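(* Let $(X,\mathfrak B,\mu)$ be a standard non-atomic $\sigma$-finite measure space with $\mu(X)=\infty$ and let $T\in\mathrm{Aut}_1(X,\mu)$. Suppose there is $\alpha>1$ such that $\alpha^{-1}<(T^n)'(x)<\alpha$ for each $n>0$ at a.e. $x\in X$. Then there is $t_0\in[0,+\infty]$ such that the Poisson suspension $(X^*,\mu_t^*,T_* )$ is conservative for each $t\in(0,t_0)$ and the Poisson suspension $(X^*,\mu_t^*,T_* )$ is totally dissipative for each $t\in(t_0,+\infty)$.
   Context: $\mathrm{Aut}(X,\mu)$ is the group of all invertible $\mu$-nonsingular transformations of $X$ (mod null sets). For $T\in\mathrm{Aut}(X,\mu)$ put $T'=\frac{d\mu\circ T^{-1}}{d\mu}$ (so $(T^n)'=\frac{d\mu\circ T^{-n}}{d\mu}$), and $\mathrm{Aut}_1(X,\mu)=\{T\in\mathrm{Aut}(X,\mu):T'-1\in L^1(X,\mu)\}$. For $t>0$, $\mu_t$ is the measure $\mu_t(A)=t\mu(A)$. Poisson suspension: $X^*$ is the space of $\mathbb Z_+\cup\{\infty\}$-valued point (counting) measures $\omega$ on $X$ with the $\sigma$-algebra generated by the maps $\omega\mapsto\omega(A)$, $A\in\mathfrak B$; for a $\sigma$-finite measure $\lambda$ on $X$, $\lambda^*$ is the probability on $X^*$ (the law of the Poisson point process of intensity $\lambda$) such that for each $A$ with $\lambda(A)<\infty$ the variable $\omega\mapsto\omega(A)$ is Poisson with parameter $\lambda(A)$, and for disjoint sets these variables are independent; $T_*\omega=\omega\circ T^{-1}$. For $T\in\mathrm{Aut}_1(X,\mu)$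 and $t>0$, $T_*$ is an invertible nonsingular transformation of $(X^*,\mu_t^* )$. An invertible nonsingular transformation $S$ of $(Y,\nu)$ is conservative if for each measurable $B$ with $\nu(B)>0$ there is $n>0$ with $\nu(S^{-n}B\cap B)>0$; it is totally dissipative if there is a measurable $B\subset Y$ such that the sets $S^nB$, $n\in\mathbb Z$, are pairwise disjoint and their union is $Y$ (mod 0). *)

theory Defs
  imports "HOL-Probability.Probability"
begin

section \<open>Measure spaces\<close>

text \<open>
  Standardness is a property of the underlying measurable space only: the \<open>\<sigma>\<close>-algebra is the
  Borel \<open>\<sigma>\<close>-algebra of some Polish topology on the carrier.
\<close>

definition standard_borel_space :: "'a measure \<Rightarrow> bool" where
  "standard_borel_space M \<longleftrightarrow>
     (\<exists>X. completely_metrizable_space X \<and> second_countable X \<and> topspace X = space M \<and>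
          sets M = sigma_sets (space M) {U. openin X U})"

definition non_atomic :: "'a measure \<Rightarrow> bool" where
  "non_atomic M \<longleftrightarrow>
     (\<forall>A\<in>sets M. 0 < emeasure M A \<longrightarrow>
        (\<exists>B\<in>sets M. B \<subseteq> A \<and> 0 < emeasure M B \<and> emeasure M B < emeasure M A))"

section \<open>Nonsingular transformations\<close>

text \<open>
  Transformations are only relevant up to null sets. They are represented by everywhere defined
  measurable maps whose inverse exists almost everywhere, so every representative of a class is
  admitted, not only the bijective ones.
\<close>

definition ae_inverse :: "'a measure \<Rightarrow> ('a \<Rightarrow> 'a) \<Rightarrow> ('a \<Rightarrow> 'a) \<Rightarrow> bool" where
  "ae_inverse M T R \<longleftrightarrow>
     R \<in> measurable M M \<and> (AE x in M. R (T x) = x) \<and> (AE x in M. T (R x) = x)"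

text \<open>The set of (representatives of) elements of \<open>Aut(X, \<mu>)\<close>.\<close>

definition Aut :: "'a measure \<Rightarrow> ('a \<Rightarrow> 'a) set" where
  "Aut M =
     {T \<in> measurable M M.
        (\<exists>R. ae_inverse M T R) \<and>
        (\<forall>A\<in>sets M. emeasure M (T -` A \<inter> space M) = 0 \<longleftrightarrow> emeasure M A = 0)}"

text \<open>The derivative \<open>T' = d(\<mu> \<circ> T\<^sup>-\<^sup>1) / d\<mu>\<close>.\<close>

definition nonsing_deriv :: "'a measure \<Rightarrow> ('a \<Rightarrow> 'a) \<Rightarrow> 'a \<Rightarrow> ennreal" where
  "nonsing_deriv M T = RN_deriv M (distr M M T)"

definition Aut1 :: "'a measure \<Rightarrow> ('a \<Rightarrow> 'a) set" where
  "Aut1 M = {T \<in> Aut M. integrable M (\<lambda>x. enn2real (nonsing_deriv M T x) - 1)}"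

definition conservative :: "'a measure \<Rightarrow> ('a \<Rightarrow> 'a) \<Rightarrow> bool" where
  "conservative N S \<longleftrightarrow>
     (\<forall>B\<in>sets N. 0 < emeasure N B \<longrightarrow>
        (\<exists>n>0. 0 < emeasure N ((S ^^ n) -` B \<inter> B)))"

text \<open>
  For \<open>R\<close> an almost everywhere inverse of \<open>S\<close>, this is the image \<open>S\<^sup>n B\<close> for \<open>n \<in> \<int>\<close>, well
  defined up to null sets; it is written as a preimage to stay within measurable sets.
\<close>

definition int_image ::
  "'a measure \<Rightarrow> ('a \<Rightarrow> 'a) \<Rightarrow> ('a \<Rightarrow> 'a) \<Rightarrow> int \<Rightarrow> 'a set \<Rightarrow> 'a set" where
  "int_image N S R n B =
     (if 0 \<le> n then (R ^^ nat n) -` B \<inter> space N else (S ^^ nat (- n)) -` B \<inter> space N)"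

definition totally_dissipative :: "'a measure \<Rightarrow> ('a \<Rightarrow> 'a) \<Rightarrow> bool" where
  "totally_dissipative N S \<longleftrightarrow>
     (\<exists>R. ae_inverse N S R \<and>
       (\<exists>B\<in>sets N.
          (\<forall>m n. m \<noteq> n \<longrightarrow> emeasure N (int_image N S R m B \<inter> int_image N S R n B) = 0) \<and>
          emeasure N (space N - (\<Union>n. int_image N S R n B)) = 0))"

section \<open>Poisson suspensions\<close>

text \<open>The measures with values in \<open>\<int>\<^sub>+ \<union> {\<infinity>}\<close> on the measurable space underlying \<open>M\<close>.\<close>

definition counting_measures :: "'a measure \<Rightarrow> 'a measure set" where
  "counting_measures M =
     {\<omega>. sets \<omega> = sets M \<and> (\<forall>A\<in>sets M. emeasure \<omega> A \<in> range of_nat \<union> {\<infinity>})}"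

text \<open>
  The measurable space \<open>X\<^sup>*\<close>. As for \<^const>\<open>subprob_algebra\<close>, only the space and the
  \<open>\<sigma>\<close>-algebra of the supremum are meaningful, not its measure.
\<close>

definition configuration_space :: "'a measure \<Rightarrow> 'a measure measure" where
  "configuration_space M =
     (SUP A \<in> sets M. vimage_algebra (counting_measures M) (\<lambda>\<omega>. emeasure \<omega> A) borel)"

text \<open>
  \<open>P\<close> is the law \<open>\<lambda>\<^sup>*\<close> of the Poisson point process with intensity \<open>\<lambda>\<close>; for \<open>\<sigma>\<close>-finite \<open>\<lambda>\<close>
  such a \<open>P\<close> exists and is unique. The formula includes \<open>\<lambda>(A) = 0\<close>, because \<open>0 ^ 0 = 1\<close>.
  Finitely many disjoint sets are covered by padding the sequence with empty sets.
\<close>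

definition poisson_law :: "'a measure \<Rightarrow> 'a measure measure \<Rightarrow> bool" where
  "poisson_law \<Lambda> P \<longleftrightarrow>
     prob_space P \<and>
     sets P = sets (configuration_space \<Lambda>) \<and>
     (\<forall>A\<in>sets \<Lambda>. emeasure \<Lambda> A < \<infinity> \<longrightarrow>
        (\<forall>k::nat. measure P {\<omega> \<in> space P. emeasure \<omega> A = of_nat k} =
                  measure \<Lambda> A ^ k / fact k * exp (- measure \<Lambda> A))) \<and>
     (\<forall>A::nat \<Rightarrow> 'a set.
        (\<forall>i. A i \<in> sets \<Lambda> \<and> emeasure \<Lambda> (A i) < \<infinity>) \<and> disjoint_family A \<longrightarrow>
        prob_space.indep_vars P (\<lambda>_. borel) (\<lambda>i \<omega>. emeasure \<omega> (A i)) UNIV)"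

text \<open>The map \<open>T\<^sub>* \<omega> = \<omega> \<circ> T\<^sup>-\<^sup>1\<close>.\<close>

definition suspension :: "'a measure \<Rightarrow> ('a \<Rightarrow> 'a) \<Rightarrow> 'a measure \<Rightarrow> 'a measure" where
  "suspension M T \<omega> = distr \<omega> M T"

lemma space_configuration_space: "space (configuration_space M) = counting_measures M"
  by (auto simp add: configuration_space_def space_Sup_eq_UN)

lemma configuration_space_cong: "sets M = sets N \<Longrightarrow> configuration_space M = configuration_space N"
  by (simp add: configuration_space_def counting_measures_def)

lemma measurable_emeasure_configuration_space [measurable]:
  "A \<in> sets M \<Longrightarrow> (\<lambda>\<omega>. emeasure \<omega> A) \<in> borel_measurable (configuration_space M)"
  by (auto intro!: measurable_Sup1 measurable_vimage_algebra1 simp: configuration_space_def)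

lemma measurable_suspension:
  assumes T: "T \<in> measurable M M"
  shows "suspension M T \<in> measurable (configuration_space M) (configuration_space M)"
proof -
  have em: "emeasure (suspension M T \<omega>) A = emeasure \<omega> (T -` A \<inter> space M)"
    if "\<omega> \<in> counting_measures M" "A \<in> sets M" for \<omega> A
  proof -
    have s: "sets \<omega> = sets M" using that(1) by (simp add: counting_measures_def)
    then have "T \<in> measurable \<omega> M" using T by (simp cong: measurable_cong_sets)
    then show ?thesis using that(2) sets_eq_imp_space_eq[OF s]
      by (simp add: suspension_def emeasure_distr)
  qed
  have pre: "T -` A \<inter> space M \<in> sets M" if "A \<in> sets M" for A
    using measurable_sets[OF T that] .
  have maps: "suspension M T \<omega> \<in> counting_measures M" if w: "\<omega> \<in> counting_measures M" for \<omega>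
  proof -
    have "sets (suspension M T \<omega>) = sets M" by (simp add: suspension_def)
    moreover have "emeasure (suspension M T \<omega>) A \<in> range of_nat \<union> {\<infinity>}" if "A \<in> sets M" for A
      unfolding em[OF w that] using w pre[OF that] unfolding counting_measures_def by blast
    ultimately show ?thesis unfolding counting_measures_def by blast
  qed
  show ?thesis
  proof (subst (2) configuration_space_def, intro measurable_SUP2)
    show "sets M \<noteq> {}" by auto
    fix A assume A: "A \<in> sets M"
    show "suspension M T \<in> measurable (configuration_space M)
            (vimage_algebra (counting_measures M) (\<lambda>\<omega>. emeasure \<omega> A) borel)"
    proof (rule measurable_vimage_algebra2)
      show "suspension M T \<in> space (configuration_space M) \<rightarrow> counting_measures M"
        using maps by (auto simp: space_configuration_space)
      have "(\<lambda>\<omega>. emeasure \<omega> (T -` A \<inter> space M)) \<in> borel_measurable (configuration_space M)"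
        using pre[OF A] by measurable
      then show "(\<lambda>\<omega>. emeasure (suspension M T \<omega>) A) \<in> borel_measurable (configuration_space M)"
        by (rule measurable_cong[THEN iffD2, rotated])
           (simp add: em[OF _ A] space_configuration_space)
    qed
  qed (simp)
qed

end

theory Submission
  imports Defs
begin

text \<open>
  Write \<open>exp (l n)\<close> for the derivative of \<open>T\<^sup>n\<close>. The suspension of \<open>T\<^sup>n\<close> has derivative
  \<open>D\<^sub>t n \<omega> = exp (- t \<integral> (exp (l n) - 1) d\<mu>) \<Prod>\<^bsub>x \<in> \<omega>\<^esub> exp (l n x)\<close> with respect to \<open>\<mu>\<^sub>t\<^sup>*\<close>, and it is
  conservative if \<open>\<Sum>n. D\<^sub>t n = \<infinity>\<close> almost everywhere and totally dissipative if \<open>\<Sum>n. D\<^sub>t n < \<infinity>\<close>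
  almost everywhere. As \<open>l\<close> is uniformly bounded, changing \<open>\<omega>\<close> on a set of finite measure changes
  \<open>D\<^sub>t n \<omega>\<close> by a factor bounded uniformly in \<open>n\<close>, so by a zero-one law one of the two cases occurs.
  Finally \<open>\<mu>\<^sub>s\<^sup>*\<close> and \<open>\<mu>\<^sub>r\<^sup>*\<close> superpose to \<open>\<mu>\<^bsub>s + r\<^esub>\<^sup>*\<close>, and \<open>D\<^bsub>s + r\<^esub> n (\<omega> + \<eta>) = D\<^sub>s n \<omega> * D\<^sub>r n \<eta>\<close> where the
  second factor has integral 1. Hence dissipativity at \<open>s\<close> implies dissipativity at \<open>s + r\<close>.

  All identities between laws are derived from the Laplace functional \<open>\<omega> \<mapsto> exp (- \<integral> f d\<omega>)\<close>.
\<close>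

section \<open>The exponential on the extended nonnegative reals\<close>

text \<open>As \<mu>(X) = \<infinity>, the product over a configuration has infinitely many factors.
  It makes sense because a bounded \<open>l n\<close> with \<open>exp (l n) - 1\<close> in L1 is
  itself integrable, so almost every configuration sums it absolutely. Its positive and negative
  parts are kept as two extended nonnegative integrals, which frees the algebra from side
  conditions. Only forward iterates enter the series. If a set never returns, its preimages are
  disjoint and have total mass at most 1, while their masses are the integrals of the derivatives
  over the set. In the other direction, a finite forward series already makes some positive function
  summable along forward orbits, which is enough to single out a last point of each orbit. The
  critical value is the infimum of the parameters with a convergent series. Below it the zero-one
  law turns the mere failure of convergence into divergence almost everywhere. Above it a smaller
  convergent parameter s exists, and the comparison with t needs a process with parameter t - s. No
  such process is given, hence the section on existence.\<close>

definition nexp :: "ennreal \<Rightarrow> ennreal" where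
  "nexp a = (if a = \<infinity> then 0 else ennreal (exp (- enn2real a)))"

text \<open>Kept apart from \<open>nexp\<close> because a sum of signed values over an infinite
  configuration need not make sense. Each of the two turns sums into products unconditionally:
  \<open>nexp\<close> is never \<infinity> and \<open>pexp\<close> is never 0.\<close>

definition pexp :: "ennreal \<Rightarrow> ennreal" where
  "pexp a = (if a = \<infinity> then \<infinity> else ennreal (exp (enn2real a)))"

lemma nexp_0 [simp]: "nexp 0 = 1" and nexp_top [simp]: "nexp \<infinity> = 0" "nexp top = 0"
  by (auto simp: nexp_def)

lemma pexp_0 [simp]: "pexp 0 = 1" and pexp_top [simp]: "pexp \<infinity> = \<infinity>" "pexp top = \<infinity>"
  by (auto simp: pexp_def)

lemma nexp_ennreal: "0 \<le> x \<Longrightarrow> nexp (ennreal x) = ennreal (exp (- x))"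
  by (simp add: nexp_def)

lemma pexp_ennreal: "0 \<le> x \<Longrightarrow> pexp (ennreal x) = ennreal (exp x)"
  by (simp add: pexp_def)

lemma nexp_add: "nexp (a + b) = nexp a * nexp b"
  by (cases a; cases b)
     (auto simp: nexp_ennreal exp_add exp_diff divide_inverse exp_minus ennreal_mult
           simp flip: ennreal_plus)

lemma pexp_add: "pexp (a + b) = pexp a * pexp b"
  by (cases a; cases b)
     (auto simp: pexp_ennreal exp_add ennreal_mult ennreal_top_mult ennreal_mult_top
           simp flip: ennreal_plus)

lemma nexp_sum: "finite I \<Longrightarrow> nexp (\<Sum>i\<in>I. f i) = (\<Prod>i\<in>I. nexp (f i))"
  by (induction I rule: finite_induct) (auto simp: nexp_add)

lemma nexp_pexp: "a \<noteq> \<infinity> \<Longrightarrow> nexp a * pexp a = 1"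
  by (cases a) (auto simp: nexp_ennreal pexp_ennreal exp_minus simp flip: ennreal_mult)

lemma nexp_le_1: "nexp a \<le> 1"
  by (cases a) (auto simp: nexp_ennreal)

lemma nexp_mono: "a \<le> b \<Longrightarrow> nexp b \<le> nexp a"
  by (cases a; cases b) (auto simp: nexp_ennreal top_unique)

lemma nexp_eq_0_iff: "nexp a = 0 \<longleftrightarrow> a = \<infinity>"
  by (cases a) (auto simp: nexp_ennreal)

lemma nexp_not_top [simp]: "nexp a \<noteq> top" "nexp a < top"
  by (cases a; auto simp: nexp_ennreal)+

lemma pexp_ge_1: "1 \<le> pexp a"
  by (cases a) (auto simp: pexp_ennreal)

lemma pexp_mono: "a \<le> b \<Longrightarrow> pexp a \<le> pexp b"
  by (cases a; cases b) (auto simp: pexp_ennreal top_unique)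

lemma pexp_eq_top_iff: "pexp a = \<infinity> \<longleftrightarrow> a = \<infinity>" "pexp a = top \<longleftrightarrow> a = top"
  by (cases a; auto simp: pexp_ennreal)+

lemma measurable_nexp [measurable]: "nexp \<in> borel_measurable borel"
  unfolding nexp_def[abs_def] by measurable

lemma measurable_pexp [measurable]: "pexp \<in> borel_measurable borel"
  unfolding pexp_def[abs_def] by measurable

text \<open>Continuity at \<infinity> is included, because limits of Laplace functionals are also
  taken at configurations where the integral diverges.\<close>

lemma tendsto_nexp:
  assumes "(f \<longlongrightarrow> a) F"
  shows "((\<lambda>x. nexp (f x)) \<longlongrightarrow> nexp a) F"
proof (cases a)
  case (real r)
  have ev: "eventually (\<lambda>x. f x < top) F"
    using assms real by (intro order_tendstoD(2)[of f a]) auto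
  have "((\<lambda>x. ennreal (exp (- enn2real (f x)))) \<longlongrightarrow> ennreal (exp (- r))) F"
    using real assms by (intro tendsto_ennrealI tendsto_intros tendsto_enn2real) auto
  then have "((\<lambda>x. nexp (f x)) \<longlongrightarrow> ennreal (exp (- r))) F"
    by (rule Lim_transform_eventually) (use ev in \<open>auto simp: nexp_def elim!: eventually_mono\<close>)
  then show ?thesis using real by (simp add: nexp_ennreal)
next
  case top
  have "((\<lambda>x. nexp (f x)) \<longlongrightarrow> 0) F"
  proof (rule order_tendstoI)
    fix e :: ennreal assume e: "0 < e"
    obtain y where y: "0 < y" "y < e" using dense[OF e] by auto
    then obtain r where r: "0 < r" "ennreal r < e" by (cases y) auto
    have "eventually (\<lambda>x. ennreal (max 0 (- ln r)) < f x) F"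
      using assms top by (intro order_tendstoD(1)[of f a]) auto
    \<comment> \<open>exp (- x) reaches r at x = - ln r; for r \<ge> 1 the threshold 0 is
      enough.\<close>
    then show "eventually (\<lambda>x. nexp (f x) < e) F"
    proof (rule eventually_mono)
      fix x assume "ennreal (max 0 (- ln r)) < f x"
      then have "nexp (f x) \<le> nexp (ennreal (max 0 (- ln r)))"
        by (intro nexp_mono) auto
      also have "\<dots> \<le> ennreal r"
        using r by (simp add: nexp_ennreal max_def ennreal_leI exp_minus ln_ge_zero_iff)
      finally show "nexp (f x) < e" using r by simp
    qed
  qed auto
  then show ?thesis using top by simp
qed

text \<open>The integrand of the Poisson exponent: for intensity \<lambda>, the mean of exp (-
  \<integral> f d\<omega>) is exp (- \<integral> (1 - exp (- f)) d\<lambda>).\<close>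

definition cexp :: "ennreal \<Rightarrow> ennreal" where
  "cexp a = 1 - nexp a"

lemma cexp_0 [simp]: "cexp 0 = 0" and cexp_top [simp]: "cexp \<infinity> = 1" "cexp top = 1"
  by (auto simp: cexp_def)

lemma cexp_ennreal: "0 \<le> x \<Longrightarrow> cexp (ennreal x) = ennreal (1 - exp (- x))"
  by (simp add: cexp_def nexp_ennreal ennreal_minus flip: ennreal_1)

lemma cexp_nexp: "cexp a + nexp a = 1"
  unfolding cexp_def using nexp_le_1 by (simp add: diff_add_cancel_ennreal)

lemma cexp_le: "cexp a \<le> a"
proof (cases a)
  case (real r)
  then show ?thesis using exp_ge_add_one_self[of "-r"] by (simp add: cexp_ennreal ennreal_leI)
qed simp

lemma cexp_mono: "a \<le> b \<Longrightarrow> cexp a \<le> cexp b"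
  unfolding cexp_def by (intro ennreal_minus_mono nexp_mono) auto

lemma measurable_cexp [measurable]: "cexp \<in> borel_measurable borel"
  unfolding cexp_def[abs_def] by measurable

lemma tendsto_cexp: "(f \<longlongrightarrow> a) F \<Longrightarrow> ((\<lambda>x. cexp (f x)) \<longlongrightarrow> cexp a) F"
  unfolding cexp_def by (intro tendsto_diff_ennreal_general tendsto_nexp tendsto_const) auto

text \<open>Lets the mean of exp (- c Y) tend to the probability of Y < \<infinity> as c falls to 0.
  The factor is never 0, so an infinite \<open>a\<close> gives 0 for every n.\<close>

lemma nexp_mult_limit:
  "(\<lambda>n. nexp (ennreal (1 / real (Suc n)) * a)) \<longlonglongrightarrow> (if a = \<infinity> then 0 else 1)"
proof (cases a)
  case (real r)
  have "(\<lambda>n. 1 / real (Suc n) * r) \<longlonglongrightarrow> 0 * r"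
    by (intro tendsto_intros LIMSEQ_Suc[OF lim_1_over_n])
  then have "(\<lambda>n. nexp (ennreal (1 / real (Suc n) * r))) \<longlonglongrightarrow> nexp (ennreal (0 * r))"
    by (intro tendsto_nexp tendsto_ennrealI)
  then show ?thesis using real by (simp flip: ennreal_mult)
next
  case top
  then show ?thesis by (simp add: ennreal_mult_top)
qed

section \<open>Configurations and the Laplace functional\<close>

lemma counting_measures_sets: "\<omega> \<in> counting_measures M \<Longrightarrow> sets \<omega> = sets M"
  by (simp add: counting_measures_def)

lemma counting_measures_cases:
  assumes "\<omega> \<in> counting_measures M"
  obtains "emeasure \<omega> A = \<infinity>" | k :: nat where "emeasure \<omega> A = of_nat k"
proof (cases "A \<in> sets M")
  case True
  then have "emeasure \<omega> A \<in> range of_nat \<union> {\<infinity>}"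
    using assms unfolding counting_measures_def by blast
  then show ?thesis using that by auto
next
  case False
  then show ?thesis using assms that(2)[of 0] by (simp add: counting_measures_def emeasure_notin_sets)
qed

lemma measurable_configuration_spaceI:
  assumes "\<And>x. x \<in> space N \<Longrightarrow> g x \<in> counting_measures M"
    and "\<And>A. A \<in> sets M \<Longrightarrow> (\<lambda>x. emeasure (g x) A) \<in> borel_measurable N"
  shows "g \<in> measurable N (configuration_space M)"
  unfolding configuration_space_def
proof (intro measurable_SUP2)
  show "sets M \<noteq> {}" by auto
  fix A assume A: "A \<in> sets M"
  show "g \<in> measurable N (vimage_algebra (counting_measures M) (\<lambda>\<omega>. emeasure \<omega> A) borel)"
    using assms A by (intro measurable_vimage_algebra2) auto
qed simp

lemma measurable_counting_measures:
  "\<omega> \<in> counting_measures M \<Longrightarrow> f \<in> measurable M N \<Longrightarrow> f \<in> measurable \<omega> N"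
  by (simp add: counting_measures_sets cong: measurable_cong_sets)

lemma counting_measures_space: "\<omega> \<in> counting_measures M \<Longrightarrow> space \<omega> = space M"
  by (rule sets_eq_imp_space_eq[OF counting_measures_sets])

lemma measurable_nn_integral_configuration [measurable]:
  assumes "f \<in> borel_measurable M"
  shows "(\<lambda>\<omega>. \<integral>\<^sup>+x. f x \<partial>\<omega>) \<in> borel_measurable (configuration_space M)"
  using assms
proof (induction f rule: borel_measurable_induct)
  case (cong f g)
  have "(\<integral>\<^sup>+x. f x \<partial>\<omega>) = (\<integral>\<^sup>+x. g x \<partial>\<omega>)" if "\<omega> \<in> space (configuration_space M)" for \<omega>
    using cong(3) that
    by (intro nn_integral_cong)
       (simp add: space_configuration_space counting_measures_sets[THEN sets_eq_imp_space_eq])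
  then show ?case using cong(4) by (rule measurable_cong[THEN iffD2])
next
  case (set A)
  have "emeasure \<omega> A = (\<integral>\<^sup>+x. indicator A x \<partial>\<omega>)" if "\<omega> \<in> space (configuration_space M)" for \<omega>
    using set that by (intro nn_integral_indicator[symmetric])
       (simp add: space_configuration_space counting_measures_sets)
  then show ?case
    by (rule measurable_cong[THEN iffD1]) (simp_all add: set measurable_emeasure_configuration_space)
next
  case (mult u c)
  have "c * (\<integral>\<^sup>+x. u x \<partial>\<omega>) = (\<integral>\<^sup>+x. c * u x \<partial>\<omega>)" if "\<omega> \<in> space (configuration_space M)" for \<omega>
    using that unfolding space_configuration_space
    by (intro nn_integral_cmult[symmetric] measurable_counting_measures[OF _ mult(2)])
  then show ?case
    by (rule measurable_cong[THEN iffD1]) (assumption, intro borel_measurable_times_ennreal mult borel_measurable_const)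
next
  case (add u v)
  have "(\<integral>\<^sup>+x. v x \<partial>\<omega>) + (\<integral>\<^sup>+x. u x \<partial>\<omega>) = (\<integral>\<^sup>+x. v x + u x \<partial>\<omega>)" if "\<omega> \<in> space (configuration_space M)" for \<omega>
    using that unfolding space_configuration_space
    by (intro nn_integral_add[symmetric] measurable_counting_measures[OF _ add.hyps(1)]
          measurable_counting_measures[OF _ add.hyps(3)])
  then show ?case
    by (rule measurable_cong[THEN iffD1]) (assumption, intro borel_measurable_add add)
next
  case (seq U)
  have "(SUP i. \<integral>\<^sup>+x. U i x \<partial>\<omega>) = (\<integral>\<^sup>+x. (SUP i. U i) x \<partial>\<omega>)" if "\<omega> \<in> space (configuration_space M)" for \<omega>
    using that unfolding SUP_apply space_configuration_space
    by (intro nn_integral_monotone_convergence_SUP[symmetric] seq measurable_counting_measures[OF _ seq(1)])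
  then show ?case
    by (rule measurable_cong[THEN iffD1]) (assumption, intro borel_measurable_SUP seq countableI_type)
qed

definition lap :: "('a \<Rightarrow> ennreal) \<Rightarrow> 'a measure \<Rightarrow> ennreal" where
  "lap f \<omega> = nexp (\<integral>\<^sup>+x. f x \<partial>\<omega>)"

lemma measurable_lap [measurable]:
  "f \<in> borel_measurable M \<Longrightarrow> lap f \<in> borel_measurable (configuration_space M)"
  unfolding lap_def[abs_def] by measurable

lemma lap_le_1: "lap f \<omega> \<le> 1"
  by (simp add: lap_def nexp_le_1)

lemma lap_add:
  "\<omega> \<in> counting_measures M \<Longrightarrow> f \<in> borel_measurable M \<Longrightarrow> g \<in> borel_measurable M \<Longrightarrow>
   lap (\<lambda>x. f x + g x) \<omega> = lap f \<omega> * lap g \<omega>"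
  by (simp add: lap_def nn_integral_add measurable_counting_measures nexp_add)

section \<open>The Laplace functional determines a law\<close>

text \<open>A tilting argument. With N the number of points in \<open>A\<close>, the weight exp (n
  (k - N)) leaves N = k untouched and kills N > k in the limit; N < k, where the weight would
  explode, is cut off by the indicator. The weights are then at most 1, so the limit passes through
  the integral.\<close>

lemma cylinder_limit:
  assumes P: "finite_measure P" and sP: "sets P = sets (configuration_space M)"
    and G: "G \<in> sets P" and A: "A \<in> sets M" and f: "f \<in> borel_measurable M"
  shows "(\<lambda>n. ennreal (exp (real (Suc n) * real k)) *
            (\<integral>\<^sup>+\<omega>. indicator (G \<inter> {\<omega>\<in>space P. of_nat k \<le> emeasure \<omega> A}) \<omega> *
               lap (\<lambda>x. f x + ennreal (real (Suc n)) * indicator A x) \<omega> \<partial>P))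
         \<longlonglongrightarrow> (\<integral>\<^sup>+\<omega>. indicator (G \<inter> {\<omega>\<in>space P. emeasure \<omega> A = of_nat k}) \<omega> * lap f \<omega> \<partial>P)"
proof -
  interpret finite_measure P by fact
  note [measurable_cong] = sP
  note [measurable] = G A f
  have spP: "space P = counting_measures M"
    using sets_eq_imp_space_eq[OF sP] by (simp add: space_configuration_space)
  let ?u = "\<lambda>n \<omega>. ennreal (exp (real (Suc n) * real k)) *
         (indicator (G \<inter> {\<omega>\<in>space P. of_nat k \<le> emeasure \<omega> A}) \<omega> *
               lap (\<lambda>x. f x + ennreal (real (Suc n)) * indicator A x) \<omega>)"
  have eq: "?u n \<omega> = indicator G \<omega> * lap f \<omega> *
      (case emeasure \<omega> A of a \<Rightarrow> indicator {of_nat k..} a * (ennreal (exp (real (Suc n) * real k)) * nexp (ennreal (real (Suc n)) * a)))"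
    if w: "\<omega> \<in> space P" for n \<omega>
  proof -
    have "lap (\<lambda>x. f x + ennreal (real (Suc n)) * indicator A x) \<omega>
      = lap f \<omega> * lap (\<lambda>x. ennreal (real (Suc n)) * indicator A x) \<omega>"
      using w by (intro lap_add[of _ M]) (auto simp: spP)
    also have "lap (\<lambda>x. ennreal (real (Suc n)) * indicator A x) \<omega> = nexp (ennreal (real (Suc n)) * emeasure \<omega> A)"
      unfolding lap_def using w by (subst nn_integral_cmult_indicator) (auto simp: spP counting_measures_sets)
    finally show ?thesis using w by (auto simp: indicator_def ac_simps)
  qed
  have val: "ennreal (exp (real (Suc n) * real k)) * nexp (ennreal (real (Suc n)) * of_nat j)
     = ennreal (exp (real (Suc n) * (real k - real j)))" for j n :: nat
  proof -
    have "ennreal (real (Suc n)) * of_nat j = ennreal (real (Suc n) * real j)"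
      by (simp add: ennreal_of_nat_eq_real_of_nat ennreal_mult del: of_nat_Suc)
    moreover have "real (Suc n) * real k - real (Suc n) * real j = real (Suc n) * (real k - real j)"
      by (simp only: right_diff_distrib)
    ultimately show ?thesis
      by (simp add: nexp_ennreal flip: ennreal_mult exp_add del: of_nat_Suc)
  qed
  \<comment> \<open>This is why the coefficient is \<open>Suc n\<close>: a coefficient 0 would give
    0 * \<infinity> = 0 and leave infinite counts undamped.\<close>
  have top: "ennreal (real (Suc n)) * \<infinity> = \<infinity>" for n :: nat
    by (simp add: ennreal_mult_top del: of_nat_Suc)
  have "(\<lambda>n. \<integral>\<^sup>+\<omega>. ?u n \<omega> \<partial>P) \<longlonglongrightarrow> (\<integral>\<^sup>+\<omega>. indicator (G \<inter> {\<omega>\<in>space P. emeasure \<omega> A = of_nat k}) \<omega> * lap f \<omega> \<partial>P)"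
  proof (rule nn_integral_dominated_convergence[where w="\<lambda>_. 1"])
    show "AE \<omega> in P. ?u n \<omega> \<le> 1" for n
    proof (rule AE_I2)
      fix \<omega> assume w: "\<omega> \<in> space P"
      have "(case emeasure \<omega> A of a \<Rightarrow> indicator {of_nat k..} a * (ennreal (exp (real (Suc n) * real k)) * nexp (ennreal (real (Suc n)) * a))) \<le> 1"
        by (rule counting_measures_cases[OF w[unfolded spP], of A])
           (auto simp: top val indicator_def mult_nonneg_nonpos simp del: of_nat_Suc)
      moreover have "indicator G \<omega> * lap f \<omega> \<le> 1" using lap_le_1[of f \<omega>] by (auto simp: indicator_def)
      ultimately show "?u n \<omega> \<le> 1" unfolding eq[OF w] using mult_mono[of _ "1::ennreal" _ "1::ennreal"] by simp
    qed
    show "AE \<omega> in P. (\<lambda>n. ?u n \<omega>) \<longlonglongrightarrow> indicator (G \<inter> {\<omega>\<in>space P. emeasure \<omega> A = of_nat k}) \<omega> * lap f \<omega>"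
    proof (rule AE_I2)
      fix \<omega> assume w: "\<omega> \<in> space P"
      have "(\<lambda>n. case emeasure \<omega> A of a \<Rightarrow> indicator {of_nat k..} a * (ennreal (exp (real (Suc n) * real k)) * nexp (ennreal (real (Suc n)) * a)))
         \<longlonglongrightarrow> indicator {of_nat k} (emeasure \<omega> A)"
      proof (rule counting_measures_cases[OF w[unfolded spP], of A])
        assume "emeasure \<omega> A = \<infinity>"
        then show ?thesis by (simp add: top indicator_def del: of_nat_Suc)
      next
        fix j assume j: "emeasure \<omega> A = of_nat j"
        consider "j < k" | "j = k" | "k < j" by linarith
        then show ?thesis
        proof cases
          case 3
          have "(\<lambda>n. exp (real (Suc n) * (real k - real j))) \<longlonglongrightarrow> 0"
            using 3 by real_asymp
          then have "(\<lambda>n. ennreal (exp (real (Suc n) * (real k - real j)))) \<longlonglongrightarrow> ennreal 0"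
            by (rule tendsto_ennrealI)
          then show ?thesis using 3 by (simp add: j val del: of_nat_Suc)
        qed (auto simp: j val simp del: of_nat_Suc)
      qed
      then have "(\<lambda>n. ?u n \<omega>) \<longlonglongrightarrow> indicator G \<omega> * lap f \<omega> * indicator {of_nat k} (emeasure \<omega> A)"
        unfolding eq[OF w] using lap_le_1[of f \<omega>]
        by (intro ennreal_tendsto_cmult) (auto simp: indicator_def lap_def)
      then show "(\<lambda>n. ?u n \<omega>) \<longlonglongrightarrow> indicator (G \<inter> {\<omega>\<in>space P. emeasure \<omega> A = of_nat k}) \<omega> * lap f \<omega>"
        using w by (auto simp: indicator_def split: if_splits)
    qed
    show "(\<integral>\<^sup>+ x. 1 \<partial>P) < \<infinity>" by (simp add: less_top[symmetric])
  qed auto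
  then show ?thesis by (subst (asm) nn_integral_cmult) auto
qed

text \<open>Induction on k: agreement on counts at least k yields agreement on counts equal to k by
  \<open>cylinder_limit\<close>, and subtracting the two, which are finite, yields counts at least k
  + 1. The hypothesis ranges over all \<open>f\<close> because the limit adds multiples of
  \<open>indicator A\<close> to \<open>f\<close>.\<close>

lemma laplace_cylinder:
  assumes P: "finite_measure P" and Q: "finite_measure Q"
    and sP: "sets P = sets (configuration_space M)" and sQ: "sets Q = sets (configuration_space M)"
    and inv: "\<And>f. f \<in> borel_measurable M \<Longrightarrow>
      (\<integral>\<^sup>+\<omega>. indicator G \<omega> * lap f \<omega> \<partial>P) = (\<integral>\<^sup>+\<omega>. indicator G \<omega> * lap f \<omega> \<partial>Q)"
    and G: "G \<in> sets P" and A: "A \<in> sets M"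
    and f: "f \<in> borel_measurable M"
  shows "(\<integral>\<^sup>+\<omega>. indicator (G \<inter> {\<omega>\<in>space P. emeasure \<omega> A = of_nat k}) \<omega> * lap f \<omega> \<partial>P) =
         (\<integral>\<^sup>+\<omega>. indicator (G \<inter> {\<omega>\<in>space P. emeasure \<omega> A = of_nat k}) \<omega> * lap f \<omega> \<partial>Q)"
proof -
  note [measurable_cong] = sP sQ
  have G' [measurable]: "G \<in> sets (configuration_space M)" using G sP by simp
  note [measurable] = A f
  have spaces: "space Q = space P" using sP sQ by (metis sets_eq_imp_space_eq)
  let ?ge = "\<lambda>k. G \<inter> {\<omega>\<in>space P. of_nat k \<le> emeasure \<omega> A}"
  let ?eq = "\<lambda>k. G \<inter> {\<omega>\<in>space P. emeasure \<omega> A = of_nat k}"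
  let ?Inv = "\<lambda>H. \<forall>f\<in>borel_measurable M. (\<integral>\<^sup>+\<omega>. indicator H \<omega> * lap f \<omega> \<partial>P) = (\<integral>\<^sup>+\<omega>. indicator H \<omega> * lap f \<omega> \<partial>Q)"
  have spP: "space P = counting_measures M"
    using sets_eq_imp_space_eq[OF sP] by (simp add: space_configuration_space)
  have step: "?Inv (?eq k)" if "?Inv (?ge k)" for k
  proof
    fix g :: "'a \<Rightarrow> ennreal" assume g [measurable]: "g \<in> borel_measurable M"
    have m: "(\<lambda>x. g x + ennreal (real (Suc n)) * indicator A x) \<in> borel_measurable M" for n by measurable
    show "(\<integral>\<^sup>+\<omega>. indicator (?eq k) \<omega> * lap g \<omega> \<partial>P) = (\<integral>\<^sup>+\<omega>. indicator (?eq k) \<omega> * lap g \<omega> \<partial>Q)"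
      using cylinder_limit[OF P sP G A g, of k] cylinder_limit[OF Q sQ _ A g, of G k] that m G'
      unfolding spaces by (intro LIMSEQ_unique) (simp_all add: sQ)
  qed
  have split: "(\<integral>\<^sup>+\<omega>. indicator (?ge k) \<omega> * lap g \<omega> \<partial>R) =
      (\<integral>\<^sup>+\<omega>. indicator (?eq k) \<omega> * lap g \<omega> \<partial>R) + (\<integral>\<^sup>+\<omega>. indicator (?ge (Suc k)) \<omega> * lap g \<omega> \<partial>R)"
    if R: "sets R = sets (configuration_space M)" and g [measurable]: "g \<in> borel_measurable M"
    for k g and R :: "'a measure measure"
  proof -
    note [measurable_cong] = R
    have sR: "space R = space P" using R sP by (metis sets_eq_imp_space_eq)
    have d: "indicator (?ge k) \<omega> = (indicator (?eq k) \<omega> + indicator (?ge (Suc k)) \<omega> :: ennreal)" if w: "\<omega> \<in> space P" for \<omega>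
    proof (rule counting_measures_cases[OF w[unfolded spP], of A])
      assume "emeasure \<omega> A = \<infinity>" then show ?thesis using w by (auto simp: indicator_def)
    next
      fix j assume j: "emeasure \<omega> A = of_nat j"
      have "of_nat (Suc k) \<le> (of_nat j :: ennreal) \<longleftrightarrow> Suc k \<le> j" by (rule of_nat_le_iff)
      with j show ?thesis using w by (auto simp: indicator_def simp del: of_nat_Suc)
    qed
    have "(\<integral>\<^sup>+\<omega>. indicator (?ge k) \<omega> * lap g \<omega> \<partial>R) = (\<integral>\<^sup>+\<omega>. indicator (?eq k) \<omega> * lap g \<omega> + indicator (?ge (Suc k)) \<omega> * lap g \<omega> \<partial>R)"
      by (intro nn_integral_cong) (simp only: d sR distrib_right)
    also have "\<dots> = (\<integral>\<^sup>+\<omega>. indicator (?eq k) \<omega> * lap g \<omega> \<partial>R) + (\<integral>\<^sup>+\<omega>. indicator (?ge (Suc k)) \<omega> * lap g \<omega> \<partial>R)"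
      unfolding spaces[symmetric]
      by (intro nn_integral_add) (simp_all add: sR[symmetric] spaces[symmetric], measurable)
    finally show ?thesis .
  qed
  have fin: "(\<integral>\<^sup>+\<omega>. indicator H \<omega> * lap g \<omega> \<partial>R) \<noteq> top" if "finite_measure R" for H g and R :: "'a measure measure"
  proof -
    interpret finite_measure R by fact
    have "(\<integral>\<^sup>+\<omega>. indicator H \<omega> * lap g \<omega> \<partial>R) \<le> (\<integral>\<^sup>+\<omega>. 1 \<partial>R)"
      using lap_le_1[of g] by (intro nn_integral_mono) (auto simp: indicator_def)
    then show ?thesis by (auto simp: top_unique)
  qed
  have ge: "?Inv (?ge k)" for k
  proof (induction k)
    case 0
    have "G \<inter> {\<omega>\<in>space P. of_nat 0 \<le> emeasure \<omega> A} = G" using sets.sets_into_space[OF G] by auto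
    moreover have "?Inv G" by (intro ballI inv)
    ultimately show ?case by (rule ssubst)
  next
    case (Suc k)
    show ?case
    proof
      fix g :: "'a \<Rightarrow> ennreal" assume g: "g \<in> borel_measurable M"
      show "(\<integral>\<^sup>+\<omega>. indicator (?ge (Suc k)) \<omega> * lap g \<omega> \<partial>P) = (\<integral>\<^sup>+\<omega>. indicator (?ge (Suc k)) \<omega> * lap g \<omega> \<partial>Q)"
      proof -
        have "(\<integral>\<^sup>+\<omega>. indicator (?eq k) \<omega> * lap g \<omega> \<partial>Q) + (\<integral>\<^sup>+\<omega>. indicator (?ge (Suc k)) \<omega> * lap g \<omega> \<partial>P)
            = (\<integral>\<^sup>+\<omega>. indicator (?eq k) \<omega> * lap g \<omega> \<partial>Q) + (\<integral>\<^sup>+\<omega>. indicator (?ge (Suc k)) \<omega> * lap g \<omega> \<partial>Q)"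
          using split[OF sP g, of k] split[OF sQ g, of k] Suc[rule_format, OF g] step[OF Suc, rule_format, OF g]
          by (simp only:)
        then show ?thesis using fin[OF Q, of "?eq k" g] unfolding ennreal_add_left_cancel by (simp only: infinity_ennreal_def simp_thms)
      qed
    qed
  qed
  show ?thesis using step[OF ge] f by blast
qed

section \<open>Cylinder sets of prescribed counts\<close>

definition cylinder :: "'a measure \<Rightarrow> ('a set \<times> nat) list \<Rightarrow> 'a measure set" where
  "cylinder M xs = {\<omega> \<in> counting_measures M. \<forall>(A, k) \<in> set xs. emeasure \<omega> A = of_nat k}"

text \<open>Lists make intersection a concatenation, which gives stability under intersections. The
  count \<infinity> is never prescribed; it is the complement of the countably many finite
  counts.\<close>

definition cylinders :: "'a measure \<Rightarrow> 'a measure set set" where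
  "cylinders M = cylinder M ` {xs. \<forall>(A, k) \<in> set xs. A \<in> sets M}"

lemma cylinder_Cons:
  "cylinder M ((A, k) # xs) = cylinder M xs \<inter> {\<omega>\<in>counting_measures M. emeasure \<omega> A = of_nat k}"
  by (auto simp: cylinder_def)

lemma cylinder_append: "cylinder M (xs @ ys) = cylinder M xs \<inter> cylinder M ys"
  by (auto simp: cylinder_def)

lemma sets_cylinder:
  "\<forall>(A, k) \<in> set xs. A \<in> sets M \<Longrightarrow> cylinder M xs \<in> sets (configuration_space M)"
proof (induction xs)
  case Nil
  have "cylinder M [] = space (configuration_space M)"
    by (simp add: cylinder_def space_configuration_space)
  then show ?case by simp
next
  case (Cons a xs)
  obtain A k where a: "a = (A, k)" by force
  have [measurable]: "A \<in> sets M" "cylinder M xs \<in> sets (configuration_space M)" using Cons a by auto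
  have "cylinder M xs \<inter> {\<omega>\<in>space (configuration_space M). emeasure \<omega> A = of_nat k} \<in> sets (configuration_space M)"
    by measurable
  then show ?case unfolding a cylinder_Cons space_configuration_space .
qed

lemma sets_configuration_space:
  "sets (configuration_space M) = sigma_sets (counting_measures M) (cylinders M)"
proof
  have sub: "cylinders M \<subseteq> sets (configuration_space M)"
    unfolding cylinders_def using sets_cylinder by blast
  then show "sigma_sets (counting_measures M) (cylinders M) \<subseteq> sets (configuration_space M)"
    using sets.sigma_sets_subset[OF sub] by (simp add: space_configuration_space)
  define S where "S = sigma (counting_measures M) (cylinders M)"
  have pow: "cylinders M \<subseteq> Pow (counting_measures M)"
    by (auto simp: cylinders_def cylinder_def)
  have spS: "space S = counting_measures M" unfolding S_def using pow by (simp add: space_measure_of)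
  have seS: "sets S = sigma_sets (counting_measures M) (cylinders M)"
    unfolding S_def using pow by (simp add: sets_measure_of)
  have idS: "(\<lambda>\<omega>. \<omega>) \<in> measurable S (configuration_space M)"
  proof (rule measurable_configuration_spaceI)
    fix A assume A: "A \<in> sets M"
    let ?E = "\<lambda>k. {\<omega>\<in>space S. emeasure \<omega> A = of_nat k}"
    have E: "?E k \<in> sets S" for k
    proof -
      have "?E k = cylinder M [(A, k)]" by (auto simp: cylinder_def spS)
      moreover have "cylinder M [(A, k)] \<in> cylinders M" using A by (auto simp: cylinders_def)
      ultimately show ?thesis unfolding seS by auto
    qed
    show "(\<lambda>\<omega>. emeasure \<omega> A) \<in> borel_measurable S"
    proof (rule measurableI)
      fix B :: "ennreal set"
      \<comment> \<open>\<open>emeasure \<omega> A\<close> takes countably many values, so the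
        preimage of any set whatsoever is measurable.\<close>
      let ?U = "\<Union>k\<in>{k. of_nat k \<in> B}. ?E k"
      have c: "(\<exists>k. emeasure \<omega> A = of_nat k) \<or> emeasure \<omega> A = \<infinity>" if "\<omega> \<in> space S" for \<omega>
        by (rule counting_measures_cases[OF that[unfolded spS], of A]) auto
      have "(\<lambda>\<omega>. emeasure \<omega> A) -` B \<inter> space S = (if \<infinity> \<in> B then ?U \<union> (space S - (\<Union>k. ?E k)) else ?U)"
        using c by (auto split: if_splits) (metis infinity_ennreal_def)+
      also have "\<dots> \<in> sets S" using E by auto
      finally show "(\<lambda>\<omega>. emeasure \<omega> A) -` B \<inter> space S \<in> sets S" .
    qed simp
  qed (simp add: spS)
  show "sets (configuration_space M) \<subseteq> sigma_sets (counting_measures M) (cylinders M)"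
  proof (intro subsetI)
    fix X assume X: "X \<in> sets (configuration_space M)"
    then have "X \<subseteq> space S" using sets.sets_into_space[OF X] by (simp add: spS space_configuration_space)
    moreover have "(\<lambda>\<omega>. \<omega>) -` X \<inter> space S \<in> sets S"
      using idS X by (rule measurable_sets)
    ultimately show "X \<in> sigma_sets (counting_measures M) (cylinders M)"
      by (simp add: seS Int_absorb2)
  qed
qed

lemma laplace_unique:
  assumes P: "finite_measure P" and Q: "finite_measure Q"
    and sP: "sets P = sets (configuration_space M)" and sQ: "sets Q = sets (configuration_space M)"
    and lap: "\<And>f. f \<in> borel_measurable M \<Longrightarrow> (\<integral>\<^sup>+\<omega>. lap f \<omega> \<partial>P) = (\<integral>\<^sup>+\<omega>. lap f \<omega> \<partial>Q)"
  shows "P = Q"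
proof (rule measure_eqI_generator_eq[where E="cylinders M" and \<Omega>="counting_measures M" and A="\<lambda>_. counting_measures M"])
  have spP: "space P = counting_measures M" and spQ: "space Q = counting_measures M"
    using sets_eq_imp_space_eq[OF sP] sets_eq_imp_space_eq[OF sQ] by (simp_all add: space_configuration_space)
  show "Int_stable (cylinders M)"
  proof (rule Int_stableI)
    fix a b assume "a \<in> cylinders M" "b \<in> cylinders M"
    then obtain xs ys where *: "a = cylinder M xs" "b = cylinder M ys"
      "\<forall>(A, k) \<in> set xs. A \<in> sets M" "\<forall>(A, k) \<in> set ys. A \<in> sets M"
      by (auto simp: cylinders_def)
    have "a \<inter> b = cylinder M (xs @ ys)" by (simp add: * cylinder_append)
    moreover have "\<forall>(A, k) \<in> set (xs @ ys). A \<in> sets M" using * by auto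
    ultimately show "a \<inter> b \<in> cylinders M" unfolding cylinders_def by blast
  qed
  show "cylinders M \<subseteq> Pow (counting_measures M)"
    by (auto simp: cylinders_def cylinder_def)
  have inv: "\<forall>f\<in>borel_measurable M. (\<integral>\<^sup>+\<omega>. indicator (cylinder M xs) \<omega> * lap f \<omega> \<partial>P) =
       (\<integral>\<^sup>+\<omega>. indicator (cylinder M xs) \<omega> * lap f \<omega> \<partial>Q)" if "\<forall>(A, k) \<in> set xs. A \<in> sets M" for xs
    using that
  proof (induction xs)
    case Nil
    have "(\<integral>\<^sup>+\<omega>. indicator (cylinder M []) \<omega> * lap f \<omega> \<partial>R) = (\<integral>\<^sup>+\<omega>. lap f \<omega> \<partial>R)"
      if "space R = counting_measures M" for f and R :: "'a measure measure"
      using that by (intro nn_integral_cong) (auto simp: cylinder_def)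
    then show ?case using lap by (simp add: spP spQ)
  next
    case (Cons a xs)
    obtain A k where a: "a = (A, k)" by force
    have A: "A \<in> sets M" and xs: "\<forall>(A, k) \<in> set xs. A \<in> sets M" using Cons.prems a by auto
    have "cylinder M xs \<in> sets P" using sets_cylinder[OF xs] sP by simp
    from laplace_cylinder[OF P Q sP sQ Cons.IH[OF xs, rule_format] this A, of _ k]
    show ?case unfolding a cylinder_Cons spP by blast
  qed
  show "emeasure P X = emeasure Q X" if XC: "X \<in> cylinders M" for X
  proof -
    obtain xs where xs: "X = cylinder M xs" "\<forall>(A, k) \<in> set xs. A \<in> sets M"
      using XC unfolding cylinders_def by blast
    have X: "X \<in> sets P" "X \<in> sets Q" using sets_cylinder[OF xs(2)] xs(1) sP sQ by auto
    have "(\<integral>\<^sup>+\<omega>. indicator X \<omega> * lap (\<lambda>_. 0) \<omega> \<partial>P) = (\<integral>\<^sup>+\<omega>. indicator X \<omega> * lap (\<lambda>_. 0) \<omega> \<partial>Q)"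
      unfolding xs(1) using inv[OF xs(2)] by simp
    then show ?thesis using X by (simp add: lap_def)
  qed
  show "sets P = sigma_sets (counting_measures M) (cylinders M)"
    "sets Q = sigma_sets (counting_measures M) (cylinders M)"
    using sP sQ sets_configuration_space by auto
  have "cylinder M [] = counting_measures M" by (simp add: cylinder_def)
  then show "range (\<lambda>_::nat. counting_measures M) \<subseteq> cylinders M" unfolding cylinders_def by force
  show "emeasure P (counting_measures M) \<noteq> \<infinity>"
    using finite_measure.emeasure_finite[OF P] by simp
qed simp

section \<open>Laws with the Laplace functional of a Poisson process\<close>

text \<open>Once a Poisson law is known to satisfy this exponential formula, nothing else about it
  is used. The parameter t is kept apart from \<open>M\<close> so that the laws for different t live
  on one configuration space.\<close>

definition laplace_law :: "'a measure \<Rightarrow> real \<Rightarrow> 'a measure measure \<Rightarrow> bool" where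
  "laplace_law M t P \<longleftrightarrow> prob_space P \<and> sets P = sets (configuration_space M) \<and>
     (\<forall>f\<in>borel_measurable M. (\<integral>\<^sup>+\<omega>. lap f \<omega> \<partial>P) = nexp (ennreal t * (\<integral>\<^sup>+x. cexp (f x) \<partial>M)))"

text \<open>The generating function of a Poisson variable at exp (- c).\<close>

lemma poisson_laplace_single:
  assumes P: "poisson_law \<Lambda> P" and A: "A \<in> sets \<Lambda>" "emeasure \<Lambda> A < \<infinity>" and c: "0 < c"
  shows "(\<integral>\<^sup>+\<omega>. nexp (ennreal c * emeasure \<omega> A) \<partial>P) = nexp (cexp (ennreal c) * emeasure \<Lambda> A)"
proof -
  have sP [measurable_cong]: "sets P = sets (configuration_space \<Lambda>)" and "prob_space P"
    and prob: "measure P {\<omega> \<in> space P. emeasure \<omega> A = of_nat k} =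
                  measure \<Lambda> A ^ k / fact k * exp (- measure \<Lambda> A)" for k
    using P A unfolding poisson_law_def by blast+
  interpret prob_space P by fact
  note [measurable] = A(1)
  have spP: "space P = counting_measures \<Lambda>"
    using sets_eq_imp_space_eq[OF sP] by (simp add: space_configuration_space)
  let ?l = "measure \<Lambda> A"
  let ?E = "\<lambda>k. {\<omega> \<in> space P. emeasure \<omega> A = of_nat k}"
  have val: "nexp (ennreal c * of_nat k) = ennreal (exp (- c) ^ k)" for k :: nat
  proof -
    have "ennreal c * of_nat k = ennreal (c * real k)"
      using c by (simp add: ennreal_of_nat_eq_real_of_nat ennreal_mult)
    then show ?thesis using c by (simp add: nexp_ennreal exp_of_nat_mult[symmetric] mult.commute)
  qed
  have pw: "nexp (ennreal c * emeasure \<omega> A) = (\<Sum>k. ennreal (exp (- c) ^ k) * indicator (?E k) \<omega>)"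
    if w: "\<omega> \<in> space P" for \<omega>
  proof (rule counting_measures_cases[OF w[unfolded spP], of A])
    \<comment> \<open>As c > 0, an infinite count gives 0 on the left, and on the right it meets
      none of the \<open>?E k\<close>.\<close>
    assume "emeasure \<omega> A = \<infinity>"
    then show ?thesis using c w by (simp add: ennreal_mult_top indicator_def)
  next
    fix j assume j: "emeasure \<omega> A = of_nat j"
    have "(\<Sum>k. ennreal (exp (- c) ^ k) * indicator (?E k) \<omega>) = (\<Sum>k\<in>{j}. ennreal (exp (- c) ^ k) * indicator (?E k) \<omega>)"
      using j w by (intro suminf_finite) (auto simp: indicator_def)
    then show ?thesis using j w val by (simp add: indicator_def)
  qed
  have "(\<integral>\<^sup>+\<omega>. nexp (ennreal c * emeasure \<omega> A) \<partial>P) = (\<integral>\<^sup>+\<omega>. (\<Sum>k. ennreal (exp (- c) ^ k) * indicator (?E k) \<omega>) \<partial>P)"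
    by (intro nn_integral_cong pw)
  also have "\<dots> = (\<Sum>k. ennreal (exp (- c) ^ k) * emeasure P (?E k))"
    by (subst nn_integral_suminf) (auto simp: nn_integral_cmult_indicator)
  also have "\<dots> = (\<Sum>k. ennreal (inverse (fact k) * (exp (- c) * ?l) ^ k * exp (- ?l)))"
    by (simp add: emeasure_eq_measure prob field_simps power_mult_distrib flip: ennreal_mult)
  also have "\<dots> = ennreal (exp (exp (- c) * ?l) * exp (- ?l))"
    using sums_mult2[OF exp_converges[of "exp (- c) * ?l"], of "exp (- ?l)"]
    by (intro suminf_ennreal_eq) (auto simp: scaleR_conv_of_real)
  also have "\<dots> = nexp (ennreal ((1 - exp (- c)) * ?l))"
    using c by (subst nexp_ennreal) (simp, simp flip: exp_add, simp add: algebra_simps)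
  also have "ennreal ((1 - exp (- c)) * ?l) = cexp (ennreal c) * emeasure \<Lambda> A"
    using c A(2) by (simp add: cexp_ennreal ennreal_mult emeasure_eq_ennreal_measure)
  finally show ?thesis .
qed

text \<open>The integral of a simple function is a finite combination of counts of disjoint level
  sets. These counts are independent, so the Laplace functional factors.\<close>

lemma poisson_laplace_simple:
  assumes P: "poisson_law \<Lambda> P"
    and g: "simple_function \<Lambda> g" "\<And>x. g x < top"
    and fin: "emeasure \<Lambda> {x\<in>space \<Lambda>. g x \<noteq> 0} < \<infinity>"
  shows "(\<integral>\<^sup>+\<omega>. lap g \<omega> \<partial>P) = nexp (\<integral>\<^sup>+x. cexp (g x) \<partial>\<Lambda>)"
proof -
  have sP [measurable_cong]: "sets P = sets (configuration_space \<Lambda>)" and "prob_space P"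
    and indep: "\<And>A::nat \<Rightarrow> 'a set. (\<forall>i. A i \<in> sets \<Lambda> \<and> emeasure \<Lambda> (A i) < \<infinity>) \<and> disjoint_family A \<Longrightarrow>
        prob_space.indep_vars P (\<lambda>_. borel) (\<lambda>i \<omega>. emeasure \<omega> (A i)) UNIV"
    using P unfolding poisson_law_def by blast+
  interpret prob_space P by fact
  have spP: "space P = counting_measures \<Lambda>"
    using sets_eq_imp_space_eq[OF sP] by (simp add: space_configuration_space)
  define V where "V = g ` space \<Lambda> - {0}"
  have finV: "finite V" using g(1) by (simp add: V_def simple_function_def)
  obtain h where h: "bij_betw h {0..<card V} V"
    using ex_bij_betw_nat_finite[OF finV] by blast
  define n where "n = card V"
  \<comment> \<open>Independence in \<open>poisson_law\<close> speaks of sequences, hence the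
    padding with empty sets. The value 0 is left out of \<open>V\<close> because its level set may
    have infinite measure.\<close>
  define A where "A i = (if i < n then g -` {h i} \<inter> space \<Lambda> else {})" for i
  have inj: "inj_on h {..<n}" and hV: "h i \<in> V" if "i < n" for i
    using h that unfolding bij_betw_def n_def by (auto simp: atLeast0LessThan)
  have h_surj: "\<exists>i<n. h i = y" if "y \<in> V" for y
  proof -
    have "h ` {..<n} = V" using h by (simp add: bij_betw_def n_def atLeast0LessThan)
    then show ?thesis using that by (metis imageE lessThan_iff)
  qed
  have A_sets [measurable]: "A i \<in> sets \<Lambda>" for i
    using g(1) by (auto simp: A_def intro!: simple_functionD)
  have A_fin: "emeasure \<Lambda> (A i) < \<infinity>" for i
  proof -
    have [measurable]: "g \<in> borel_measurable \<Lambda>" using g(1) by (rule borel_measurable_simple_function)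
    have "A i \<subseteq> {x\<in>space \<Lambda>. g x \<noteq> 0}" using hV by (auto simp: A_def V_def)
    then have "emeasure \<Lambda> (A i) \<le> emeasure \<Lambda> {x\<in>space \<Lambda>. g x \<noteq> 0}" by (rule emeasure_mono) measurable
    then show ?thesis using fin by simp
  qed
  have dis: "disjoint_family A"
    unfolding disjoint_family_on_def A_def using inj by (auto simp: inj_on_def)
  have hpos: "\<exists>r>0. h i = ennreal r" if i: "i < n" for i
  proof -
    obtain x where "h i = g x" "h i \<noteq> 0" using hV[OF i] by (auto simp: V_def)
    then show ?thesis using g(2)[of x]
      by (intro exI[of _ "enn2real (h i)"]) (auto simp: enn2real_positive_iff zero_less_iff_neq_zero)
  qed
  \<comment> \<open>\<open>F\<close> is needed both as the identity, for the configuration, and as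
    \<open>cexp\<close>, for the intensity; vanishing at 0 disposes of the omitted level
    set.\<close>
  have expand: "F (g x) = (\<Sum>i<n. F (h i) * indicator (A i) x)"
    if F: "F 0 = 0" and x: "x \<in> space \<Lambda>" for F :: "ennreal \<Rightarrow> ennreal" and x
  proof (cases "g x = 0")
    case True
    then have "indicator (A i) x = (0 :: ennreal)" for i using hV by (auto simp: A_def V_def)
    then show ?thesis using True F by simp
  next
    case False
    then obtain j where j: "j < n" "h j = g x" using h_surj[of "g x"] x by (auto simp: V_def)
    have "F (h i) * indicator (A i) x = (if i = j then F (g x) else 0)" if "i < n" for i
      using j that x inj by (auto simp: A_def indicator_def inj_on_def)
    then show ?thesis using j(1) by simp
  qed
  have int: "(\<integral>\<^sup>+x. F (g x) \<partial>\<omega>) = (\<Sum>i<n. F (h i) * emeasure \<omega> (A i))"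
    if "F 0 = 0" "sets \<omega> = sets \<Lambda>" for F \<omega>
  proof -
    have [measurable]: "A i \<in> sets \<omega>" for i using that by simp
    have "(\<integral>\<^sup>+x. F (g x) \<partial>\<omega>) = (\<integral>\<^sup>+x. (\<Sum>i<n. F (h i) * indicator (A i) x) \<partial>\<omega>)"
      using expand[of F] that sets_eq_imp_space_eq[OF that(2)] by (intro nn_integral_cong) auto
    also have "\<dots> = (\<Sum>i<n. F (h i) * emeasure \<omega> (A i))"
      by (subst nn_integral_sum) (auto simp: nn_integral_cmult_indicator)
    finally show ?thesis .
  qed
  have "indep_vars (\<lambda>_. borel) (\<lambda>i \<omega>. emeasure \<omega> (A i)) UNIV"
    using A_sets A_fin dis by (intro indep) auto
  then have ind: "indep_vars (\<lambda>_. borel) (\<lambda>i \<omega>. emeasure \<omega> (A i)) {..<n}"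
    by (rule indep_vars_subset) auto
  have "indep_vars (\<lambda>_. borel) (\<lambda>i \<omega>. nexp (h i * emeasure \<omega> (A i))) {..<n}"
    by (rule indep_vars_compose2[OF ind]) measurable
  then have "(\<integral>\<^sup>+\<omega>. (\<Prod>i<n. nexp (h i * emeasure \<omega> (A i))) \<partial>P) = (\<Prod>i<n. \<integral>\<^sup>+\<omega>. nexp (h i * emeasure \<omega> (A i)) \<partial>P)"
    by (intro indep_vars_nn_integral) auto
  also have "\<dots> = (\<Prod>i<n. nexp (cexp (h i) * emeasure \<Lambda> (A i)))"
  proof (rule prod.cong)
    fix i assume "i \<in> {..<n}"
    then obtain r where "r > 0" "h i = ennreal r" using hpos by auto
    then show "(\<integral>\<^sup>+\<omega>. nexp (h i * emeasure \<omega> (A i)) \<partial>P) = nexp (cexp (h i) * emeasure \<Lambda> (A i))"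
      using poisson_laplace_single[OF P A_sets A_fin] by simp
  qed simp
  also have "\<dots> = nexp (\<integral>\<^sup>+x. cexp (g x) \<partial>\<Lambda>)"
    by (subst int) (auto simp: nexp_sum)
  also have "(\<integral>\<^sup>+\<omega>. (\<Prod>i<n. nexp (h i * emeasure \<omega> (A i))) \<partial>P) = (\<integral>\<^sup>+\<omega>. lap g \<omega> \<partial>P)"
    using int[of "\<lambda>y. y"] unfolding lap_def
    by (intro nn_integral_cong) (auto simp: nexp_sum spP counting_measures_sets)
  finally show ?thesis .
qed

text \<open>Simple approximations are cut off to sets of finite measure, as
  \<open>poisson_laplace_simple\<close> requires, and still increase to \<open>f\<close>. Inner
  integrals converge monotonically; the outer one needs domination, since \<open>nexp\<close>
  reverses the order.\<close>

lemma poisson_laplace: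
  assumes P: "poisson_law \<Lambda> P" and \<Lambda>: "sigma_finite_measure \<Lambda>"
    and f: "f \<in> borel_measurable \<Lambda>"
  shows "(\<integral>\<^sup>+\<omega>. lap f \<omega> \<partial>P) = nexp (\<integral>\<^sup>+x. cexp (f x) \<partial>\<Lambda>)"
proof -
  have sP [measurable_cong]: "sets P = sets (configuration_space \<Lambda>)" and "prob_space P"
    using P unfolding poisson_law_def by blast+
  interpret prob_space P by fact
  have spP: "space P = counting_measures \<Lambda>"
    using sets_eq_imp_space_eq[OF sP] by (simp add: space_configuration_space)
  obtain g where g: "\<And>i. simple_function \<Lambda> (g i)" "incseq g" "\<And>i x. g i x < top" "\<And>x. (SUP i. g i x) = f x"
    using borel_measurable_implies_simple_function_sequence'[OF f] by blast
  obtain X where X: "range X \<subseteq> sets \<Lambda>" "(\<Union>i. X i) = space \<Lambda>" "\<And>i. emeasure \<Lambda> (X i) \<noteq> \<infinity>" "incseq X"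
    by (rule sigma_finite_measure.sigma_finite_incseq[OF \<Lambda>]) blast
  have [measurable]: "X i \<in> sets \<Lambda>" "g i \<in> borel_measurable \<Lambda>" for i
    using X g(1) by (auto intro: borel_measurable_simple_function)
  define u where "u i x = g i x * indicator (X i) x" for i x
  have u_meas [measurable]: "u i \<in> borel_measurable \<Lambda>" for i unfolding u_def by measurable
  have inc: "incseq u"
    unfolding incseq_def le_fun_def
  proof (intro allI impI)
    fix m n x assume "m \<le> (n::nat)"
    then have "X m \<subseteq> X n" "g m x \<le> g n x"
      using g(2) X(4) by (auto simp: incseq_def le_fun_def)
    then show "u m x \<le> u n x" unfolding u_def by (intro mult_mono) (auto simp: indicator_def)
  qed
  have lim: "(\<lambda>i. u i x) \<longlonglongrightarrow> f x" if x: "x \<in> space \<Lambda>" for x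
  proof -
    obtain k where "x \<in> X k" using X(2) x by auto
    then have "eventually (\<lambda>i. u i x = g i x) sequentially"
      using X(4) by (intro eventually_sequentiallyI[of k]) (auto simp: u_def incseq_def indicator_def)
    moreover have "(\<lambda>i. g i x) \<longlonglongrightarrow> f x"
      using g(2) unfolding g(4)[symmetric] by (intro LIMSEQ_SUP) (auto simp: incseq_def le_fun_def)
    ultimately show ?thesis by (simp cong: tendsto_cong)
  qed
  have conv: "(\<lambda>i. \<integral>\<^sup>+x. F (u i x) \<partial>\<omega>) \<longlonglongrightarrow> (\<integral>\<^sup>+x. F (f x) \<partial>\<omega>)"
    if F: "mono F" "F \<in> borel_measurable borel" "\<And>x. x \<in> space \<Lambda> \<Longrightarrow> (\<lambda>i. F (u i x)) \<longlonglongrightarrow> F (f x)"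
      and s: "sets \<omega> = sets \<Lambda>" for F :: "ennreal \<Rightarrow> ennreal" and \<omega>
  proof -
    note [measurable_cong] = s and [measurable] = F(2)
    have incF: "incseq (\<lambda>i x. F (u i x))"
      using inc F(1) by (auto simp: incseq_def le_fun_def mono_def)
    have "(\<lambda>i. \<integral>\<^sup>+x. F (u i x) \<partial>\<omega>) \<longlonglongrightarrow> (\<integral>\<^sup>+x. (SUP i. F (u i x)) \<partial>\<omega>)"
      using incF by (intro nn_integral_LIMSEQ LIMSEQ_SUP) (auto simp: incseq_def le_fun_def)
    also have "(\<integral>\<^sup>+x. (SUP i. F (u i x)) \<partial>\<omega>) = (\<integral>\<^sup>+x. F (f x) \<partial>\<omega>)"
    proof (rule nn_integral_cong)
      fix x assume "x \<in> space \<omega>"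
      then have "x \<in> space \<Lambda>" using sets_eq_imp_space_eq[OF s] by simp
      moreover have "(\<lambda>i. F (u i x)) \<longlonglongrightarrow> (SUP i. F (u i x))"
        using incF by (intro LIMSEQ_SUP) (auto simp: incseq_def le_fun_def)
      ultimately show "(SUP i. F (u i x)) = F (f x)" using F(3) LIMSEQ_unique by blast
    qed
    finally show ?thesis .
  qed
  have "(\<lambda>i. \<integral>\<^sup>+\<omega>. lap (u i) \<omega> \<partial>P) \<longlonglongrightarrow> (\<integral>\<^sup>+\<omega>. lap f \<omega> \<partial>P)"
  proof (rule nn_integral_dominated_convergence[where w="\<lambda>_. 1"])
    show "AE \<omega> in P. (\<lambda>i. lap (u i) \<omega>) \<longlonglongrightarrow> lap f \<omega>"
      unfolding lap_def using conv[of "\<lambda>y. y"] lim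
      by (intro AE_I2 tendsto_nexp) (auto simp: spP counting_measures_sets mono_def)
  qed (use f in \<open>auto simp: lap_le_1 emeasure_space_1\<close>)
  moreover have "(\<integral>\<^sup>+\<omega>. lap (u i) \<omega> \<partial>P) = nexp (\<integral>\<^sup>+x. cexp (u i x) \<partial>\<Lambda>)" for i
  proof (rule poisson_laplace_simple[OF P])
    have "emeasure \<Lambda> {x \<in> space \<Lambda>. u i x \<noteq> 0} \<le> emeasure \<Lambda> (X i)"
      by (rule emeasure_mono) (auto simp: u_def indicator_def split: if_splits)
    then show "emeasure \<Lambda> {x \<in> space \<Lambda>. u i x \<noteq> 0} < \<infinity>" using X(3)[of i] by (simp add: less_top top_unique order_le_less_trans)
    show "simple_function \<Lambda> (u i)" unfolding u_def
      using g(1) by (intro simple_function_mult simple_function_indicator) auto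
    show "u i x < top" for x using g(3)[of i x] by (auto simp: u_def indicator_def)
  qed
  moreover have "(\<lambda>i. nexp (\<integral>\<^sup>+x. cexp (u i x) \<partial>\<Lambda>)) \<longlonglongrightarrow> nexp (\<integral>\<^sup>+x. cexp (f x) \<partial>\<Lambda>)"
    using lim by (intro tendsto_nexp conv tendsto_cexp) (auto simp: mono_def cexp_mono)
  ultimately show ?thesis using LIMSEQ_unique by simp
qed

lemma sigma_finite_scale_measure:
  assumes "sigma_finite_measure M"
  shows "sigma_finite_measure (scale_measure (ennreal t) M)"
proof
  interpret sigma_finite_measure M by fact
  obtain A where "countable A" "A \<subseteq> sets M" "\<Union>A = space M" "\<forall>a\<in>A. emeasure M a \<noteq> \<infinity>"
    using sigma_finite_countable by blast
  then show "\<exists>A. countable A \<and> A \<subseteq> sets (scale_measure (ennreal t) M) \<and>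
      \<Union> A = space (scale_measure (ennreal t) M) \<and>
      (\<forall>a\<in>A. emeasure (scale_measure (ennreal t) M) a \<noteq> \<infinity>)"
    by (intro exI[of _ A]) (auto simp: space_scale_measure ennreal_mult_eq_top_iff)
qed

lemma poisson_law_laplace_law:
  assumes "poisson_law (scale_measure (ennreal t) M) P" and "sigma_finite_measure M"
  shows "laplace_law M t P"
  using poisson_laplace[OF assms(1) sigma_finite_scale_measure[OF assms(2)]] assms(1)
    configuration_space_cong[OF sets_scale_measure[of "ennreal t" M]]
  by (simp add: laplace_law_def poisson_law_def nn_integral_scale_measure cong: measurable_cong_sets)

section \<open>Almost sure consequences of the exponential formula\<close>

lemma laplace_lawD:
  assumes "laplace_law M t P"
  shows "prob_space P" "sets P = sets (configuration_space M)" "space P = counting_measures M"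
    "f \<in> borel_measurable M \<Longrightarrow> (\<integral>\<^sup>+\<omega>. lap f \<omega> \<partial>P) = nexp (ennreal t * (\<integral>\<^sup>+x. cexp (f x) \<partial>M))"
  using assms unfolding laplace_law_def
  by (auto dest: sets_eq_imp_space_eq simp: space_configuration_space)

text \<open>Let Y be the integral of \<open>f\<close> over the configuration. For every c > 0, exp
  (- c t \<integral> f d\<mu>) \<le> E exp (- c Y) \<le> P (Y < \<infinity>), the first bound
  because 1 - exp (- x) \<le> x. The left side tends to 1 as c falls to 0.\<close>

lemma laplace_law_AE_finite:
  assumes P: "laplace_law M t P" and f: "f \<in> borel_measurable M" "(\<integral>\<^sup>+x. f x \<partial>M) < \<infinity>"
  shows "AE \<omega> in P. (\<integral>\<^sup>+x. f x \<partial>\<omega>) < \<infinity>"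
proof -
  note sP [measurable_cong] = laplace_lawD(2)[OF P] and [measurable] = f(1)
  interpret prob_space P using P by (rule laplace_lawD)
  let ?c = "\<lambda>n. ennreal (1 / real (Suc n))" and ?I = "ennreal t * (\<integral>\<^sup>+x. f x \<partial>M)"
  let ?E = "{\<omega>\<in>space P. (\<integral>\<^sup>+x. f x \<partial>\<omega>) < \<infinity>}"
  have "nexp (?c n * ?I) \<le> emeasure P ?E" for n
  proof -
    have "?c n * ?I = ennreal t * (\<integral>\<^sup>+x. ?c n * f x \<partial>M)"
      by (subst nn_integral_cmult) (auto simp: ac_simps)
    also have "\<dots> \<ge> ennreal t * (\<integral>\<^sup>+x. cexp (?c n * f x) \<partial>M)"
      by (intro mult_left_mono nn_integral_mono cexp_le) auto
    finally have "nexp (?c n * ?I) \<le> (\<integral>\<^sup>+\<omega>. lap (\<lambda>x. ?c n * f x) \<omega> \<partial>P)"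
      by (subst laplace_lawD(4)[OF P]) (auto intro: nexp_mono)
    also have "\<dots> \<le> (\<integral>\<^sup>+\<omega>. indicator ?E \<omega> \<partial>P)"
    proof (intro nn_integral_mono)
      fix \<omega> assume w: "\<omega> \<in> space P"
      then have "(\<integral>\<^sup>+x. ?c n * f x \<partial>\<omega>) = ?c n * (\<integral>\<^sup>+x. f x \<partial>\<omega>)"
        using f(1) by (intro nn_integral_cmult) (auto simp: laplace_lawD(3)[OF P] intro: measurable_counting_measures)
      then show "lap (\<lambda>x. ?c n * f x) \<omega> \<le> indicator ?E \<omega>"
        using w by (auto simp: lap_def indicator_def nexp_le_1 less_top[symmetric] ennreal_mult_top simp del: of_nat_Suc)
    qed
    finally show ?thesis by simp
  qed
  then have "1 \<le> emeasure P ?E"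
    using nexp_mult_limit[of ?I] f(2)
    by (intro LIMSEQ_le_const2[where X="\<lambda>n. nexp (?c n * ?I)"]) (auto simp: ennreal_mult_eq_top_iff split: if_splits)
  then have "emeasure P ?E = 1" by (intro antisym measure_le_1)
  then show ?thesis by (intro AE_I_eq_1) auto
qed

text \<open>The function equal to \<infinity> on the exceptional null set and 0 elsewhere has
  integral 0, hence a finite integral over almost every configuration. This leaves no room for a
  point in the null set.\<close>

lemma laplace_law_AE_AE:
  assumes P: "laplace_law M t P" and Q: "AE x in M. Q x"
  shows "AE \<omega> in P. AE x in \<omega>. Q x"
proof -
  obtain N where N: "{x\<in>space M. \<not> Q x} \<subseteq> N" "N \<in> sets M" "emeasure M N = 0"
    using Q by (auto elim: AE_E)
  have "AE \<omega> in P. (\<integral>\<^sup>+x. \<infinity> * indicator N x \<partial>\<omega>) < \<infinity>"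
    using N by (intro laplace_law_AE_finite[OF P]) (auto simp: nn_integral_cmult_indicator)
  with AE_space show ?thesis
  proof eventually_elim
    case w: (elim \<omega>)
    then have w': "\<omega> \<in> counting_measures M" by (simp add: laplace_lawD(3)[OF P])
    have Nw: "N \<in> sets \<omega>" using N(2) counting_measures_sets[OF w'] by simp
    have "(\<integral>\<^sup>+x. \<infinity> * indicator N x \<partial>\<omega>) = \<infinity> * emeasure \<omega> N"
      using Nw by (rule nn_integral_cmult_indicator)
    then have "emeasure \<omega> N = 0"
      using w(2) by (auto simp: ennreal_top_mult split: if_splits)
    then show "AE x in \<omega>. Q x"
      using N(1) Nw by (intro AE_I[of _ _ N]) (auto simp: counting_measures_space[OF w'])
  qed
qed

lemma counting_measuresI:
  assumes "sets \<omega> = sets M"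
    and "\<And>A. A \<in> sets M \<Longrightarrow> emeasure \<omega> A = \<infinity> \<or> (\<exists>k::nat. emeasure \<omega> A = of_nat k)"
  shows "\<omega> \<in> counting_measures M"
  unfolding counting_measures_def
proof (intro CollectI conjI ballI)
  fix A assume "A \<in> sets M"
  then show "emeasure \<omega> A \<in> range of_nat \<union> {\<infinity>}" using assms(2)[of A] by auto
qed (fact assms(1))

lemma laplace_law_unique:
  "laplace_law M t P \<Longrightarrow> laplace_law M t Q \<Longrightarrow> P = Q"
  by (rule laplace_unique[where M=M])
     (auto simp: laplace_lawD(1,2,4) prob_space.finite_measure)

section \<open>Superposition\<close>

definition superpose :: "'a measure \<Rightarrow> 'a measure \<Rightarrow> 'a measure \<Rightarrow> 'a measure" where
  "superpose M \<omega> \<eta> = measure_of (space M) (sets M) (\<lambda>A. emeasure \<omega> A + emeasure \<eta> A)"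

lemma sets_superpose [simp, measurable_cong]: "sets (superpose M \<omega> \<eta>) = sets M"
  by (simp add: superpose_def)

lemma space_superpose [simp]: "space (superpose M \<omega> \<eta>) = space M"
  by (simp add: superpose_def)

lemma emeasure_superpose:
  assumes "sets \<omega> = sets M" "sets \<eta> = sets M" "A \<in> sets M"
  shows "emeasure (superpose M \<omega> \<eta>) A = emeasure \<omega> A + emeasure \<eta> A"
  unfolding superpose_def
proof (rule emeasure_measure_of_sigma)
  show "sigma_algebra (space M) (sets M)" ..
  show "positive (sets M) (\<lambda>A. emeasure \<omega> A + emeasure \<eta> A)" by (simp add: positive_def)
  show "countably_additive (sets M) (\<lambda>A. emeasure \<omega> A + emeasure \<eta> A)"
  proof (rule countably_additiveI)
    fix F :: "nat \<Rightarrow> _" assume F: "range F \<subseteq> sets M" "disjoint_family F" "(\<Union>i. F i) \<in> sets M"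
    show "(\<Sum>i. emeasure \<omega> (F i) + emeasure \<eta> (F i)) = emeasure \<omega> (\<Union>i. F i) + emeasure \<eta> (\<Union>i. F i)"
      using F assms by (subst suminf_add[symmetric]) (auto simp: suminf_emeasure)
  qed
qed fact

lemma nn_integral_superpose:
  assumes s: "sets \<omega> = sets M" "sets \<eta> = sets M" and f: "f \<in> borel_measurable M"
  shows "(\<integral>\<^sup>+x. f x \<partial>superpose M \<omega> \<eta>) = (\<integral>\<^sup>+x. f x \<partial>\<omega>) + (\<integral>\<^sup>+x. f x \<partial>\<eta>)"
proof -
  have sp: "space \<omega> = space M" "space \<eta> = space M" using s[THEN sets_eq_imp_space_eq] by auto
  note [measurable_cong] = s
  show ?thesis
    using f
  proof (induction f rule: borel_measurable_induct)
    case (cong f g)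
    have "(\<integral>\<^sup>+x. f x \<partial>\<nu>) = (\<integral>\<^sup>+x. g x \<partial>\<nu>)" if "space \<nu> = space M" for \<nu>
      using that cong(3) by (intro nn_integral_cong) simp
    then show ?case using cong(4) by (simp add: sp)
  next
    case (set A)
    then show ?case using s by (simp add: emeasure_superpose)
  next
    case (mult u c)
    note [measurable] = mult.hyps(2)
    show ?case by (simp add: nn_integral_cmult mult.IH distrib_left)
  next
    case (add u v)
    note [measurable] = add.hyps(1,3)
    show ?case by (simp add: nn_integral_add add.IH ac_simps)
  next
    case (seq U)
    note [measurable] = seq.hyps(1)
    have inc: "incseq (\<lambda>i. \<integral>\<^sup>+x. U i x \<partial>\<nu>)" for \<nu>
      using \<open>incseq U\<close> by (auto simp: incseq_def le_fun_def intro!: nn_integral_mono)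
    have "(\<integral>\<^sup>+x. (SUP i. U i) x \<partial>\<nu>) = (SUP i. \<integral>\<^sup>+x. U i x \<partial>\<nu>)"
      if "sets \<nu> = sets M" for \<nu>
    proof -
      note [measurable_cong] = that
      show ?thesis unfolding SUP_apply
        using \<open>incseq U\<close> by (intro nn_integral_monotone_convergence_SUP) auto
    qed
    then show ?case using s
      by (simp add: seq.IH ennreal_SUP_add[OF inc inc])
  qed
qed

lemma superpose_counting_measures:
  assumes "\<omega> \<in> counting_measures M" "\<eta> \<in> counting_measures M"
  shows "superpose M \<omega> \<eta> \<in> counting_measures M"
proof (rule counting_measuresI)
  fix A assume A: "A \<in> sets M"
  show "emeasure (superpose M \<omega> \<eta>) A = \<infinity> \<or> (\<exists>k::nat. emeasure (superpose M \<omega> \<eta>) A = of_nat k)"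
    using assms A
    by (auto simp: emeasure_superpose counting_measures_sets simp flip: of_nat_add
          elim!: counting_measures_cases[where A=A])
qed simp

lemma measurable_superpose:
  "(\<lambda>(\<omega>, \<eta>). superpose M \<omega> \<eta>) \<in>
     measurable (configuration_space M \<Otimes>\<^sub>M configuration_space M) (configuration_space M)"
proof (rule measurable_configuration_spaceI)
  fix A assume A [measurable]: "A \<in> sets M"
  have "(\<lambda>x. emeasure (fst x) A + emeasure (snd x) A) \<in>
     borel_measurable (configuration_space M \<Otimes>\<^sub>M configuration_space M)" by measurable
  then show "(\<lambda>x. emeasure (case x of (\<omega>, \<eta>) \<Rightarrow> superpose M \<omega> \<eta>) A) \<in>
     borel_measurable (configuration_space M \<Otimes>\<^sub>M configuration_space M)"
    by (rule measurable_cong[THEN iffD2, rotated])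
       (auto simp: space_pair_measure space_configuration_space emeasure_superpose[OF _ _ A] counting_measures_sets)
qed (auto simp: space_pair_measure space_configuration_space superpose_counting_measures)

lemma lap_superpose:
  assumes "\<omega> \<in> counting_measures M" "\<eta> \<in> counting_measures M" "f \<in> borel_measurable M"
  shows "lap f (superpose M \<omega> \<eta>) = lap f \<omega> * lap f \<eta>"
  using assms by (simp add: lap_def nn_integral_superpose counting_measures_sets nexp_add)

text \<open>By independence the Laplace functional of the sum is a product, and the exponents add.
  Signs matter because \<open>ennreal\<close> truncates negative parameters.\<close>

lemma laplace_law_superpose:
  assumes P: "laplace_law M s P" and Q: "laplace_law M r Q" and "0 \<le> s" "0 \<le> r"
  shows "laplace_law M (s + r) (distr (P \<Otimes>\<^sub>M Q) (configuration_space M) (\<lambda>(\<omega>, \<eta>). superpose M \<omega> \<eta>))"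
proof -
  note sP [measurable_cong] = laplace_lawD(2)[OF P] and sQ [measurable_cong] = laplace_lawD(2)[OF Q]
  interpret P: prob_space P using P by (rule laplace_lawD)
  interpret Q: prob_space Q using Q by (rule laplace_lawD)
  interpret PQ: pair_prob_space P Q ..
  have m [measurable]: "(\<lambda>(\<omega>, \<eta>). superpose M \<omega> \<eta>) \<in> measurable (P \<Otimes>\<^sub>M Q) (configuration_space M)"
    using measurable_superpose[of M] by (simp cong: measurable_cong_sets)
  show ?thesis
    unfolding laplace_law_def
  proof (intro conjI ballI)
    show "prob_space (distr (P \<Otimes>\<^sub>M Q) (configuration_space M) (\<lambda>(\<omega>, \<eta>). superpose M \<omega> \<eta>))"
      by (rule PQ.prob_space_distr) (rule m)
    fix f :: "'a \<Rightarrow> ennreal" assume f [measurable]: "f \<in> borel_measurable M"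
    have "(\<integral>\<^sup>+\<omega>. lap f \<omega> \<partial>distr (P \<Otimes>\<^sub>M Q) (configuration_space M) (\<lambda>(\<omega>, \<eta>). superpose M \<omega> \<eta>))
      = (\<integral>\<^sup>+x. lap f (case x of (\<omega>, \<eta>) \<Rightarrow> superpose M \<omega> \<eta>) \<partial>(P \<Otimes>\<^sub>M Q))"
      by (rule nn_integral_distr) measurable
    also have "\<dots> = (\<integral>\<^sup>+x. lap f (fst x) * lap f (snd x) \<partial>(P \<Otimes>\<^sub>M Q))"
      by (intro nn_integral_cong)
         (auto simp: space_pair_measure laplace_lawD(3)[OF P] laplace_lawD(3)[OF Q] lap_superpose f)
    also have "\<dots> = (\<integral>\<^sup>+\<omega>. \<integral>\<^sup>+\<eta>. lap f \<omega> * lap f \<eta> \<partial>Q \<partial>P)"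
      by (subst Q.nn_integral_fst[symmetric]) auto
    also have "\<dots> = (\<integral>\<^sup>+\<omega>. lap f \<omega> \<partial>P) * (\<integral>\<^sup>+\<eta>. lap f \<eta> \<partial>Q)"
      by (simp add: nn_integral_cmult nn_integral_multc)
    also have "\<dots> = nexp (ennreal (s + r) * (\<integral>\<^sup>+x. cexp (f x) \<partial>M))"
      using assms(3,4) by (simp add: laplace_lawD(4)[OF P f] laplace_lawD(4)[OF Q f] distrib_right nexp_add[symmetric])
    finally show "(\<integral>\<^sup>+\<omega>. lap f \<omega> \<partial>distr (P \<Otimes>\<^sub>M Q) (configuration_space M) (\<lambda>(\<omega>, \<eta>). superpose M \<omega> \<eta>))
      = nexp (ennreal (s + r) * (\<integral>\<^sup>+x. cexp (f x) \<partial>M))" .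
  qed simp
qed

section \<open>Restriction and the zero-one law\<close>

text \<open>Taking a density with an indicator retains the full space and its measurable sets, so
  restrictions stay inside \<open>counting_measures M\<close>.\<close>

definition restr :: "'a set \<Rightarrow> 'a measure \<Rightarrow> 'a measure" where
  "restr A \<omega> = density \<omega> (indicator A)"

lemma sets_restr [simp, measurable_cong]: "sets (restr A \<omega>) = sets \<omega>"
  by (simp add: restr_def)

lemma nn_integral_restr:
  assumes "\<omega> \<in> counting_measures M" "A \<in> sets M" "f \<in> borel_measurable M"
  shows "(\<integral>\<^sup>+x. f x \<partial>restr A \<omega>) = (\<integral>\<^sup>+x. f x * indicator A x \<partial>\<omega>)"
  unfolding restr_def using assms
  by (subst nn_integral_density)
     (auto simp: counting_measures_sets measurable_counting_measures mult.commute)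

lemma emeasure_restr:
  assumes "\<omega> \<in> counting_measures M" "A \<in> sets M" "B \<in> sets M"
  shows "emeasure (restr A \<omega>) B = emeasure \<omega> (A \<inter> B)"
  using nn_integral_restr[OF assms(1,2), of "indicator B"] assms
  by (simp add: counting_measures_sets mult.commute flip: indicator_inter_arith)

lemma restr_counting_measures:
  assumes "\<omega> \<in> counting_measures M" "A \<in> sets M"
  shows "restr A \<omega> \<in> counting_measures M"
proof (rule counting_measuresI)
  fix B assume "B \<in> sets M"
  then show "emeasure (restr A \<omega>) B = \<infinity> \<or> (\<exists>k::nat. emeasure (restr A \<omega>) B = of_nat k)"
    using assms by (auto simp: emeasure_restr elim!: counting_measures_cases[where A="A \<inter> B"])
qed (simp add: counting_measures_sets[OF assms(1)])

lemma measurable_restr: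
  assumes A [measurable]: "A \<in> sets M"
  shows "restr A \<in> measurable (configuration_space M) (configuration_space M)"
proof (rule measurable_configuration_spaceI)
  fix B assume B [measurable]: "B \<in> sets M"
  have "(\<lambda>\<omega>. emeasure \<omega> (A \<inter> B)) \<in> borel_measurable (configuration_space M)" by measurable
  then show "(\<lambda>\<omega>. emeasure (restr A \<omega>) B) \<in> borel_measurable (configuration_space M)"
    by (rule measurable_cong[THEN iffD2, rotated])
       (simp add: space_configuration_space emeasure_restr[OF _ A B])
qed (simp add: space_configuration_space restr_counting_measures A)

text \<open>Weighting \<open>P\<close> by the functional of the points in \<open>A\<close>
  multiplies the law of the points outside by the constant \<open>K\<close> and changes nothing
  else; Laplace functionals show this, because test functions with disjoint supports have additive
  exponents. An event outside against a functional inside is the form of independence that the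
  zero-one law uses.\<close>

lemma laplace_law_restr_indep:
  assumes P: "laplace_law M t P" and A: "A \<in> sets M" and f: "f \<in> borel_measurable M"
    and B: "B \<in> sets (configuration_space M)"
  shows "(\<integral>\<^sup>+\<omega>. indicator B (restr (space M - A) \<omega>) * lap (\<lambda>x. f x * indicator A x) \<omega> \<partial>P)
       = (\<integral>\<^sup>+\<omega>. indicator B (restr (space M - A) \<omega>) \<partial>P) * (\<integral>\<^sup>+\<omega>. lap (\<lambda>x. f x * indicator A x) \<omega> \<partial>P)"
proof -
  note sP [measurable_cong] = laplace_lawD(2)[OF P] and [measurable] = A f B
  interpret P: prob_space P using P by (rule laplace_lawD)
  let ?C = "configuration_space M"
  let ?R = "restr (space M - A)" and ?u = "lap (\<lambda>x. f x * indicator A x)"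
  have m [measurable]: "?R \<in> measurable P ?C"
    using measurable_restr[of "space M - A" M] by (simp cong: measurable_cong_sets)
  define K where "K = (\<integral>\<^sup>+\<omega>. ?u \<omega> \<partial>P)"
  have K: "K \<noteq> top"
  proof -
    have "K \<le> (\<integral>\<^sup>+\<omega>. 1 \<partial>P)" unfolding K_def by (intro nn_integral_mono lap_le_1)
    then show ?thesis by (auto simp: top_unique P.emeasure_space_1)
  qed
  have "distr (density P ?u) ?C ?R = scale_measure K (distr P ?C ?R)"
  proof (rule laplace_unique[where M=M])
    have m': "?R \<in> measurable (density P ?u) ?C" by measurable
    have em: "emeasure (density P ?u) (space P) = K"
      unfolding K_def by (subst emeasure_density) (auto intro!: nn_integral_cong)
    have "finite_measure (density P ?u)"
      by (rule finite_measureI) (simp add: em K)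
    then show "finite_measure (distr (density P ?u) ?C ?R)"
      by (rule finite_measure.finite_measure_distr[OF _ m'])
    interpret PR: prob_space "distr P ?C ?R" by (rule P.prob_space_distr) (rule m)
    show "finite_measure (scale_measure K (distr P ?C ?R))"
      using PR.emeasure_space_1 K by (intro finite_measureI) (simp add: space_scale_measure)
    fix g :: "'a \<Rightarrow> ennreal" assume g [measurable]: "g \<in> borel_measurable M"
    let ?g = "\<lambda>x. g x * indicator (space M - A) x" and ?f = "\<lambda>x. f x * indicator A x"
    have lapR: "lap g (?R \<omega>) = lap ?g \<omega>" if "\<omega> \<in> space P" for \<omega>
      using that unfolding lap_def by (subst nn_integral_restr) (auto simp: laplace_lawD(3)[OF P])
    have mf: "?f \<in> borel_measurable M" and mg: "?g \<in> borel_measurable M" by measurable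
    have "(\<integral>\<^sup>+\<omega>. lap g \<omega> \<partial>distr (density P ?u) ?C ?R) = (\<integral>\<^sup>+\<omega>. ?u \<omega> * lap g (?R \<omega>) \<partial>P)"
      by (subst nn_integral_distr, measurable) (subst nn_integral_density, auto)
    also have "\<dots> = (\<integral>\<^sup>+\<omega>. lap (\<lambda>x. ?f x + ?g x) \<omega> \<partial>P)"
      using lapR by (intro nn_integral_cong) (simp add: lap_add[OF _ mf mg] laplace_lawD(3)[OF P])
    also have "\<dots> = nexp (ennreal t * (\<integral>\<^sup>+x. cexp (?f x + ?g x) \<partial>M))"
      by (rule laplace_lawD(4)[OF P]) measurable
    \<comment> \<open>At each point one of the two functions is 0, and
      \<open>cexp 0 = 0\<close>.\<close>
    also have "(\<integral>\<^sup>+x. cexp (?f x + ?g x) \<partial>M) = (\<integral>\<^sup>+x. cexp (?f x) + cexp (?g x) \<partial>M)"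
      by (intro nn_integral_cong) (auto simp: indicator_def)
    also have "\<dots> = (\<integral>\<^sup>+x. cexp (?f x) \<partial>M) + (\<integral>\<^sup>+x. cexp (?g x) \<partial>M)"
      by (rule nn_integral_add) measurable
    also have "nexp (ennreal t * \<dots>) = K * (\<integral>\<^sup>+\<omega>. lap ?g \<omega> \<partial>P)"
      unfolding K_def laplace_lawD(4)[OF P mf] laplace_lawD(4)[OF P mg]
      by (simp add: distrib_left nexp_add)
    also have "(\<integral>\<^sup>+\<omega>. lap ?g \<omega> \<partial>P) = (\<integral>\<^sup>+\<omega>. lap g (?R \<omega>) \<partial>P)"
      using lapR by (intro nn_integral_cong) simp
    also have "K * \<dots> = (\<integral>\<^sup>+\<omega>. lap g \<omega> \<partial>scale_measure K (distr P ?C ?R))"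
      by (subst nn_integral_scale_measure, measurable) (subst nn_integral_distr, auto)
    finally show "(\<integral>\<^sup>+\<omega>. lap g \<omega> \<partial>distr (density P ?u) ?C ?R) = (\<integral>\<^sup>+\<omega>. lap g \<omega> \<partial>scale_measure K (distr P ?C ?R))" .
  qed simp_all
  then have eq: "(\<integral>\<^sup>+\<omega>. indicator B \<omega> \<partial>distr (density P ?u) ?C ?R) = (\<integral>\<^sup>+\<omega>. indicator B \<omega> \<partial>scale_measure K (distr P ?C ?R))"
    by simp
  have "(\<integral>\<^sup>+\<omega>. indicator B (?R \<omega>) * ?u \<omega> \<partial>P) = (\<integral>\<^sup>+\<omega>. indicator B \<omega> \<partial>distr (density P ?u) ?C ?R)"
    by (subst nn_integral_distr, measurable) (subst nn_integral_density, auto simp: mult.commute)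
  also note eq
  also have "(\<integral>\<^sup>+\<omega>. indicator B \<omega> \<partial>scale_measure K (distr P ?C ?R)) = K * (\<integral>\<^sup>+\<omega>. indicator B (?R \<omega>) \<partial>P)"
    by (subst nn_integral_scale_measure, measurable) (subst nn_integral_distr, auto)
  finally show ?thesis by (simp add: K_def mult.commute)
qed

lemma lap_exhaustion:
  assumes X: "range X \<subseteq> sets M" "(\<Union>i. X i) = space M" "incseq X"
    and w: "\<omega> \<in> counting_measures M" and f: "f \<in> borel_measurable M"
  shows "(\<lambda>k. lap (\<lambda>x. f x * indicator (X k) x) \<omega>) \<longlonglongrightarrow> lap f \<omega>"
proof -
  note [measurable_cong] = counting_measures_sets[OF w] and [measurable] = f
  have [measurable]: "X k \<in> sets M" for k using X by auto
  let ?g = "\<lambda>k x. f x * indicator (X k) x"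
  have mono: "incseq ?g"
    using X(3) by (auto simp: incseq_def le_fun_def indicator_def dest: subsetD)
  have "(\<lambda>k. \<integral>\<^sup>+x. ?g k x \<partial>\<omega>) \<longlonglongrightarrow> (\<integral>\<^sup>+x. (SUP k. ?g k x) \<partial>\<omega>)"
    using mono by (intro nn_integral_LIMSEQ LIMSEQ_SUP) (auto simp: incseq_def le_fun_def)
  also have "(\<integral>\<^sup>+x. (SUP k. ?g k x) \<partial>\<omega>) = (\<integral>\<^sup>+x. f x \<partial>\<omega>)"
  proof (rule nn_integral_cong)
    fix x assume "x \<in> space \<omega>"
    then obtain k where "x \<in> X k" using X(2) counting_measures_space[OF w] by auto
    then show "(SUP k. ?g k x) = f x"
      by (intro antisym SUP_least SUP_upper2[of k]) (auto simp: indicator_def)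
  qed
  finally show ?thesis unfolding lap_def by (rule tendsto_nexp)
qed

text \<open>\<open>E\<close> is determined almost surely by the points outside \<open>X k\<close>,
  hence independent of the functionals of functions supported on \<open>X k\<close>. As k grows
  these reach every \<open>lap f\<close>, so \<open>E\<close> is independent of all events, itself
  included, and its probability p satisfies p = p * p.\<close>

lemma laplace_law_zero_one:
  assumes P: "laplace_law M t P" and E: "E \<in> sets P"
    and X: "range X \<subseteq> sets M" "(\<Union>i. X i) = space M" "incseq X"
    and B: "\<And>k. B k \<in> sets (configuration_space M)"
    and EB: "\<And>k. AE \<omega> in P. \<omega> \<in> E \<longleftrightarrow> restr (space M - X k) \<omega> \<in> B k"
  shows "emeasure P E = 0 \<or> emeasure P E = 1"
proof -
  note sP [measurable_cong] = laplace_lawD(2)[OF P] and [measurable] = E B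
  interpret P: prob_space P using P by (rule laplace_lawD)
  have [measurable]: "X k \<in> sets M" for k using X by auto
  have key: "(\<integral>\<^sup>+\<omega>. indicator E \<omega> * lap f \<omega> \<partial>P) = emeasure P E * (\<integral>\<^sup>+\<omega>. lap f \<omega> \<partial>P)"
    if f [measurable]: "f \<in> borel_measurable M" for f
  proof -
    let ?f = "\<lambda>k x. f x * indicator (X k) x"
    have lim: "(\<lambda>k. lap (?f k) \<omega>) \<longlonglongrightarrow> lap f \<omega>" if "\<omega> \<in> space P" for \<omega>
      using lap_exhaustion[OF X] that f by (simp add: laplace_lawD(3)[OF P])
    have "(\<lambda>k. \<integral>\<^sup>+\<omega>. indicator E \<omega> * lap (?f k) \<omega> \<partial>P) \<longlonglongrightarrow> (\<integral>\<^sup>+\<omega>. indicator E \<omega> * lap f \<omega> \<partial>P)"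
    proof (rule nn_integral_dominated_convergence[where w="\<lambda>_. 1"])
      show "AE \<omega> in P. (\<lambda>k. indicator E \<omega> * lap (?f k) \<omega>) \<longlonglongrightarrow> indicator E \<omega> * lap f \<omega>"
        using lim by (intro AE_I2 ennreal_tendsto_cmult) (auto simp: indicator_def)
    qed (auto simp: lap_le_1 P.emeasure_space_1 indicator_def)
    moreover have "(\<integral>\<^sup>+\<omega>. indicator E \<omega> * lap (?f k) \<omega> \<partial>P) = emeasure P E * (\<integral>\<^sup>+\<omega>. lap (?f k) \<omega> \<partial>P)" for k
    proof -
      have m [measurable]: "restr (space M - X k) \<in> measurable P (configuration_space M)"
        using measurable_restr[of "space M - X k" M] by (simp cong: measurable_cong_sets)
      have "(\<integral>\<^sup>+\<omega>. indicator E \<omega> * lap (?f k) \<omega> \<partial>P) = (\<integral>\<^sup>+\<omega>. indicator (B k) (restr (space M - X k) \<omega>) * lap (?f k) \<omega> \<partial>P)"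
        using EB[of k] by (intro nn_integral_cong_AE) (auto simp: indicator_def)
      also have "\<dots> = (\<integral>\<^sup>+\<omega>. indicator (B k) (restr (space M - X k) \<omega>) \<partial>P) * (\<integral>\<^sup>+\<omega>. lap (?f k) \<omega> \<partial>P)"
        by (rule laplace_law_restr_indep[OF P _ f B]) simp
      also have "(\<integral>\<^sup>+\<omega>. indicator (B k) (restr (space M - X k) \<omega>) \<partial>P) = (\<integral>\<^sup>+\<omega>. indicator E \<omega> \<partial>P)"
        using EB[of k] by (intro nn_integral_cong_AE) (auto simp: indicator_def)
      finally show ?thesis by simp
    qed
    moreover have "(\<lambda>k. emeasure P E * (\<integral>\<^sup>+\<omega>. lap (?f k) \<omega> \<partial>P)) \<longlonglongrightarrow> emeasure P E * (\<integral>\<^sup>+\<omega>. lap f \<omega> \<partial>P)"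
    proof (rule ennreal_tendsto_cmult)
      show "(\<lambda>k. \<integral>\<^sup>+\<omega>. lap (?f k) \<omega> \<partial>P) \<longlonglongrightarrow> (\<integral>\<^sup>+\<omega>. lap f \<omega> \<partial>P)"
        using lim by (intro nn_integral_dominated_convergence[where w="\<lambda>_. 1"])
          (auto simp: lap_le_1 P.emeasure_space_1)
    qed (simp add: less_top[symmetric])
    ultimately show ?thesis using LIMSEQ_unique by simp
  qed
  have "density P (indicator E) = scale_measure (emeasure P E) P"
  proof (rule laplace_unique[where M=M])
    show "finite_measure (density P (indicator E))"
      by (rule finite_measureI) (simp add: emeasure_density)
    show "finite_measure (scale_measure (emeasure P E) P)"
      by (rule finite_measureI) (simp add: space_scale_measure P.emeasure_space_1)
    fix f :: "'a \<Rightarrow> ennreal" assume f [measurable]: "f \<in> borel_measurable M"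
    have "(\<integral>\<^sup>+\<omega>. lap f \<omega> \<partial>density P (indicator E)) = (\<integral>\<^sup>+\<omega>. indicator E \<omega> * lap f \<omega> \<partial>P)"
      by (rule nn_integral_density) measurable
    also have "\<dots> = (\<integral>\<^sup>+\<omega>. lap f \<omega> \<partial>scale_measure (emeasure P E) P)"
      unfolding key[OF f] by (rule nn_integral_scale_measure[symmetric]) measurable
    finally show "(\<integral>\<^sup>+\<omega>. lap f \<omega> \<partial>density P (indicator E)) = (\<integral>\<^sup>+\<omega>. lap f \<omega> \<partial>scale_measure (emeasure P E) P)" .
  qed (simp_all add: sP)
  then have "emeasure (density P (indicator E)) E = emeasure (scale_measure (emeasure P E) P) E" by simp
  then have "emeasure P E = emeasure P E * emeasure P E"
    by (simp add: emeasure_density flip: indicator_inter_arith)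
  then have "P.prob E = P.prob E * P.prob E"
    by (simp add: P.emeasure_eq_measure flip: ennreal_mult)
  then show ?thesis by (auto simp: P.emeasure_eq_measure)
qed

section \<open>The derivative of a suspension\<close>

text \<open>\<open>ennreal\<close> cuts negative values to 0, so the two integrals are those of the
  positive and the negative part of \<open>l\<close>. The leading constant is the reciprocal of the
  mean of the product of exp (l x) over the points of a Poisson configuration.\<close>

definition susp_density :: "'a measure \<Rightarrow> real \<Rightarrow> ('a \<Rightarrow> real) \<Rightarrow> 'a measure \<Rightarrow> ennreal" where
  "susp_density M t l \<omega> = ennreal (exp (- t * (\<integral>x. exp (l x) - 1 \<partial>M))) *
     (pexp (\<integral>\<^sup>+x. ennreal (l x) \<partial>\<omega>) * nexp (\<integral>\<^sup>+x. ennreal (- l x) \<partial>\<omega>))"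

lemma measurable_susp_density [measurable]:
  assumes [measurable]: "l \<in> borel_measurable M"
  shows "susp_density M t l \<in> borel_measurable (configuration_space M)"
proof -
  have [measurable]: "(\<lambda>\<omega>. \<integral>\<^sup>+x. ennreal (l x) \<partial>\<omega>) \<in> borel_measurable (configuration_space M)"
    "(\<lambda>\<omega>. \<integral>\<^sup>+x. ennreal (- l x) \<partial>\<omega>) \<in> borel_measurable (configuration_space M)"
    by (rule measurable_nn_integral_configuration; measurable)+
  show ?thesis unfolding susp_density_def[abs_def] by measurable
qed

text \<open>Valid at every pair of configurations, without integrability: both parts of the exponent
  are additive in \<open>ennreal\<close>.\<close>

lemma susp_density_superpose:
  assumes "\<omega> \<in> counting_measures M" "\<eta> \<in> counting_measures M" and [measurable]: "l \<in> borel_measurable M"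
  shows "susp_density M (s + r) l (superpose M \<omega> \<eta>) = susp_density M s l \<omega> * susp_density M r l \<eta>"
proof -
  have "exp (- (s + r) * (\<integral>x. exp (l x) - 1 \<partial>M)) = exp (- s * (\<integral>x. exp (l x) - 1 \<partial>M)) * exp (- r * (\<integral>x. exp (l x) - 1 \<partial>M))"
    by (simp add: exp_add[symmetric] algebra_simps)
  then show ?thesis
    using assms(1,2)
    by (simp add: susp_density_def nn_integral_superpose counting_measures_sets pexp_add nexp_add
          ennreal_mult ac_simps)
qed

lemma suspension_counting_measures:
  assumes "U \<in> measurable M M" "\<omega> \<in> counting_measures M"
  shows "suspension M U \<omega> \<in> counting_measures M"
  using measurable_space[OF measurable_suspension[OF assms(1)]] assms(2)
  by (simp add: space_configuration_space)

lemma nn_integral_suspension: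
  assumes "U \<in> measurable M M" "\<omega> \<in> counting_measures M" "f \<in> borel_measurable M"
  shows "(\<integral>\<^sup>+x. f x \<partial>suspension M U \<omega>) = (\<integral>\<^sup>+x. f (U x) \<partial>\<omega>)"
  unfolding suspension_def using assms
  by (intro nn_integral_distr) (auto intro: measurable_counting_measures)

lemma finite_measure_density_bounded:
  assumes P: "prob_space P" and [measurable]: "g \<in> borel_measurable P"
    and le: "\<And>x. g x \<le> c" and "c < top"
  shows "finite_measure (density P g)"
proof (rule finite_measureI)
  interpret prob_space P by fact
  have "emeasure (density P g) (space P) = (\<integral>\<^sup>+x. g x * indicator (space P) x \<partial>P)"
    by (rule emeasure_density) auto
  also have "\<dots> \<le> (\<integral>\<^sup>+x. c \<partial>P)"
    using le by (intro nn_integral_mono) (auto simp: indicator_def)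
  finally have "emeasure (density P g) (space P) \<le> (\<integral>\<^sup>+x. c \<partial>P)" .
  then show "emeasure (density P g) (space (density P g)) \<noteq> \<infinity>"
    using \<open>c < top\<close> by (auto simp: emeasure_space_1 top_unique)
qed

text \<open>On a bounded range, l is dominated by \<bar>exp l - 1\<bar>: l \<le> \<bar>exp l -
  1\<bar> where l \<ge> 0, and - l \<le> exp L * \<bar>exp l - 1\<bar>. The third integral is that
  of the positive part against the image measure with density exp l.\<close>

lemma integrable_exp_diff:
  fixes l :: "'a \<Rightarrow> real"
  assumes [measurable]: "l \<in> borel_measurable M" and int: "integrable M (\<lambda>x. exp (l x) - 1)"
    and L: "\<And>x. \<bar>l x\<bar> \<le> L"
  shows "(\<integral>\<^sup>+x. ennreal (l x) \<partial>M) < \<infinity>" "(\<integral>\<^sup>+x. ennreal (- l x) \<partial>M) < \<infinity>"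
    "(\<integral>\<^sup>+x. ennreal (l x) * ennreal (exp (l x)) \<partial>M) < \<infinity>"
proof -
  have fin: "(\<integral>\<^sup>+x. ennreal (exp L * \<bar>exp (l x) - 1\<bar>) \<partial>M) < \<infinity>"
    using int by (simp add: ennreal_mult nn_integral_cmult integrable_iff_bounded ennreal_mult_less_top)
  have "0 \<le> L" using L[of undefined] by linarith
  have 1: "l x * exp (l x) \<le> exp L * \<bar>exp (l x) - 1\<bar>" if "l x \<ge> 0" for x
  proof -
    have "l x \<le> \<bar>exp (l x) - 1\<bar>" using exp_ge_add_one_self[of "l x"] by linarith
    moreover have "exp (l x) \<le> exp L" using L[of x] by simp
    ultimately show ?thesis using that by (subst (1) mult.commute) (intro mult_mono, auto)
  qed
  have 2: "l x \<le> l x * exp (l x)" if "l x \<ge> 0" for x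
    using mult_left_mono[of 1 "exp (l x)" "l x"] that by simp
  have 3: "- l x \<le> exp L * \<bar>exp (l x) - 1\<bar>" for x
  proof (cases "l x \<ge> 0")
    case False
    have "- l x \<le> exp (- l x) - 1" using exp_ge_add_one_self[of "- l x"] by linarith
    also have "\<dots> = exp (- l x) * (1 - exp (l x))" by (simp add: algebra_simps flip: exp_add)
    also have "\<dots> \<le> exp L * \<bar>exp (l x) - 1\<bar>"
      using L[of x] False by (intro mult_mono) auto
    finally show ?thesis .
  qed (smt (verit) exp_gt_zero mult_nonneg_nonneg)
  show "(\<integral>\<^sup>+x. ennreal (- l x) \<partial>M) < \<infinity>"
    using 3 by (intro le_less_trans[OF nn_integral_mono fin]) (auto intro!: ennreal_leI)
  have le: "ennreal (l x) * ennreal (exp (l x)) \<le> ennreal (exp L * \<bar>exp (l x) - 1\<bar>)"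
    "ennreal (l x) \<le> ennreal (exp L * \<bar>exp (l x) - 1\<bar>)" for x
    using 1[of x] 2[of x] by (cases "l x \<ge> 0"; auto intro!: ennreal_leI simp: ennreal_neg simp flip: ennreal_mult)+
  show "(\<integral>\<^sup>+x. ennreal (l x) * ennreal (exp (l x)) \<partial>M) < \<infinity>" "(\<integral>\<^sup>+x. ennreal (l x) \<partial>M) < \<infinity>"
    by (rule le_less_trans[OF nn_integral_mono fin], rule le)+
qed

text \<open>As l - max l 0 = - max (- l) 0, multiplying exp (- a - max l 0) by exp l gives exp (- a
  - max (- l) 0). The terms with 1 - exp l and exp l - 1 balance the remaining exp l against 1; they
  stand on opposite sides because \<open>ennreal\<close> has no signed difference.\<close>

lemma tilt_identity:
  fixes l :: real and a :: ennreal
  shows "ennreal (exp l) * cexp (a + ennreal l) + ennreal (1 - exp l) =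
         cexp (a + ennreal (- l)) + ennreal (exp l - 1)"
proof (cases a)
  case (real r)
  have e: "1 - exp (- (r + max l 0)) \<ge> 0" "1 - exp (- (r + max (- l) 0)) \<ge> 0" using real by auto
  have a: "ennreal r + ennreal k = ennreal (r + max k 0)" for k
    using real by (cases "k \<ge> 0") (auto simp: ennreal_neg max_def)
  have "exp l * (1 - exp (- (r + max l 0))) + max (1 - exp l) 0 =
        1 - exp (- (r + max (- l) 0)) + max (exp l - 1) 0"
    by (cases "l \<ge> 0") (auto simp: max_def algebra_simps simp flip: exp_add)
  then have "ennreal (exp l * (1 - exp (- (r + max l 0))) + max (1 - exp l) 0) =
        ennreal (1 - exp (- (r + max (- l) 0)) + max (exp l - 1) 0)" by (rule arg_cong)
  moreover have "ennreal (exp l * (1 - exp (- (r + max l 0))) + max (1 - exp l) 0) =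
      ennreal (exp l) * ennreal (1 - exp (- (r + max l 0))) + ennreal (1 - exp l)"
    using e by (subst ennreal_plus) (auto simp: ennreal_mult)
  moreover have "ennreal (1 - exp (- (r + max (- l) 0)) + max (exp l - 1) 0) =
      ennreal (1 - exp (- (r + max (- l) 0))) + ennreal (exp l - 1)"
    using e by (subst ennreal_plus) auto
  moreover have "cexp (a + ennreal k) = ennreal (1 - exp (- (r + max k 0)))" for k
    unfolding real(2) a using real(1) by (intro cexp_ennreal) simp
  ultimately show ?thesis by (simp only:)
next
  case top
  have "ennreal (exp l) + ennreal (1 - exp l) = 1 + ennreal (exp l - 1)"
    by (cases "l \<ge> 0") (auto simp: ennreal_neg simp flip: ennreal_plus ennreal_1)
  then show ?thesis using top by simp
qed

text \<open>Integrates \<open>tilt_identity\<close> with a = f x. The parts of exp l - 1 have finite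
  integrals \<open>u\<close> and \<open>v\<close>, and - t (u - v) is the exponent of the constant
  in front.\<close>

lemma tilt_laplace:
  assumes [measurable]: "l \<in> borel_measurable M" "f \<in> borel_measurable M" and int: "integrable M (\<lambda>x. exp (l x) - 1)"
    and t: "0 \<le> t"
  shows "ennreal (exp (- t * (\<integral>x. exp (l x) - 1 \<partial>M))) * nexp (ennreal t * (\<integral>\<^sup>+x. cexp (f x + ennreal (- l x)) \<partial>M)) =
    nexp (ennreal t * (\<integral>\<^sup>+x. ennreal (exp (l x)) * cexp (f x + ennreal (l x)) \<partial>M))"
proof -
  define A where "A = (\<integral>\<^sup>+x. ennreal (exp (l x)) * cexp (f x + ennreal (l x)) \<partial>M)"
  define B where "B = (\<integral>\<^sup>+x. cexp (f x + ennreal (- l x)) \<partial>M)"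
  define u where "u = (\<integral>\<^sup>+x. ennreal (exp (l x) - 1) \<partial>M)"
  define v where "v = (\<integral>\<^sup>+x. ennreal (1 - exp (l x)) \<partial>M)"
  have uv: "u < \<infinity>" "v < \<infinity>"
    using int by (auto simp: real_integrable_def u_def v_def less_top)
  have b: "(\<integral>x. exp (l x) - 1 \<partial>M) = enn2real u - enn2real v"
    using real_lebesgue_integral_def[OF int] by (simp add: u_def v_def)
  have AB: "A + v = B + u"
    unfolding A_def B_def u_def v_def
    by (subst (1 2) nn_integral_add[symmetric]) (auto simp: tilt_identity)
  show ?thesis
    unfolding A_def[symmetric] B_def[symmetric]
  \<comment> \<open>\<open>u\<close> and \<open>v\<close> are finite, so \<open>A\<close> and
    \<open>B\<close> are infinite together; both sides are then 0 if t > 0, and 1 if t = 0.\<close>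
  proof (cases "B = \<infinity> \<or> A = \<infinity>")
    case True
    have "A + v = top \<longleftrightarrow> B + u = top" by (simp only: AB)
    with True uv have "A = \<infinity>" "B = \<infinity>"
      by (auto simp: less_top[symmetric])
    then show "ennreal (exp (- t * (\<integral>x. exp (l x) - 1 \<partial>M))) * nexp (ennreal t * B) = nexp (ennreal t * A)"
      using t by (cases "t = 0") (auto simp: ennreal_mult_top)
  next
    case False
    then obtain a b' where ab: "0 \<le> a" "A = ennreal a" "0 \<le> b'" "B = ennreal b'"
      by (cases A; cases B) auto
    obtain u' v' where uv': "0 \<le> u'" "u = ennreal u'" "0 \<le> v'" "v = ennreal v'"
      using uv by (cases u; cases v) auto
    have "a + v' = b' + u'" using AB ab uv' by (simp flip: ennreal_plus)
    then have a: "a = b' + u' - v'" by simp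
    show "ennreal (exp (- t * (\<integral>x. exp (l x) - 1 \<partial>M))) * nexp (ennreal t * B) = nexp (ennreal t * A)"
      using ab uv' t unfolding b
      by (simp add: nexp_ennreal flip: ennreal_mult exp_add) (simp add: a algebra_simps)
  qed
qed

text \<open>\<open>laplace_unique\<close> compares finite measures, but the factor
  \<open>pexp\<close> of the density is unbounded. So \<open>half\<close> first weights the image
  law by \<open>lap ?p\<close>, which makes both densities bounded. Then \<open>pexp\<close> is
  multiplied back: it inverts \<open>lap ?p\<close> because the positive part of \<open>l\<close>
  has a finite integral over almost every image configuration.\<close>

lemma distr_suspension:
  assumes P: "laplace_law M t P" and t: "0 \<le> t"
    and U [measurable]: "U \<in> measurable M M" and l [measurable]: "l \<in> borel_measurable M"
    and int: "integrable M (\<lambda>x. exp (l x) - 1)" and L: "\<And>x. \<bar>l x\<bar> \<le> L"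
    and dens: "distr M M U = density M (\<lambda>x. ennreal (exp (l x)))"
  shows "distr P P (suspension M U) = density P (susp_density M t l)"
proof -
  let ?C = "configuration_space M"
  note sP [measurable_cong] = laplace_lawD(2)[OF P]
  have spP: "space P = counting_measures M" by (rule laplace_lawD(3)[OF P])
  interpret P: prob_space P using P by (rule laplace_lawD)
  let ?p = "\<lambda>x. ennreal (l x)" and ?q = "\<lambda>x. ennreal (- l x)"
  have mq: "?q \<in> borel_measurable M" and mp: "?p \<in> borel_measurable M" by measurable
  have [measurable]: "(\<lambda>\<omega>. \<integral>\<^sup>+x. ?p x \<partial>\<omega>) \<in> borel_measurable ?C" "lap ?p \<in> borel_measurable ?C"
    "lap ?q \<in> borel_measurable ?C"
    by (rule measurable_nn_integral_configuration measurable_lap; measurable)+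
  have S [measurable]: "suspension M U \<in> measurable P ?C"
    using measurable_suspension[OF U] by (simp cong: measurable_cong_sets)
  define c where "c = ennreal (exp (- t * (\<integral>x. exp (l x) - 1 \<partial>M)))"
  have change: "(\<integral>\<^sup>+x. g (U x) \<partial>M) = (\<integral>\<^sup>+x. ennreal (exp (l x)) * g x \<partial>M)"
    if [measurable]: "g \<in> borel_measurable M" for g :: "'a \<Rightarrow> ennreal"
  proof -
    have "(\<integral>\<^sup>+x. g (U x) \<partial>M) = (\<integral>\<^sup>+x. g x \<partial>distr M M U)" by (simp add: nn_integral_distr)
    also have "\<dots> = (\<integral>\<^sup>+x. ennreal (exp (l x)) * g x \<partial>M)" unfolding dens by (subst nn_integral_density) auto
    finally show ?thesis .
  qed
  interpret D: prob_space "distr P ?C (suspension M U)" by (rule P.prob_space_distr) (rule S)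
  have half: "density P (\<lambda>\<omega>. c * lap ?q \<omega>) = density (distr P ?C (suspension M U)) (lap ?p)"
  proof (rule laplace_unique[where M=M])
    show "finite_measure (density P (\<lambda>\<omega>. c * lap ?q \<omega>))"
      using mult_left_mono[OF lap_le_1, of c ?q]
      by (intro finite_measure_density_bounded[OF P.prob_space_axioms, where c=c]) (auto simp: c_def)
    show "finite_measure (density (distr P ?C (suspension M U)) (lap ?p))"
      by (intro finite_measure_density_bounded[OF D.prob_space_axioms, where c=1]) (auto simp: lap_le_1)
    fix f :: "'a \<Rightarrow> ennreal" assume f [measurable]: "f \<in> borel_measurable M"
    have "(\<integral>\<^sup>+\<omega>. lap f \<omega> \<partial>density P (\<lambda>\<omega>. c * lap ?q \<omega>)) = (\<integral>\<^sup>+\<omega>. c * lap ?q \<omega> * lap f \<omega> \<partial>P)"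
      by (rule nn_integral_density) measurable
    also have "\<dots> = (\<integral>\<^sup>+\<omega>. c * lap (\<lambda>x. f x + ?q x) \<omega> \<partial>P)"
      by (intro nn_integral_cong) (simp add: lap_add[OF _ f mq] spP ac_simps)
    also have "\<dots> = c * (\<integral>\<^sup>+\<omega>. lap (\<lambda>x. f x + ?q x) \<omega> \<partial>P)"
      by (rule nn_integral_cmult) measurable
    also have "\<dots> = c * nexp (ennreal t * (\<integral>\<^sup>+x. cexp (f x + ?q x) \<partial>M))"
      by (subst laplace_lawD(4)[OF P]) auto
    also have "\<dots> = nexp (ennreal t * (\<integral>\<^sup>+x. ennreal (exp (l x)) * cexp (f x + ?p x) \<partial>M))"
      unfolding c_def by (rule tilt_laplace[OF l f int t])
    also have "\<dots> = nexp (ennreal t * (\<integral>\<^sup>+x. cexp (f (U x) + ?p (U x)) \<partial>M))"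
      by (subst change[of "\<lambda>x. cexp (f x + ?p x)"]) auto
    also have "\<dots> = (\<integral>\<^sup>+\<omega>. lap (\<lambda>x. f (U x) + ?p (U x)) \<omega> \<partial>P)"
      by (subst laplace_lawD(4)[OF P]) auto
    also have "\<dots> = (\<integral>\<^sup>+\<omega>. lap ?p (suspension M U \<omega>) * lap f (suspension M U \<omega>) \<partial>P)"
    proof (rule nn_integral_cong)
      fix \<omega> assume "\<omega> \<in> space P"
      then have w: "\<omega> \<in> counting_measures M" by (simp add: spP)
      have "lap (\<lambda>x. f (U x) + ?p (U x)) \<omega> = lap (\<lambda>x. f x + ?p x) (suspension M U \<omega>)"
        unfolding lap_def by (subst nn_integral_suspension[OF U w]) auto
      also have "\<dots> = lap ?p (suspension M U \<omega>) * lap f (suspension M U \<omega>)"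
        by (simp add: lap_add[OF suspension_counting_measures[OF U w] f mp] mult.commute)
      finally show "lap (\<lambda>x. f (U x) + ?p (U x)) \<omega> = lap ?p (suspension M U \<omega>) * lap f (suspension M U \<omega>)" .
    qed
    also have "\<dots> = (\<integral>\<^sup>+\<omega>. lap f \<omega> \<partial>density (distr P ?C (suspension M U)) (lap ?p))"
      by (subst nn_integral_density, measurable) (subst nn_integral_distr, auto)
    finally show "(\<integral>\<^sup>+\<omega>. lap f \<omega> \<partial>density P (\<lambda>\<omega>. c * lap ?q \<omega>)) =
      (\<integral>\<^sup>+\<omega>. lap f \<omega> \<partial>density (distr P ?C (suspension M U)) (lap ?p))" .
  qed (simp_all add: sP)
  have "AE \<omega> in P. (\<integral>\<^sup>+x. ?p (U x) \<partial>\<omega>) < \<infinity>"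
  proof (rule laplace_law_AE_finite[OF P])
    show "(\<integral>\<^sup>+x. ?p (U x) \<partial>M) < \<infinity>"
      using integrable_exp_diff(3)[OF l int L] by (subst change[of ?p]) (auto simp: mult.commute)
  qed measurable
  then have "AE \<omega> in P. (\<integral>\<^sup>+x. ?p x \<partial>suspension M U \<omega>) < \<infinity>"
    using AE_space by eventually_elim (simp add: nn_integral_suspension[OF U _ mp] spP)
  then have fin: "AE \<omega> in distr P ?C (suspension M U). (\<integral>\<^sup>+x. ?p x \<partial>\<omega>) < \<infinity>"
    by (subst AE_distr_iff) auto
  have "distr P P (suspension M U) = distr P ?C (suspension M U)"
    by (rule distr_cong) (auto simp: sP)
  also have "\<dots> = density (distr P ?C (suspension M U)) (\<lambda>_. 1)"
    by (simp add: density_1)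
  also have "\<dots> = density (distr P ?C (suspension M U)) (\<lambda>\<omega>. lap ?p \<omega> * pexp (\<integral>\<^sup>+x. ?p x \<partial>\<omega>))"
    using fin by (intro density_cong) (auto simp: lap_def nexp_pexp)
  also have "\<dots> = density (density (distr P ?C (suspension M U)) (lap ?p)) (\<lambda>\<omega>. pexp (\<integral>\<^sup>+x. ?p x \<partial>\<omega>))"
    by (rule density_density_eq[symmetric]) measurable
  also have "\<dots> = density (density P (\<lambda>\<omega>. c * lap ?q \<omega>)) (\<lambda>\<omega>. pexp (\<integral>\<^sup>+x. ?p x \<partial>\<omega>))"
    by (simp only: half)
  also have "\<dots> = density P (\<lambda>\<omega>. c * lap ?q \<omega> * pexp (\<integral>\<^sup>+x. ?p x \<partial>\<omega>))"
    by (rule density_density_eq) measurable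
  also have "(\<lambda>\<omega>. c * lap ?q \<omega> * pexp (\<integral>\<^sup>+x. ?p x \<partial>\<omega>)) = susp_density M t l"
    by (auto simp: fun_eq_iff susp_density_def c_def lap_def ac_simps)
  finally show ?thesis .
qed

text \<open>The negative part of \<open>l\<close> has a finite integral over almost every
  configuration, so \<open>nexp\<close> of it is not 0. Positivity is what lets null sets be carried
  back through the inverse in \<open>totally_dissipativeI\<close>.\<close>

lemma susp_density_pos:
  assumes P: "laplace_law M t P"
    and l [measurable]: "l \<in> borel_measurable M"
    and int: "integrable M (\<lambda>x. exp (l x) - 1)" and L: "\<And>x. \<bar>l x\<bar> \<le> L"
  shows "AE \<omega> in P. 0 < susp_density M t l \<omega>"
proof -
  have "AE \<omega> in P. (\<integral>\<^sup>+x. ennreal (- l x) \<partial>\<omega>) < \<infinity>"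
    by (rule laplace_law_AE_finite[OF P _ integrable_exp_diff(2)[OF l int L]]) measurable
  then show ?thesis
  proof eventually_elim
    case (elim \<omega>)
    have "1 \<le> pexp (\<integral>\<^sup>+x. ennreal (l x) \<partial>\<omega>)" by (rule pexp_ge_1)
    then have "0 < pexp (\<integral>\<^sup>+x. ennreal (l x) \<partial>\<omega>)" by (rule less_le_trans[rotated]) simp
    moreover have "0 < nexp (\<integral>\<^sup>+x. ennreal (- l x) \<partial>\<omega>)"
      using elim by (simp add: zero_less_iff_neq_zero nexp_eq_0_iff)
    ultimately show ?case by (simp add: susp_density_def ennreal_zero_less_mult_iff)
  qed
qed

lemma susp_density_restr:
  assumes w: "\<omega> \<in> counting_measures M" and A [measurable]: "A \<in> sets M" and fin: "emeasure \<omega> A < \<infinity>"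
    and l [measurable]: "\<And>n. l n \<in> borel_measurable M" and L: "\<And>n x. \<bar>l n x\<bar> \<le> L"
  shows "(\<Sum>n. susp_density M t (l n) \<omega>) = \<infinity> \<longleftrightarrow>
         (\<Sum>n. susp_density M t (l n) (restr (space M - A) \<omega>)) = \<infinity>"
proof -
  note [measurable_cong] = counting_measures_sets[OF w]
  let ?R = "restr (space M - A) \<omega>"
  \<comment> \<open>Each point of \<open>A\<close> contributes a factor between exp (- L) and exp L,
    whatever n is; finiteness of \<omega>(A) makes \<open>a\<close> positive and \<open>b\<close>
    finite.\<close>
  define a where "a = nexp (ennreal L * emeasure \<omega> A)"
  define b where "b = pexp (ennreal L * emeasure \<omega> A)"
  have ab: "a \<noteq> 0" "b \<noteq> \<infinity>" "b \<noteq> top"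
    using fin by (auto simp: a_def b_def nexp_eq_0_iff pexp_eq_top_iff ennreal_mult_eq_top_iff)
  have split: "(\<integral>\<^sup>+x. f x \<partial>\<omega>) = (\<integral>\<^sup>+x. f x \<partial>?R) + (\<integral>\<^sup>+x. f x * indicator A x \<partial>\<omega>)"
    if f [measurable]: "f \<in> borel_measurable M" for f
  proof -
    have "(\<integral>\<^sup>+x. f x \<partial>\<omega>) = (\<integral>\<^sup>+x. f x * indicator (space M - A) x + f x * indicator A x \<partial>\<omega>)"
      by (intro nn_integral_cong) (auto simp: indicator_def counting_measures_space[OF w])
    also have "\<dots> = (\<integral>\<^sup>+x. f x * indicator (space M - A) x \<partial>\<omega>) + (\<integral>\<^sup>+x. f x * indicator A x \<partial>\<omega>)"
      by (rule nn_integral_add) measurable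
    also have "(\<integral>\<^sup>+x. f x * indicator (space M - A) x \<partial>\<omega>) = (\<integral>\<^sup>+x. f x \<partial>?R)"
      by (rule nn_integral_restr[symmetric, OF w]) measurable
    finally show ?thesis .
  qed
  have bound: "(\<integral>\<^sup>+x. ennreal (k x) * indicator A x \<partial>\<omega>) \<le> ennreal L * emeasure \<omega> A"
    if "\<And>x. k x \<le> L" for k
  proof -
    have "(\<integral>\<^sup>+x. ennreal (k x) * indicator A x \<partial>\<omega>) \<le> (\<integral>\<^sup>+x. ennreal L * indicator A x \<partial>\<omega>)"
      using that by (intro nn_integral_mono mult_right_mono ennreal_leI) auto
    also have "\<dots> = ennreal L * emeasure \<omega> A"
      by (rule nn_integral_cmult_indicator) measurable
    finally show ?thesis .
  qed
  define w where "w n = pexp (\<integral>\<^sup>+x. ennreal (l n x) * indicator A x \<partial>\<omega>) * nexp (\<integral>\<^sup>+x. ennreal (- l n x) * indicator A x \<partial>\<omega>)" for n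
  have D: "susp_density M t (l n) \<omega> = susp_density M t (l n) ?R * w n" for n
    unfolding susp_density_def w_def
    by (subst (1 2) split) (auto simp: pexp_add nexp_add ac_simps)
  have wa: "a \<le> w n" for n
  proof -
    have "- l n x \<le> L" for x using L[of n x] by linarith
    then have "a \<le> nexp (\<integral>\<^sup>+x. ennreal (- l n x) * indicator A x \<partial>\<omega>)"
      unfolding a_def by (intro nexp_mono bound)
    with mult_mono[OF pexp_ge_1 this] show ?thesis by (simp add: w_def)
  qed
  have wb: "w n \<le> b" for n
  proof -
    have "l n x \<le> L" for x using L[of n x] by linarith
    then have "pexp (\<integral>\<^sup>+x. ennreal (l n x) * indicator A x \<partial>\<omega>) \<le> b"
      unfolding b_def by (intro pexp_mono bound)
    from mult_mono[OF this nexp_le_1] show ?thesis by (simp add: w_def)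
  qed
  have "(\<Sum>n. susp_density M t (l n) ?R) * a \<le> (\<Sum>n. susp_density M t (l n) \<omega>)"
    unfolding D ennreal_suminf_multc[symmetric] using wa by (intro suminf_le mult_left_mono) auto
  moreover have "(\<Sum>n. susp_density M t (l n) \<omega>) \<le> (\<Sum>n. susp_density M t (l n) ?R) * b"
    unfolding D ennreal_suminf_multc[symmetric] using wb by (intro suminf_le mult_left_mono) auto
  ultimately show ?thesis using ab
    by (auto simp: top_unique ennreal_mult_eq_top_iff ennreal_top_mult)
qed

lemma susp_density_zero_one:
  assumes P: "laplace_law M t P" and M: "sigma_finite_measure M"
    and l [measurable]: "\<And>n. l n \<in> borel_measurable M" and L: "\<And>n x. \<bar>l n x\<bar> \<le> L"
  shows "(AE \<omega> in P. (\<Sum>n. susp_density M t (l n) \<omega>) = \<infinity>) \<or>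
         (AE \<omega> in P. (\<Sum>n. susp_density M t (l n) \<omega>) < \<infinity>)"
proof -
  note sP [measurable_cong] = laplace_lawD(2)[OF P]
  have spP: "space P = counting_measures M" by (rule laplace_lawD(3)[OF P])
  interpret P: prob_space P using P by (rule laplace_lawD)
  obtain X where X: "range X \<subseteq> sets M" "(\<Union>i. X i) = space M" "\<And>i. emeasure M (X i) \<noteq> \<infinity>" "incseq X"
    by (rule sigma_finite_measure.sigma_finite_incseq[OF M]) blast
  have Xs [measurable]: "X k \<in> sets M" for k using X by auto
  have [measurable]: "susp_density M t (l n) \<in> borel_measurable (configuration_space M)" for n by measurable
  define E where "E = {\<omega>\<in>space P. (\<Sum>n. susp_density M t (l n) \<omega>) = \<infinity>}"
  have E [measurable]: "E \<in> sets P" unfolding E_def by measurable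
  have "emeasure P E = 0 \<or> emeasure P E = 1"
  proof (rule laplace_law_zero_one[OF P E X(1,2,4)])
    fix k
    \<comment> \<open>\<open>E\<close> itself serves as \<open>B k\<close> for every k: divergence
      holds for \<omega> exactly if it holds for the restriction of \<omega>.\<close>
    show "E \<in> sets (configuration_space M)" using E sP by simp
    have "AE \<omega> in P. (\<integral>\<^sup>+x. indicator (X k) x \<partial>\<omega>) < \<infinity>"
      using X(3)[of k] by (intro laplace_law_AE_finite[OF P]) (auto simp: less_top)
    with AE_space show "AE \<omega> in P. (\<omega> \<in> E) = (restr (space M - X k) \<omega> \<in> E)"
    proof eventually_elim
      case (elim \<omega>)
      then have w: "\<omega> \<in> counting_measures M" by (simp add: spP)
      have "emeasure \<omega> (X k) < \<infinity>"
        using elim Xs[of k] counting_measures_sets[OF w] by simp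
      from susp_density_restr[OF w Xs this l L, of t] show ?case
        using w by (simp add: E_def spP restr_counting_measures)
    qed
  qed
  then show ?thesis
  proof
    assume "emeasure P E = 1"
    then have "AE \<omega> in P. (\<Sum>n. susp_density M t (l n) \<omega>) = \<infinity>"
      using E unfolding E_def by (rule P.AE_I_eq_1)
    then show ?thesis ..
  next
    assume "emeasure P E = 0"
    then have "AE \<omega> in P. \<omega> \<notin> E" by (intro AE_not_in null_setsI E)
    with AE_space have "AE \<omega> in P. (\<Sum>n. susp_density M t (l n) \<omega>) < \<infinity>"
      by eventually_elim (simp add: E_def less_top)
    then show ?thesis by blast
  qed
qed

section \<open>Existence of Poisson laws\<close>

text \<open>Finitely many coordinates enter, so restriction to them reduces the infinite product to
  a finite one.\<close>

lemma nn_integral_PiM_prefix: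
  fixes N :: "nat \<Rightarrow> 'a measure"
  assumes N: "\<And>i. prob_space (N i)" and [measurable]: "\<And>i. g i \<in> borel_measurable (N i)"
  shows "(\<integral>\<^sup>+w. (\<Prod>i<n. g i (w i)) \<partial>PiM UNIV N) = (\<Prod>i<n. \<integral>\<^sup>+x. g i x \<partial>N i)"
proof -
  interpret prob_space "N i" for i by (rule N)
  interpret product_prob_space N UNIV ..
  let ?J = "{..<n}"
  have m: "(\<lambda>w. restrict w ?J) \<in> measurable (PiM UNIV N) (PiM ?J N)"
    by (rule measurable_restrict_subset) simp
  have p: "(\<lambda>w. \<Prod>i<n. g i (w i)) \<in> borel_measurable (PiM ?J N)"
    by (intro borel_measurable_prod_ennreal measurable_compose[OF measurable_component_singleton]) auto
  have "(\<integral>\<^sup>+w. (\<Prod>i<n. g i (w i)) \<partial>PiM UNIV N) = (\<integral>\<^sup>+w. (\<Prod>i<n. g i (restrict w ?J i)) \<partial>PiM UNIV N)"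
    by (intro nn_integral_cong prod.cong) auto
  also have "\<dots> = (\<integral>\<^sup>+w. (\<Prod>i<n. g i (w i)) \<partial>distr (PiM UNIV N) (PiM ?J N) (\<lambda>w. restrict w ?J))"
    by (rule nn_integral_distr[symmetric, OF m]) (use p in simp)
  also have "\<dots> = (\<Prod>i<n. \<integral>\<^sup>+x. g i x \<partial>N i)"
    unfolding distr_PiM_restrict_finite[OF finite_lessThan subset_UNIV]
    by (rule product_nn_integral_prod) auto
  finally show ?thesis .
qed

lemma poisson_pgf:
  assumes "0 < l" "0 \<le> y"
  shows "(\<integral>\<^sup>+k. ennreal (y ^ k) \<partial>measure_pmf (poisson_pmf l)) = ennreal (exp (l * (y - 1)))"
proof -
  have "(\<integral>\<^sup>+k. ennreal (y ^ k) \<partial>measure_pmf (poisson_pmf l)) = (\<Sum>k. ennreal (inverse (fact k) * (l * y) ^ k * exp (- l)))"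
    using assms
    by (simp add: nn_integral_measure_pmf nn_integral_count_space_nat field_simps power_mult_distrib flip: ennreal_mult)
  also have "\<dots> = ennreal (exp (l * y) * exp (- l))"
    using sums_mult2[OF exp_converges[of "l * y"], of "exp (- l)"] assms
    by (intro suminf_ennreal_eq) (auto simp: scaleR_conv_of_real)
  also have "exp (l * y) * exp (- l) = exp (l * (y - 1))"
    by (simp add: exp_add[symmetric] algebra_simps)
  finally show ?thesis .
qed

text \<open>\<open>N\<close> is the law of the number of points in \<open>A\<close> and
  \<open>m\<close> the law of each point, all drawn independently. With \<open>N\<close> Poisson of
  mean t \<mu>(A) and \<open>m\<close> the normalized \<mu> on \<open>A\<close>, the left side is
  the generating function of \<open>N\<close> at J = \<integral> exp (- f) dm, and \<mu>(A) (1 - J)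
  is the integral of 1 - exp (- f) over \<open>A\<close>.\<close>

lemma finite_piece:
  assumes A [measurable]: "A \<in> sets M" and fin: "emeasure M A < \<infinity>" and ne: "space M \<noteq> {}" and t: "0 < t"
  shows "\<exists>(N :: nat pmf) m. prob_space m \<and> sets m = sets M \<and>
     (\<forall>f\<in>borel_measurable M. (\<integral>\<^sup>+k. (\<integral>\<^sup>+x. nexp (f x) \<partial>m) ^ k \<partial>measure_pmf N) =
        nexp (ennreal t * (\<integral>\<^sup>+x. cexp (f x) * indicator A x \<partial>M)))"
proof (cases "emeasure M A = 0")
  case True
  \<comment> \<open>A null piece gets no points, yet \<open>m\<close> must be a probability; a Dirac
    mass fills in.\<close>
  obtain x0 where "x0 \<in> space M" using ne by auto
  then have "prob_space (return M x0)" by (rule prob_space_return)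
  moreover have "(\<integral>\<^sup>+x. cexp (f x) * indicator A x \<partial>M) = 0" if "f \<in> borel_measurable M" for f
    using nn_integral_null_set[of A M "\<lambda>x. cexp (f x)"] True A by (simp add: null_setsI)
  ultimately show ?thesis
    by (intro exI[of _ "return_pmf 0"] exI[of _ "return M x0"]) auto
next
  case False
  define a where "a = measure M A"
  have a: "0 < a" "emeasure M A = ennreal a"
    using False fin by (auto simp: a_def emeasure_eq_ennreal_measure zero_less_measure_iff less_top)
  define m where "m = density M (\<lambda>x. ennreal (1 / a) * indicator A x)"
  have int: "(\<integral>\<^sup>+x. g x \<partial>m) = ennreal (1 / a) * (\<integral>\<^sup>+x. g x * indicator A x \<partial>M)"
    if [measurable]: "g \<in> borel_measurable M" for g
    unfolding m_def by (subst nn_integral_density) (auto simp: nn_integral_cmult[symmetric] ac_simps)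
  have pm: "prob_space m"
  proof (rule prob_spaceI)
    have "emeasure m (space m) = (\<integral>\<^sup>+x. 1 \<partial>m)" by simp
    also have "\<dots> = 1" using a by (subst int) (auto simp flip: ennreal_mult)
    finally show "emeasure m (space m) = 1" .
  qed
  interpret m: prob_space m by (rule pm)
  have "(\<integral>\<^sup>+k. (\<integral>\<^sup>+x. nexp (f x) \<partial>m) ^ k \<partial>measure_pmf (poisson_pmf (t * a))) =
        nexp (ennreal t * (\<integral>\<^sup>+x. cexp (f x) * indicator A x \<partial>M))"
    if f [measurable]: "f \<in> borel_measurable M" for f
  proof -
    have sm [measurable_cong]: "sets m = sets M" by (simp add: m_def)
    define J where "J = (\<integral>\<^sup>+x. nexp (f x) \<partial>m)"
    define K where "K = (\<integral>\<^sup>+x. cexp (f x) * indicator A x \<partial>M)"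
    have sum1: "ennreal (1 / a) * K + J = 1"
    proof -
      have "ennreal (1 / a) * K + J = (\<integral>\<^sup>+x. cexp (f x) \<partial>m) + (\<integral>\<^sup>+x. nexp (f x) \<partial>m)"
        unfolding K_def J_def by (subst int[of "\<lambda>x. cexp (f x)"]) auto
      also have "\<dots> = (\<integral>\<^sup>+x. cexp (f x) + nexp (f x) \<partial>m)"
        by (rule nn_integral_add[symmetric]) measurable
      also have "\<dots> = 1" by (simp add: cexp_nexp m.emeasure_space_1)
      finally show ?thesis .
    qed
    have "J \<le> 1" using sum1 by (metis add.commute le_iff_add)
    then obtain y where y: "0 \<le> y" "J = ennreal y" by (cases J) (auto simp: top_unique)
    have "K \<noteq> top" using sum1 a(1) by (auto simp: ennreal_mult_top)
    then obtain k where k: "0 \<le> k" "K = ennreal k" by (cases K) auto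
    have "k / a + y = 1" using sum1 a(1) y k by (simp flip: ennreal_mult ennreal_plus)
    then have "k = a * (1 - y)" using a(1) by (simp add: field_simps)
    then have "t * a * (y - 1) = - (t * k)" by algebra
    then have e: "exp (t * a * (y - 1)) = exp (- (t * k))" by (rule arg_cong)
    have "(\<integral>\<^sup>+k. J ^ k \<partial>measure_pmf (poisson_pmf (t * a))) = ennreal (exp (t * a * (y - 1)))"
      using poisson_pgf[of "t * a" y] t a y by (simp add: ennreal_power)
    also have "\<dots> = nexp (ennreal t * K)"
      unfolding e using k t by (simp add: nexp_ennreal flip: ennreal_mult)
    finally show ?thesis unfolding J_def K_def .
  qed
  then show ?thesis using pm by (intro exI[of _ "poisson_pmf (t * a)"] exI[of _ m]) (auto simp: m_def)
qed

text \<open>Independent clouds of points over a countable disjoint cover by sets of finite measure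
  are added up; the exponents of the pieces sum to the full one.\<close>

lemma laplace_law_exists:
  assumes M: "sigma_finite_measure M" and ne: "space M \<noteq> {}" and t: "0 < t"
  shows "\<exists>P. laplace_law M t P"
proof -
  obtain A :: "nat \<Rightarrow> 'a set" where A: "range A \<subseteq> sets M" "(\<Union>i. A i) = space M" "\<And>i. emeasure M (A i) \<noteq> \<infinity>" "disjoint_family A"
    by (rule sigma_finite_measure.sigma_finite_disjoint[OF M]) blast
  have [measurable]: "A i \<in> sets M" for i using A by auto
  have "\<forall>i. \<exists>(N :: nat pmf) m. prob_space m \<and> sets m = sets M \<and>
     (\<forall>f\<in>borel_measurable M. (\<integral>\<^sup>+k. (\<integral>\<^sup>+x. nexp (f x) \<partial>m) ^ k \<partial>measure_pmf N) =
        nexp (ennreal t * (\<integral>\<^sup>+x. cexp (f x) * indicator (A i) x \<partial>M)))"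
    using A(3) by (intro allI finite_piece ne t) (auto simp: less_top)
  then obtain N :: "nat \<Rightarrow> nat pmf" and m where m: "\<And>i. prob_space (m i)" "\<And>i. sets (m i) = sets M"
     "\<And>i f. f \<in> borel_measurable M \<Longrightarrow> (\<integral>\<^sup>+k. (\<integral>\<^sup>+x. nexp (f x) \<partial>m i) ^ k \<partial>measure_pmf (N i)) =
        nexp (ennreal t * (\<integral>\<^sup>+x. cexp (f x) * indicator (A i) x \<partial>M))"
    by metis
  note [measurable_cong] = m(2)
  have spm: "space (m i) = space M" for i by (rule sets_eq_imp_space_eq[OF m(2)])
  interpret m: prob_space "m i" for i by (rule m(1))
  \<comment> \<open>Every piece carries an infinite i.i.d. sequence, of which only as many entries
    as the random count are used; thus the sample space does not depend on the count.\<close>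
  define W where "W i = PiM (UNIV :: nat set) (\<lambda>_. m i)" for i
  interpret mp: product_prob_space "\<lambda>_. m i" "UNIV :: nat set" for i ..
  interpret W: prob_space "W i" for i unfolding W_def by (rule mp.P.prob_space_axioms)
  define Z where "Z i = measure_pmf (N i) \<Otimes>\<^sub>M W i" for i
  interpret ZZ: pair_prob_space "measure_pmf (N i)" "W i" for i ..
  have pZ: "prob_space (Z i)" for i unfolding Z_def by (rule ZZ.prob_space_axioms)
  interpret Z: prob_space "Z i" for i by (rule pZ)
  define \<Omega> where "\<Omega> = PiM (UNIV :: nat set) Z"
  interpret Zp: product_prob_space Z "UNIV :: nat set" ..
  interpret \<Omega>: prob_space \<Omega> unfolding \<Omega>_def by (rule Zp.P.prob_space_axioms)
  have mN: "(\<lambda>z. fst z) \<in> measurable (Z i) (count_space UNIV)" for i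
    unfolding Z_def by measurable
  have mX: "(\<lambda>z. snd z j) \<in> measurable (Z i) M" for i j
    unfolding Z_def W_def by measurable
  have mc: "(\<lambda>w. w i) \<in> measurable \<Omega> (Z i)" for i unfolding \<Omega>_def by measurable
  have mN' [measurable]: "(\<lambda>w. fst (w i)) \<in> measurable \<Omega> (count_space UNIV)" for i
    using measurable_compose[OF mc mN] .
  have mX' [measurable]: "(\<lambda>w. snd (w i) j) \<in> measurable \<Omega> M" for i j
    using measurable_compose[OF mc mX] .
  define J where "J w = {(i, j). j < fst (w i)}" for w :: "nat \<Rightarrow> nat \<times> (nat \<Rightarrow> 'a)"
  \<comment> \<open>The sum of the Dirac masses, encoded as an image of counting measure on the
    index set; its values are then counts by construction.\<close>
  define \<xi> where "\<xi> w = distr (count_space (J w)) M (\<lambda>(i, j). snd (w i) j)" for w :: "nat \<Rightarrow> nat \<times> (nat \<Rightarrow> 'a)"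
  have mx: "(\<lambda>(i, j). snd (w i) j) \<in> measurable (count_space (J w)) M" if w: "w \<in> space \<Omega>" for w
    using measurable_space[OF mX' w] by auto
  have int: "(\<integral>\<^sup>+x. f x \<partial>\<xi> w) = (\<Sum>i. \<Sum>j<fst (w i). f (snd (w i) j))"
    if w: "w \<in> space \<Omega>" and f: "f \<in> borel_measurable M" for w and f :: "'a \<Rightarrow> ennreal"
  proof -
    have "(\<integral>\<^sup>+x. f x \<partial>\<xi> w) = (\<integral>\<^sup>+z. f (snd (w (fst z)) (snd z)) \<partial>count_space (J w))"
      unfolding \<xi>_def using f by (subst nn_integral_distr[OF mx[OF w]]) (simp_all add: case_prod_beta)
    also have "\<dots> = (\<integral>\<^sup>+z. f (snd (w (fst z)) (snd z)) * indicator (J w) z \<partial>count_space UNIV)"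
      by (rule nn_integral_count_space_indicator) simp
    also have "\<dots> = (\<Sum>i. \<Sum>j. f (snd (w i) j) * indicator (J w) (i, j))"
      by (subst nn_integral_fst_count_space[symmetric]) (simp add: nn_integral_count_space_nat)
    also have "\<dots> = (\<Sum>i. \<Sum>j<fst (w i). f (snd (w i) j))"
    proof (rule suminf_cong)
      fix i
      have "(\<Sum>j. f (snd (w i) j) * indicator (J w) (i, j)) = (\<Sum>j<fst (w i). f (snd (w i) j) * indicator (J w) (i, j))"
        by (rule suminf_finite) (auto simp: J_def)
      then show "(\<Sum>j. f (snd (w i) j) * indicator (J w) (i, j)) = (\<Sum>j<fst (w i). f (snd (w i) j))"
        by (simp add: J_def)
    qed
    finally show ?thesis .
  qed
  have m\<xi> [measurable]: "\<xi> \<in> measurable \<Omega> (configuration_space M)"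
  proof (rule measurable_configuration_spaceI)
    fix w assume w: "w \<in> space \<Omega>"
    show "\<xi> w \<in> counting_measures M"
    proof (rule counting_measuresI)
      fix B assume "B \<in> sets M"
      then show "emeasure (\<xi> w) B = \<infinity> \<or> (\<exists>k::nat. emeasure (\<xi> w) B = of_nat k)"
        unfolding \<xi>_def
        by (subst (1 2) emeasure_distr[OF mx[OF w]]) (auto simp: emeasure_count_space)
    qed (simp add: \<xi>_def)
  next
    fix B assume B [measurable]: "B \<in> sets M"
    \<comment> \<open>The upper limit of the finite sum is random; as a series with a condition it
      has a fixed range, and measurability is immediate.\<close>
    have s: "(\<Sum>j<k. h j) = (\<Sum>j. if j < k then h j else 0)" for k and h :: "nat \<Rightarrow> ennreal"
      by (subst suminf_finite[where N="{..<k}"]) auto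
    have "(\<lambda>w. \<Sum>i. \<Sum>j<fst (w i). indicator B (snd (w i) j) :: ennreal) \<in> borel_measurable \<Omega>"
      unfolding s by measurable
    then show "(\<lambda>w. emeasure (\<xi> w) B) \<in> borel_measurable \<Omega>"
    proof (rule measurable_cong[THEN iffD1, rotated])
      fix w assume w: "w \<in> space \<Omega>"
      show "(\<Sum>i. \<Sum>j<fst (w i). indicator B (snd (w i) j)) = emeasure (\<xi> w) B"
        using int[OF w, of "indicator B"] B by (simp add: \<xi>_def)
    qed
  qed
  have "laplace_law M t (distr \<Omega> (configuration_space M) \<xi>)"
    unfolding laplace_law_def
  proof (intro conjI ballI)
    show "prob_space (distr \<Omega> (configuration_space M) \<xi>)" by (rule \<Omega>.prob_space_distr) (rule m\<xi>)
    fix f :: "'a \<Rightarrow> ennreal" assume f [measurable]: "f \<in> borel_measurable M"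
    define G where "G i z = (\<Prod>j<fst z. nexp (f (snd z j)))" for i :: nat and z :: "nat \<times> (nat \<Rightarrow> 'a)"
    have mG: "G i \<in> borel_measurable (Z i)" for i
      unfolding G_def[abs_def]
    proof (rule measurable_compose_countable[of "\<lambda>k z. \<Prod>j<k. nexp (f (snd z j))", OF _ mN])
      fix k
      have "(\<lambda>z. nexp (f (snd z j))) \<in> borel_measurable (Z i)" for j
        using measurable_compose[OF mX, of "\<lambda>x. nexp (f x)"] by simp
      then show "(\<lambda>z. \<Prod>j<k. nexp (f (snd z j))) \<in> borel_measurable (Z i)"
        by (intro borel_measurable_prod_ennreal)
    qed
    define c where "c i = ennreal t * (\<integral>\<^sup>+x. cexp (f x) * indicator (A i) x \<partial>M)" for i
    have EG: "(\<integral>\<^sup>+z. G i z \<partial>Z i) = nexp (c i)" for i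
    proof -
      have "(\<integral>\<^sup>+z. G i z \<partial>Z i) = (\<integral>\<^sup>+k. \<integral>\<^sup>+x. G i (k, x) \<partial>W i \<partial>measure_pmf (N i))"
        using mG[of i] unfolding Z_def by (rule W.nn_integral_fst[symmetric])
      also have "\<dots> = (\<integral>\<^sup>+k. (\<integral>\<^sup>+x. nexp (f x) \<partial>m i) ^ k \<partial>measure_pmf (N i))"
        unfolding G_def W_def fst_conv snd_conv
        by (subst nn_integral_PiM_prefix[where N="\<lambda>_. m i" and g="\<lambda>_ x. nexp (f x)"]) (auto simp: m(1))
      finally show ?thesis using m(3)[OF f, of i] by (simp add: c_def)
    qed
    \<comment> \<open>The partial products are the Laplace functionals of the first n pieces and are
      at most 1, so dominated convergence reaches the full configuration.\<close>
    have lapG: "(\<Prod>i<n. G i (w i)) = nexp (\<Sum>i<n. \<Sum>j<fst (w i). f (snd (w i) j))" for w n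
      by (simp add: G_def nexp_sum)
    have "(\<lambda>n. \<integral>\<^sup>+w. (\<Prod>i<n. G i (w i)) \<partial>\<Omega>) \<longlonglongrightarrow> (\<integral>\<^sup>+w. lap f (\<xi> w) \<partial>\<Omega>)"
    proof (rule nn_integral_dominated_convergence[where w="\<lambda>_. 1"])
      show "(\<lambda>w. \<Prod>i<n. G i (w i)) \<in> borel_measurable \<Omega>" for n
        by (intro borel_measurable_prod_ennreal measurable_compose[OF mc mG])
      show "AE w in \<Omega>. (\<Prod>i<n. G i (w i)) \<le> 1" for n by (simp add: lapG nexp_le_1)
      show "AE w in \<Omega>. (\<lambda>n. \<Prod>i<n. G i (w i)) \<longlonglongrightarrow> lap f (\<xi> w)"
        unfolding lapG lap_def using int[OF _ f]
        by (intro AE_I2 tendsto_nexp) (simp add: summable_LIMSEQ)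
    qed (auto simp: \<Omega>.emeasure_space_1)
    moreover have "(\<integral>\<^sup>+w. (\<Prod>i<n. G i (w i)) \<partial>\<Omega>) = nexp (\<Sum>i<n. c i)" for n
      unfolding \<Omega>_def by (subst nn_integral_PiM_prefix[OF pZ mG]) (simp add: EG nexp_sum)
    moreover have "(\<lambda>n. nexp (\<Sum>i<n. c i)) \<longlonglongrightarrow> nexp (\<Sum>i. c i)"
      by (intro tendsto_nexp summable_LIMSEQ) auto
    ultimately have "(\<integral>\<^sup>+w. lap f (\<xi> w) \<partial>\<Omega>) = nexp (\<Sum>i. c i)"
      using LIMSEQ_unique by simp
    also have "(\<Sum>i. c i) = ennreal t * (\<Sum>i. \<integral>\<^sup>+x. cexp (f x) * indicator (A i) x \<partial>M)"
      unfolding c_def by (rule ennreal_suminf_cmult)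
    also have "(\<Sum>i. \<integral>\<^sup>+x. cexp (f x) * indicator (A i) x \<partial>M) = (\<integral>\<^sup>+x. (\<Sum>i. cexp (f x) * indicator (A i) x) \<partial>M)"
      by (rule nn_integral_suminf[symmetric]) measurable
    also have "\<dots> = (\<integral>\<^sup>+x. cexp (f x) \<partial>M)"
    proof (rule nn_integral_cong)
      fix x assume "x \<in> space M"
      then obtain i where "x \<in> A i" using A(2) by auto
      then show "(\<Sum>i. cexp (f x) * indicator (A i) x) = cexp (f x)"
        using suminf_cmult_indicator[OF A(4), of x i "\<lambda>_. cexp (f x)"] by simp
    qed
    finally show "(\<integral>\<^sup>+\<omega>. lap f \<omega> \<partial>distr \<Omega> (configuration_space M) \<xi>) = nexp (ennreal t * (\<integral>\<^sup>+x. cexp (f x) \<partial>M))"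
      by (subst nn_integral_distr) auto
  qed simp
  then show ?thesis by blast
qed

section \<open>Recurrence criteria\<close>

lemma AE_distr_density:
  assumes S: "S \<in> measurable N N" and eq: "distr N N S = density N d" and [measurable]: "d \<in> borel_measurable N"
    and Q: "AE y in N. Q y"
  shows "AE x in N. Q (S x)"
proof (rule AE_distrD[OF S])
  show "AE x in distr N N S. Q x"
    unfolding eq using Q by (subst AE_density) auto
qed

lemma AE_funpow:
  assumes step: "\<And>Q. (AE y in N. Q y) \<Longrightarrow> (AE x in N. Q (S x))" and "AE y in N. Q y"
  shows "AE x in N. Q ((S ^^ n) x)"
  using assms(2)
proof (induction n arbitrary: Q)
  case (Suc n)
  from step[OF Suc.IH[OF Suc.prems]] show ?case by (simp only: funpow_Suc_right comp_def)
qed simp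

text \<open>If \<open>B\<close> never returned, its preimages \<open>E n\<close> would be disjoint
  up to null sets and their masses would sum to at most 1. But the mass of \<open>E n\<close> is the
  integral of \<open>D n\<close> over \<open>B\<close>, and these integrals sum to
  \<infinity>.\<close>

lemma conservativeI:
  assumes N: "prob_space N" and S: "S \<in> measurable N N"
    and D [measurable]: "\<And>n. D n \<in> borel_measurable N"
    and distr: "\<And>n. distr N N (S ^^ n) = density N (D n)"
    and inf: "AE x in N. (\<Sum>n. D n x) = \<infinity>"
  shows "conservative N S"
  unfolding conservative_def
proof (intro ballI impI, rule ccontr)
  interpret prob_space N by fact
  note [measurable] = measurable_compose_n[OF S]
  fix B assume B [measurable]: "B \<in> sets N" and pos: "0 < emeasure N B"
    and contr: "\<not> (\<exists>n>0. 0 < emeasure N ((S ^^ n) -` B \<inter> B))"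
  have Bsp: "B \<subseteq> space N" using sets.sets_into_space[OF B] .
  define E where "E n = (S ^^ n) -` B \<inter> space N" for n
  have E [measurable]: "E n \<in> sets N" for n unfolding E_def by measurable
  have disj0: "AE x in N. x \<in> B \<longrightarrow> (S ^^ n) x \<notin> B" if n: "n > 0" for n
  proof -
    have eq: "(S ^^ n) -` B \<inter> B = E n \<inter> B" using Bsp by (auto simp: E_def)
    have "\<not> 0 < emeasure N ((S ^^ n) -` B \<inter> B)" using contr n by blast
    then have "E n \<inter> B \<in> null_sets N" unfolding eq by (intro null_setsI) (simp_all add: zero_less_iff_neq_zero)
    then have "AE x in N. x \<notin> E n \<inter> B" by (rule AE_not_in)
    with AE_space show ?thesis by eventually_elim (auto simp: E_def)
  qed
  \<comment> \<open>Nonsingularity moves the statement about time n - m from x to the point (S ^^ m)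
    x.\<close>
  have disj: "AE x in N. x \<in> E m \<longrightarrow> x \<notin> E n" if "m < n" for m n
  proof -
    have "AE x in N. (S ^^ m) x \<in> B \<longrightarrow> (S ^^ (n - m)) ((S ^^ m) x) \<notin> B"
      using that by (intro AE_distr_density[OF measurable_compose_n[OF S] distr D] disj0) simp
    then show ?thesis
    proof eventually_elim
      case (elim x)
      have "(S ^^ n) x = (S ^^ (n - m)) ((S ^^ m) x)"
        using that by (simp flip: comp_apply[of "S ^^ (n - m)" "S ^^ m"] funpow_add)
      then show ?case using elim by (auto simp: E_def)
    qed
  qed
  have "AE x in N. \<forall>m n. m < n \<longrightarrow> x \<in> E m \<longrightarrow> x \<notin> E n"
    using disj by (simp add: AE_all_countable)
  then have le1: "AE x in N. (\<Sum>n. indicator (E n) x) \<le> (1 :: ennreal)"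
  proof eventually_elim
    case (elim x)
    show ?case
    proof (cases "\<exists>n. x \<in> E n")
      case True
      then obtain n where n: "x \<in> E n" by blast
      have "(\<Sum>n. indicator (E n) x) = (\<Sum>n\<in>{n}. indicator (E n) x :: ennreal)"
        using elim n by (intro suminf_finite) (auto, metis indicator_simps(2) linorder_neqE_nat)
      then show ?thesis using n by simp
    qed simp
  qed
  have "(\<integral>\<^sup>+x. (\<Sum>n. D n x) * indicator B x \<partial>N) = (\<Sum>n. \<integral>\<^sup>+x. D n x * indicator B x \<partial>N)"
    by (subst nn_integral_suminf[symmetric]) (auto intro!: nn_integral_cong simp: ennreal_suminf_multc)
  also have "\<dots> = (\<Sum>n. \<integral>\<^sup>+x. indicator (E n) x \<partial>N)"
  proof (rule suminf_cong)
    fix n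
    have "(\<integral>\<^sup>+x. D n x * indicator B x \<partial>N) = emeasure (density N (D n)) B"
      by (subst emeasure_density) auto
    also have "\<dots> = emeasure N (E n)"
      unfolding distr[symmetric] E_def by (rule emeasure_distr) measurable
    finally show "(\<integral>\<^sup>+x. D n x * indicator B x \<partial>N) = (\<integral>\<^sup>+x. indicator (E n) x \<partial>N)" by simp
  qed
  also have "\<dots> = (\<integral>\<^sup>+x. (\<Sum>n. indicator (E n) x) \<partial>N)"
    by (rule nn_integral_suminf[symmetric]) measurable
  also have "\<dots> \<le> (\<integral>\<^sup>+x. 1 \<partial>N)" by (rule nn_integral_mono_AE[OF le1])
  finally have "(\<integral>\<^sup>+x. (\<Sum>n. D n x) * indicator B x \<partial>N) \<le> 1" by (simp add: emeasure_space_1)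
  moreover have "(\<integral>\<^sup>+x. (\<Sum>n. D n x) * indicator B x \<partial>N) = (\<integral>\<^sup>+x. \<infinity> * indicator B x \<partial>N)"
    using inf by (intro nn_integral_cong_AE) auto
  moreover have "(\<integral>\<^sup>+x. \<infinity> * indicator B x \<partial>N) = \<infinity>"
    using pos by (subst nn_integral_cmult_indicator) (auto simp: ennreal_top_mult)
  ultimately show False by (simp add: top_unique)
qed

section \<open>Two-sided orbits and wandering sets\<close>

definition orbit :: "('a \<Rightarrow> 'a) \<Rightarrow> ('a \<Rightarrow> 'a) \<Rightarrow> int \<Rightarrow> 'a \<Rightarrow> 'a" where
  "orbit S R k x = (if 0 \<le> k then (S ^^ nat k) x else (R ^^ nat (- k)) x)"

text \<open>\<open>R\<close> is only an almost everywhere inverse, so the group law is claimed for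
  points along whose forward and backward orbits the two maps cancel. Almost every point turns out
  to be of this kind.\<close>

lemma orbit_simps:
  assumes RS: "\<And>n. R (S ((S ^^ n) x)) = (S ^^ n) x" and SR: "\<And>n. S (R ((R ^^ n) x)) = (R ^^ n) x"
  shows "S (orbit S R k x) = orbit S R (k + 1) x" "R (orbit S R k x) = orbit S R (k - 1) x"
proof -
  show "S (orbit S R k x) = orbit S R (k + 1) x"
  proof (cases "0 \<le> k")
    case True
    then show ?thesis by (simp add: orbit_def nat_add_distrib)
  next
    case False
    then obtain n where n: "k = - int (Suc n)" by (metis negD not_le)
    have "nat (int n + 1) = Suc n" by simp
    then show ?thesis unfolding n using SR[of n] by (auto simp: orbit_def)
  qed
  show "R (orbit S R k x) = orbit S R (k - 1) x"
  proof (cases "0 < k")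
    case True
    then obtain n where n: "k = int (Suc n)" by (metis gr0_implies_Suc zero_less_imp_eq_int)
    have "nat (1 + int n) = Suc n" by simp
    then show ?thesis unfolding n using RS[of n] by (simp add: orbit_def)
  next
    case False
    then have "nat (- (k - 1)) = Suc (nat (- k))" by simp
    then show ?thesis using False by (auto simp: orbit_def)
  qed
qed

lemma orbit_add:
  assumes RS: "\<And>n. R (S ((S ^^ n) x)) = (S ^^ n) x" and SR: "\<And>n. S (R ((R ^^ n) x)) = (R ^^ n) x"
  shows "orbit S R j (orbit S R k x) = orbit S R (k + j) x"
proof -
  note simps = orbit_simps[of R S x, OF RS SR]
  have S: "(S ^^ n) (orbit S R k x) = orbit S R (k + int n) x" for n
    by (induction n) (simp_all add: simps algebra_simps)
  have R: "(R ^^ n) (orbit S R k x) = orbit S R (k - int n) x" for n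
    by (induction n) (simp_all add: simps algebra_simps)
  show ?thesis
    by (subst (1) orbit_def) (simp add: S R)
qed

lemma inverse_one_add_ennreal:
  fixes s :: ennreal
  shows "inverse (1 + s) \<le> 1" "s * inverse (1 + s) \<le> 1"
proof -
  have "inverse (1 + s) \<le> 1 \<and> s * inverse (1 + s) \<le> 1"
  proof (cases s)
    case (real r)
    then have "inverse (1 + s) = ennreal (inverse (1 + r))"
      by (simp add: inverse_ennreal flip: ennreal_1 ennreal_plus)
    moreover have "inverse (1 + r) \<le> 1" "r * inverse (1 + r) \<le> 1"
      using real by (auto simp: field_simps)
    ultimately show ?thesis using real by (simp flip: ennreal_mult)
  qed simp
  then show "inverse (1 + s) \<le> 1" "s * inverse (1 + s) \<le> 1" by auto
qed

lemma ennreal_suminf_tendsto_zero: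
  fixes f :: "nat \<Rightarrow> ennreal"
  assumes "(\<Sum>n. f n) < \<infinity>"
  shows "f \<longlonglongrightarrow> 0"
proof -
  have ne: "f n \<noteq> top" for n
    using assms sum_le_suminf[of f "{n}"] by (auto simp: top_unique)
  then have f: "f n = ennreal (enn2real (f n))" for n by (simp add: less_top)
  have "(\<Sum>n. ennreal (enn2real (f n))) \<noteq> top" using assms f by simp
  then have "summable (\<lambda>n. enn2real (f n))" by (intro summable_suminf_not_top) auto
  then have "(\<lambda>n. enn2real (f n)) \<longlonglongrightarrow> 0" by (rule summable_LIMSEQ_zero)
  then have "(\<lambda>n. ennreal (enn2real (f n))) \<longlonglongrightarrow> ennreal 0" by (rule tendsto_ennrealI)
  then show ?thesis using f by simp
qed

text \<open>
  The function \<open>h = 1 / (1 + \<Sum>n. D n)\<close> is positive and summable along forward orbits, so the points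
  of an orbit at which \<open>h\<close> exceeds half of its supremum over the orbit have a last one.
  The wandering set picks that point.
\<close>

lemma totally_dissipativeI:
  assumes N: "prob_space N" and S: "S \<in> measurable N N" and R: "ae_inverse N S R"
    and D [measurable]: "\<And>n. D n \<in> borel_measurable N"
    and distr: "\<And>n. distr N N (S ^^ n) = density N (D n)"
    and pos: "AE x in N. 0 < D 1 x"
    and fin: "AE x in N. (\<Sum>n. D n x) < \<infinity>"
  shows "totally_dissipative N S"
proof -
  interpret prob_space N by fact
  have Rm: "R \<in> measurable N N" and RS: "AE x in N. R (S x) = x" and SR: "AE x in N. S (R x) = x"
    using R by (auto simp: ae_inverse_def)
  note [measurable] = S Rm measurable_compose_n[OF S] measurable_compose_n[OF Rm]
  have distr1: "distr N N S = density N (D 1)" using distr[of 1] by simp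
  have stepS: "AE x in N. Q (S x)" if "AE y in N. Q y" for Q
    using AE_distr_density[OF S distr1 D that] .
  \<comment> \<open>\<open>R\<close> respects null sets too: R (S x) = x avoids \<open>Z\<close>
    almost everywhere, so \<open>R\<close> avoids \<open>Z\<close> under the image law of
    \<open>S\<close>, and positivity of its density \<open>D 1\<close> transfers this to
    \<open>N\<close>.\<close>
  have stepR: "AE x in N. Q (R x)" if Q: "AE y in N. Q y" for Q
  proof -
    obtain Z where Z [measurable]: "Z \<in> sets N" "emeasure N Z = 0" "{x\<in>space N. \<not> Q x} \<subseteq> Z"
      using Q by (auto elim: AE_E)
    have "AE x in N. x \<notin> Z" using Z by (intro AE_not_in null_setsI)
    with RS have "AE x in N. R (S x) \<notin> Z" by eventually_elim simp
    then have "AE x in distr N N S. R x \<notin> Z" by (subst AE_distr_iff) auto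
    then have "AE x in N. 0 < D 1 x \<longrightarrow> R x \<notin> Z" unfolding distr1 by (subst (asm) AE_density) auto
    with pos AE_space show ?thesis
    proof eventually_elim
      case (elim x)
      then have "R x \<in> space N" using measurable_space[OF Rm] by auto
      then show ?case using elim Z(3) by auto
    qed
  qed
  \<comment> \<open>Pushing \<open>N\<close> forward by S ^^ n produces the density
    \<open>D n\<close>, so the sum of h along forward orbits has the integral of h * \<Sum>n. D n,
    which this choice keeps at most 1.\<close>
  define h where "h x = inverse (1 + (\<Sum>n. D n x))" for x
  have [measurable]: "h \<in> borel_measurable N" unfolding h_def by measurable
  have h1: "h x \<le> 1" for x by (simp add: h_def inverse_one_add_ennreal)
  have hpos: "AE x in N. 0 < h x"
    using fin by eventually_elim (auto simp: h_def ennreal_inverse_positive less_top)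
  have "(\<integral>\<^sup>+x. (\<Sum>n. h ((S ^^ n) x)) \<partial>N) = (\<Sum>n. \<integral>\<^sup>+x. h ((S ^^ n) x) \<partial>N)"
    by (rule nn_integral_suminf) measurable
  also have "\<dots> = (\<Sum>n. \<integral>\<^sup>+x. D n x * h x \<partial>N)"
  proof (rule suminf_cong)
    fix n
    have "(\<integral>\<^sup>+x. h ((S ^^ n) x) \<partial>N) = (\<integral>\<^sup>+x. h x \<partial>distr N N (S ^^ n))"
      by (subst nn_integral_distr) auto
    also have "\<dots> = (\<integral>\<^sup>+x. D n x * h x \<partial>N)"
      unfolding distr by (subst nn_integral_density) auto
    finally show "(\<integral>\<^sup>+x. h ((S ^^ n) x) \<partial>N) = (\<integral>\<^sup>+x. D n x * h x \<partial>N)" .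
  qed
  also have "\<dots> = (\<integral>\<^sup>+x. (\<Sum>n. D n x * h x) \<partial>N)"
    by (rule nn_integral_suminf[symmetric]) measurable
  also have "\<dots> \<le> (\<integral>\<^sup>+x. 1 \<partial>N)"
    unfolding ennreal_suminf_multc h_def by (intro nn_integral_mono inverse_one_add_ennreal)
  finally have "(\<integral>\<^sup>+x. (\<Sum>n. h ((S ^^ n) x)) \<partial>N) \<noteq> \<infinity>" by (auto simp: emeasure_space_1 top_unique)
  then have sumh: "AE x in N. (\<Sum>n. h ((S ^^ n) x)) \<noteq> \<infinity>"
    by (intro nn_integral_PInf_AE) auto
  have RSn: "AE x in N. \<forall>n. R (S ((S ^^ n) x)) = (S ^^ n) x"
    unfolding AE_all_countable 
    by (intro allI AE_funpow[where S=S and Q="\<lambda>x. R (S x) = x"] RS) (rule stepS)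
  have SRn: "AE x in N. \<forall>n. S (R ((R ^^ n) x)) = (R ^^ n) x"
    unfolding AE_all_countable 
    by (intro allI AE_funpow[where S=R and Q="\<lambda>x. S (R x) = x"] SR) (rule stepR)
  let ?o = "orbit S R"
  have om [measurable]: "?o k \<in> measurable N N" for k
    unfolding orbit_def by (cases "0 \<le> k") auto
  \<comment> \<open>The supremum runs over the two-sided orbit, which makes it invariant; forward
    summability then suffices because only a last index above half of it is sought, not a first
    one.\<close>
  define H where "H x = (SUP k. h (?o k x))" for x
  have [measurable]: "H \<in> borel_measurable N" unfolding H_def by measurable
  define B where "B = {x\<in>space N. H x < 2 * h x \<and> (\<forall>n>0. 2 * h ((S ^^ n) x) \<le> H x)}"
  have B [measurable]: "B \<in> sets N" unfolding B_def by measurable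
  define good where "good x \<longleftrightarrow> x \<in> space N \<and> 0 < h x \<and> (\<Sum>n. h ((S ^^ n) x)) \<noteq> \<infinity> \<and>
    (\<forall>n. R (S ((S ^^ n) x)) = (S ^^ n) x) \<and> (\<forall>n. S (R ((R ^^ n) x)) = (R ^^ n) x)" for x
  have good: "AE x in N. good x"
    using AE_space hpos sumh RSn SRn by eventually_elim (simp add: good_def)
  have add: "?o j (?o k x) = ?o (k + j) x" if "good x" for j k x
    using that by (intro orbit_add) (auto simp: good_def)
  have Hinv: "H (?o k x) = H x" if x: "good x" for k x
  proof (rule antisym)
    show "H (?o k x) \<le> H x" unfolding H_def add[OF x] by (intro SUP_least SUP_upper) auto
    show "H x \<le> H (?o k x)" unfolding H_def add[OF x]
    proof (rule SUP_least)
      fix j show "h (?o j x) \<le> (SUP i. h (?o (k + i) x))"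
        by (rule SUP_upper2[of "j - k"]) auto
    qed
  qed
  have Bo: "?o k x \<in> B \<longleftrightarrow> H x < 2 * h (?o k x) \<and> (\<forall>j>k. 2 * h (?o j x) \<le> H x)" if x: "good x" for k x
  proof -
    have "(\<forall>n>0. 2 * h ((S ^^ n) (?o k x)) \<le> H x) \<longleftrightarrow> (\<forall>j>k. 2 * h (?o j x) \<le> H x)"
    proof (intro iffI allI impI)
      fix j assume j: "j > k" and *: "\<forall>n>0. 2 * h ((S ^^ n) (?o k x)) \<le> H x"
      have "?o j x = (S ^^ nat (j - k)) (?o k x)" using add[OF x, of "j - k" k] j by (simp add: orbit_def[of S R "j - k"])
      then show "2 * h (?o j x) \<le> H x" using * j by simp
    next
      fix n :: nat assume n: "n > 0" and *: "\<forall>j>k. 2 * h (?o j x) \<le> H x"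
      have "(S ^^ n) (?o k x) = ?o (k + int n) x" using add[OF x, of "int n" k] by (simp add: orbit_def[of S R "int n"])
      then show "2 * h ((S ^^ n) (?o k x)) \<le> H x" using * n by simp
    qed
    moreover have "?o k x \<in> space N" using measurable_space[OF om] x by (auto simp: good_def)
    ultimately show ?thesis by (simp add: B_def Hinv[OF x])
  qed
  \<comment> \<open>Lying in the m-th image of \<open>B\<close> is a condition on the orbit point
    with index - m, which reverses the order of indices below.\<close>
  have img: "int_image N S R m B = {x\<in>space N. ?o (- m) x \<in> B}" for m
    using sets.sets_into_space[OF B] by (cases "m = 0") (auto simp: int_image_def orbit_def)
  have "AE x in N. x \<notin> int_image N S R m B \<inter> int_image N S R n B" if mn: "m < n" for m n
    using good
  proof eventually_elim
    case (elim x)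
    show ?case
    proof
      assume "x \<in> int_image N S R m B \<inter> int_image N S R n B"
      then have "H x < 2 * h (?o (- m) x)" "\<forall>j>- n. 2 * h (?o j x) \<le> H x"
        using Bo[OF elim] by (auto simp: img)
      then show False using mn by (metis leD neg_less_iff_less)
    qed
  qed
  then have disj: "AE x in N. x \<notin> int_image N S R m B \<inter> int_image N S R n B" if "m \<noteq> n" for m n
    using that by (metis inf_commute linorder_neqE)
  have cover: "AE x in N. x \<notin> space N - (\<Union>n. int_image N S R n B)"
    using good
  proof eventually_elim
    case x: (elim x)
    have "h x \<le> H x" unfolding H_def by (rule SUP_upper2[of 0]) (auto simp: orbit_def)
    then have H0: "0 < H x" using x by (auto simp: good_def)
    \<comment> \<open>The supremum must be finite as well as positive: only then is its half
      strictly smaller and exceeded at some \<open>k0\<close>.\<close>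
    have H1: "H x \<le> 1" unfolding H_def by (intro SUP_least h1)
    then obtain r where r: "0 < r" "H x = ennreal r" using H0 by (cases "H x") (auto simp: top_unique)
    have "ennreal (r / 2) < H x" using r by (simp add: ennreal_less_iff)
    then obtain k0 where k0: "ennreal (r / 2) < h (?o k0 x)" unfolding H_def by (auto simp: less_SUP_iff)
    have half: "ennreal (r / 2) < y \<longleftrightarrow> H x < 2 * y" for y
      using r by (cases y) (auto simp: ennreal_less_iff ennreal_mult_top ennreal_mult[symmetric] simp flip: ennreal_numeral)
    have "(\<lambda>n. h ((S ^^ n) x)) \<longlonglongrightarrow> 0"
      using x by (intro ennreal_suminf_tendsto_zero) (auto simp: good_def less_top)
    then have "eventually (\<lambda>n. h ((S ^^ n) x) < ennreal (r / 2)) sequentially"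
      using r by (intro order_tendstoD) auto
    then obtain n0 where n0: "\<And>n. n \<ge> n0 \<Longrightarrow> h ((S ^^ n) x) < ennreal (r / 2)"
      by (auto simp: eventually_sequentially)
    \<comment> \<open>No index beyond \<open>n0\<close> exceeds the threshold, so the last one that
      does lies in a finite window starting at \<open>k0\<close>; the \<open>max\<close> keeps
      \<open>k0\<close> inside.\<close>
    define K where "K = {k\<in>{k0..max k0 (int n0)}. ennreal (r / 2) < h (?o k x)}"
    have K: "finite K" "k0 \<in> K"
      unfolding K_def using k0 by (auto intro: finite_subset[of _ "{k0..max k0 (int n0)}"])
    define k where "k = Max K"
    have kK: "k \<in> K" unfolding k_def using K by (intro Max_in) auto
    have "2 * h (?o j x) \<le> H x" if j: "j > k" for j
    proof -
      have "j \<notin> K" using j Max_ge[OF K(1), of j] unfolding k_def by (meson not_le)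
      moreover have "j \<ge> k0" using j Max_ge[OF K] unfolding k_def by simp
      ultimately have "\<not> ennreal (r / 2) < h (?o j x)"
      proof (cases "int n0 < j")
        case True
        then have "h (?o j x) < ennreal (r / 2)" using n0[of "nat j"] by (simp add: orbit_def)
        then show ?thesis by simp
      qed (auto simp: K_def)
      then show ?thesis unfolding half by simp
    qed
    moreover have "H x < 2 * h (?o k x)" using kK unfolding K_def half by simp
    ultimately have "?o k x \<in> B" using Bo[OF x] by simp
    then have "x \<in> int_image N S R (- k) B" using x by (simp add: img good_def)
    then show ?case by blast
  qed
  have imgs [measurable]: "int_image N S R m B \<in> sets N" for m
    unfolding img by measurable
  show ?thesis
    unfolding totally_dissipative_def
  proof (intro exI[of _ R] conjI R bexI[OF _ B] allI impI)
    show "emeasure N (int_image N S R m B \<inter> int_image N S R n B) = 0" if "m \<noteq> n" for m n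
      using disj[OF that] AE_iff_null_sets[of "int_image N S R m B \<inter> int_image N S R n B" N] by auto
    show "emeasure N (space N - (\<Union>n. int_image N S R n B)) = 0"
      using cover AE_iff_null_sets[of "space N - (\<Union>n. int_image N S R n B)" N] by auto
  qed
qed

section \<open>The cocycle of a transformation with bounded derivatives\<close>

lemma Aut_AE:
  assumes T: "T \<in> Aut M" and Q: "AE y in M. Q y"
  shows "AE x in M. Q (T x)"
proof -
  have m: "T \<in> measurable M M" and null: "\<And>A. A \<in> sets M \<Longrightarrow> emeasure M A = 0 \<Longrightarrow> emeasure M (T -` A \<inter> space M) = 0"
    using T by (auto simp: Aut_def)
  obtain Z where Z: "Z \<in> sets M" "emeasure M Z = 0" "{x\<in>space M. \<not> Q x} \<subseteq> Z"
    using Q by (auto elim: AE_E)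
  have "AE x in M. x \<notin> T -` Z \<inter> space M"
    using null[OF Z(1,2)] measurable_sets[OF m Z(1)] by (intro AE_not_in null_setsI)
  with AE_space show ?thesis
  proof eventually_elim
    case (elim x)
    then show ?case using Z(3) measurable_space[OF m, of x] by auto
  qed
qed

lemma density_funpow:
  assumes T: "T \<in> Aut M" and "sigma_finite_measure M"
  shows "density M (nonsing_deriv M (T ^^ n)) = distr M M (T ^^ n)"
  unfolding nonsing_deriv_def
proof (rule sigma_finite_measure.density_RN_deriv[OF assms(2)])
  have m [measurable]: "T \<in> measurable M M" using T by (simp add: Aut_def)
  show "absolutely_continuous M (distr M M (T ^^ n))"
    unfolding absolutely_continuous_def
  proof
    fix A assume A: "A \<in> null_sets M"
    then have [measurable]: "A \<in> sets M" by auto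
    have "AE x in M. (T ^^ n) x \<notin> A"
      by (rule AE_funpow[where Q="\<lambda>x. x \<notin> A", OF _ AE_not_in[OF A]]) (rule Aut_AE[OF T])
    then have "emeasure M ((T ^^ n) -` A \<inter> space M) = 0"
      by (subst (asm) AE_iff_measurable[OF _ refl]) (auto simp: vimage_def Int_def conj_commute)
    then show "A \<in> null_sets (distr M M (T ^^ n))"
      using A by (intro null_setsI) (auto simp: emeasure_distr)
  qed
qed simp

text \<open>The chain rule for Radon-Nikodym derivatives, with R in the role of the inverse of T. It
  carries integrability of the derivative minus 1 from T to its iterates.\<close>

lemma log_derivative_cocycle:
  fixes a b c :: "'a \<Rightarrow> real"
  assumes M: "sigma_finite_measure M" and R: "ae_inverse M T R"
    and T [measurable]: "T \<in> measurable M M" and U [measurable]: "U \<in> measurable M M"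
    and [measurable]: "a \<in> borel_measurable M" "b \<in> borel_measurable M" "c \<in> borel_measurable M"
    and a: "distr M M T = density M (\<lambda>x. ennreal (exp (a x)))"
    and b: "distr M M U = density M (\<lambda>x. ennreal (exp (b x)))"
    and c: "distr M M (T \<circ> U) = density M (\<lambda>x. ennreal (exp (c x)))"
  shows "AE x in M. exp (c x) = exp (b (R x)) * exp (a x)"
proof -
  have [measurable]: "R \<in> measurable M M" and RT: "AE x in M. R (T x) = x"
    using R by (auto simp: ae_inverse_def)
  have "density M (\<lambda>x. ennreal (exp (c x))) = density M (\<lambda>x. ennreal (exp (b (R x)) * exp (a x)))"
  proof (rule measure_eqI)
    fix A assume "A \<in> sets (density M (\<lambda>x. ennreal (exp (c x))))"
    then have A [measurable]: "A \<in> sets M" by simp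
    have "emeasure (density M (\<lambda>x. ennreal (exp (c x)))) A = emeasure (distr (distr M M U) M T) A"
      by (simp only: c[symmetric] distr_distr[OF T U])
    also have "\<dots> = (\<integral>\<^sup>+x. indicator A (T x) \<partial>distr M M U)"
      using A by (subst nn_integral_indicator[symmetric]) (simp, subst nn_integral_distr, auto)
    also have "\<dots> = (\<integral>\<^sup>+x. ennreal (exp (b x)) * indicator A (T x) \<partial>M)"
      unfolding b by (subst nn_integral_density) auto
    also have "\<dots> = (\<integral>\<^sup>+x. ennreal (exp (b (R (T x)))) * indicator A (T x) \<partial>M)"
      using RT by (intro nn_integral_cong_AE) auto
    also have "\<dots> = (\<integral>\<^sup>+x. ennreal (exp (b (R x))) * indicator A x \<partial>distr M M T)"
      by (subst nn_integral_distr) auto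
    also have "\<dots> = (\<integral>\<^sup>+x. ennreal (exp (b (R x)) * exp (a x)) * indicator A x \<partial>M)"
      unfolding a by (subst nn_integral_density) (auto simp: ennreal_mult ac_simps)
    also have "\<dots> = emeasure (density M (\<lambda>x. ennreal (exp (b (R x)) * exp (a x)))) A"
      by (rule emeasure_density[symmetric]) auto
    finally show "emeasure (density M (\<lambda>x. ennreal (exp (c x)))) A = emeasure (density M (\<lambda>x. ennreal (exp (b (R x)) * exp (a x)))) A" .
  qed simp
  then have "AE x in M. ennreal (exp (c x)) = ennreal (exp (b (R x)) * exp (a x))"
    by (intro sigma_finite_measure.density_unique[OF M]) auto
  then show ?thesis by eventually_elim (simp add: ennreal_inj del: ennreal_mult)
qed

text \<open>Integrability passes from n to n + 1 because exp (l (n + 1)) - 1 equals exp (l 1) * (exp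
  (l n o R) - 1) + (exp (l 1) - 1) almost everywhere: integrating against exp (l 1) amounts to
  composing with T, which cancels R and leaves the integral for n.\<close>

lemma log_derivatives:
  fixes M :: "'a measure" and \<alpha> :: real
  assumes M: "sigma_finite_measure M" and T: "T \<in> Aut1 M" and \<alpha>: "\<alpha> > 1"
    and bd: "\<forall>n>0. AE x in M. ennreal (inverse \<alpha>) < nonsing_deriv M (T ^^ n) x \<and>
                          nonsing_deriv M (T ^^ n) x < ennreal \<alpha>"
  obtains l :: "nat \<Rightarrow> 'a \<Rightarrow> real" where "\<And>n. l n \<in> borel_measurable M" "\<And>n x. \<bar>l n x\<bar> \<le> ln \<alpha>"
    "\<And>n. integrable M (\<lambda>x. exp (l n x) - 1)"
    "\<And>n. distr M M (T ^^ n) = density M (\<lambda>x. ennreal (exp (l n x)))"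
proof -
  have TA: "T \<in> Aut M" and int1: "integrable M (\<lambda>x. enn2real (nonsing_deriv M T x) - 1)"
    using T by (auto simp: Aut1_def)
  have m [measurable]: "T \<in> measurable M M" using TA by (simp add: Aut_def)
  obtain R where R: "ae_inverse M T R" using TA by (auto simp: Aut_def)
  have [measurable]: "R \<in> measurable M M" and RT: "AE x in M. R (T x) = x"
    using R by (auto simp: ae_inverse_def)
  have [measurable]: "nonsing_deriv M U \<in> borel_measurable M" for U
    unfolding nonsing_deriv_def by measurable
  \<comment> \<open>Clamping alters the derivatives of positive index on null sets only and makes
    the bounds hold at every point.\<close>
  define cl where "cl y = max (inverse \<alpha>) (min \<alpha> y)" for y :: real
  have [measurable]: "cl \<in> borel_measurable borel" unfolding cl_def by measurable
  have cl: "inverse \<alpha> \<le> cl y" "cl y \<le> \<alpha>" "0 < cl y" for y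
  proof -
    have "inverse \<alpha> < 1" "0 < inverse \<alpha>" using \<alpha> by (auto simp: inverse_less_1_iff)
    then show "inverse \<alpha> \<le> cl y" "cl y \<le> \<alpha>" "0 < cl y" using \<alpha> by (auto simp: cl_def less_max_iff_disj)
  qed
  \<comment> \<open>Bounds are assumed for n > 0 only; the identity has derivative 1, hence
    logarithm 0.\<close>
  define l where "l n x = (if n = 0 then 0 else ln (cl (enn2real (nonsing_deriv M (T ^^ n) x))))" for n x
  have l [measurable]: "l n \<in> borel_measurable M" for n unfolding l_def by measurable
  have L: "\<bar>l n x\<bar> \<le> ln \<alpha>" for n x
  proof (cases "n = 0")
    case False
    let ?y = "cl (enn2real (nonsing_deriv M (T ^^ n) x))"
    have "ln (inverse \<alpha>) \<le> ln ?y" "ln ?y \<le> ln \<alpha>" using cl \<alpha> by (subst ln_le_cancel_iff; auto)+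
    then show ?thesis using False \<alpha> by (simp add: l_def ln_inverse)
  qed (use \<alpha> in \<open>simp add: l_def\<close>)
  have AEl: "AE x in M. ennreal (exp (l n x)) = nonsing_deriv M (T ^^ n) x" if n: "n > 0" for n
    using bd[rule_format, OF n]
  proof eventually_elim
    case (elim x)
    then have "nonsing_deriv M (T ^^ n) x \<noteq> top" by auto
    then obtain y where y: "0 \<le> y" "nonsing_deriv M (T ^^ n) x = ennreal y" by (cases "nonsing_deriv M (T ^^ n) x") auto
    then have "inverse \<alpha> < y" "y < \<alpha>" using elim \<alpha> by (auto simp: ennreal_less_iff)
    then have "cl y = y" by (simp add: cl_def)
    moreover have "0 < y" using cl(3)[of y] \<open>cl y = y\<close> by simp
    ultimately show ?case using n y by (simp add: l_def)
  qed
  have distr: "distr M M (T ^^ n) = density M (\<lambda>x. ennreal (exp (l n x)))" for n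
  proof (cases "n = 0")
    case True
    then show ?thesis using distr_id[of M] by (simp add: l_def density_1 id_def)
  next
    case False
    then show ?thesis
      unfolding density_funpow[OF TA M, symmetric] using AEl[of n] by (intro density_cong) auto
  qed
  have int: "(\<integral>\<^sup>+x. ennreal \<bar>exp (l n x) - 1\<bar> \<partial>M) < \<infinity>" for n
  proof (induction n)
    case 0
    then show ?case by (simp add: l_def)
  next
    case (Suc n)
    have one: "(\<integral>\<^sup>+x. ennreal \<bar>exp (l 1 x) - 1\<bar> \<partial>M) < \<infinity>"
    proof -
      have "(\<integral>\<^sup>+x. ennreal \<bar>exp (l 1 x) - 1\<bar> \<partial>M) = (\<integral>\<^sup>+x. ennreal \<bar>enn2real (nonsing_deriv M T x) - 1\<bar> \<partial>M)"
      proof (rule nn_integral_cong_AE, use AEl[OF zero_less_one] in eventually_elim)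
        fix x assume "ennreal (exp (l 1 x)) = nonsing_deriv M (T ^^ 1) x"
        from arg_cong[OF this, of enn2real]
        show "ennreal \<bar>exp (l 1 x) - 1\<bar> = ennreal \<bar>enn2real (nonsing_deriv M T x) - 1\<bar>" by simp
      qed
      then show ?thesis using int1 by (simp add: integrable_iff_bounded)
    qed
    have "distr M M T = density M (\<lambda>x. ennreal (exp (l 1 x)))" using distr[of 1] by simp
    note dT = this
    have "distr M M (T \<circ> T ^^ n) = density M (\<lambda>x. ennreal (exp (l (Suc n) x)))" using distr[of "Suc n"] by simp
    from log_derivative_cocycle[OF M R m measurable_compose_n[OF m] l l l dT distr this]
    have coc: "AE x in M. exp (l (Suc n) x) = exp (l n (R x)) * exp (l 1 x)" .
    have "(\<integral>\<^sup>+x. ennreal \<bar>exp (l (Suc n) x) - 1\<bar> \<partial>M)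
       \<le> (\<integral>\<^sup>+x. ennreal (exp (l 1 x)) * ennreal \<bar>exp (l n (R x)) - 1\<bar> + ennreal \<bar>exp (l 1 x) - 1\<bar> \<partial>M)"
    proof (rule nn_integral_mono_AE, use coc in eventually_elim)
      fix x assume "exp (l (Suc n) x) = exp (l n (R x)) * exp (l 1 x)"
      then have "exp (l (Suc n) x) - 1 = exp (l 1 x) * (exp (l n (R x)) - 1) + (exp (l 1 x) - 1)"
        by (simp add: algebra_simps)
      then have "\<bar>exp (l (Suc n) x) - 1\<bar> \<le> exp (l 1 x) * \<bar>exp (l n (R x)) - 1\<bar> + \<bar>exp (l 1 x) - 1\<bar>"
        using abs_triangle_ineq[of "exp (l 1 x) * (exp (l n (R x)) - 1)" "exp (l 1 x) - 1"] by (simp add: abs_mult)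
      then show "ennreal \<bar>exp (l (Suc n) x) - 1\<bar> \<le> ennreal (exp (l 1 x)) * ennreal \<bar>exp (l n (R x)) - 1\<bar> + ennreal \<bar>exp (l 1 x) - 1\<bar>"
        by (simp add: ennreal_leI flip: ennreal_mult ennreal_plus)
    qed
    also have "\<dots> = (\<integral>\<^sup>+x. ennreal (exp (l 1 x)) * ennreal \<bar>exp (l n (R x)) - 1\<bar> \<partial>M) + (\<integral>\<^sup>+x. ennreal \<bar>exp (l 1 x) - 1\<bar> \<partial>M)"
      by (rule nn_integral_add) measurable
    also have "(\<integral>\<^sup>+x. ennreal (exp (l 1 x)) * ennreal \<bar>exp (l n (R x)) - 1\<bar> \<partial>M) = (\<integral>\<^sup>+x. ennreal \<bar>exp (l n (R x)) - 1\<bar> \<partial>distr M M T)"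
      unfolding dT by (subst nn_integral_density) auto
    also have "\<dots> = (\<integral>\<^sup>+x. ennreal \<bar>exp (l n (R (T x))) - 1\<bar> \<partial>M)"
      by (subst nn_integral_distr) auto
    also have "\<dots> = (\<integral>\<^sup>+x. ennreal \<bar>exp (l n x) - 1\<bar> \<partial>M)"
      using RT by (intro nn_integral_cong_AE) auto
    finally show ?case using Suc one by (auto simp: less_top[symmetric] top_unique)
  qed
  have "integrable M (\<lambda>x. exp (l n x) - 1)" for n
    using int[of n] by (simp add: integrable_iff_bounded)
  then show thesis using that[of l] l L distr by blast
qed

section \<open>The suspension as a transformation of the configuration space\<close>

lemma suspension_funpow:
  assumes T: "T \<in> measurable M M" and w: "\<omega> \<in> counting_measures M"
  shows "(suspension M T ^^ n) \<omega> = suspension M (T ^^ n) \<omega>"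
proof (induction n)
  case 0
  show ?case using distr_id2[OF counting_measures_sets[OF w, symmetric]]
    by (simp add: suspension_def id_def)
next
  case (Suc n)
  have "T ^^ n \<in> measurable \<omega> M"
    using w measurable_compose_n[OF T] by (rule measurable_counting_measures)
  then show ?case using Suc T by (simp add: suspension_def distr_distr comp_def)
qed

text \<open>Almost every configuration has no points where the maps fail to cancel, by
  \<open>laplace_law_AE_AE\<close>; for such a configuration the image measures cancel.\<close>

lemma ae_inverse_suspension:
  assumes P: "laplace_law M t P" and R: "ae_inverse M T R" and T: "T \<in> measurable M M"
  shows "ae_inverse P (suspension M T) (suspension M R)"
proof -
  have Rm: "R \<in> measurable M M" and RT: "AE x in M. R (T x) = x" and TR: "AE x in M. T (R x) = x"
    using R by (auto simp: ae_inverse_def)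
  note [measurable_cong] = laplace_lawD(2)[OF P]
  have inv: "AE \<omega> in P. suspension M V (suspension M U \<omega>) = \<omega>"
    if U: "U \<in> measurable M M" and V: "V \<in> measurable M M" and VU: "AE x in M. V (U x) = x" for U V
    using laplace_law_AE_AE[OF P VU] AE_space
  proof eventually_elim
    case (elim \<omega>)
    then have w: "\<omega> \<in> counting_measures M" by (simp add: laplace_lawD(3)[OF P])
    have Uw: "U \<in> measurable \<omega> M" by (rule measurable_counting_measures[OF w U])
    have "suspension M V (suspension M U \<omega>) = distr \<omega> M (\<lambda>x. V (U x))"
      unfolding suspension_def by (simp add: distr_distr[OF V Uw] comp_def)
    also have "\<dots> = distr \<omega> M (\<lambda>x. x)"
      using elim(1) measurable_compose[OF Uw V] counting_measures_sets[OF w]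
      by (intro distr_cong_AE) (auto cong: measurable_cong_sets)
    also have "\<dots> = \<omega>" by (simp add: distr_id2 counting_measures_sets[OF w])
    finally show ?case .
  qed
  have "suspension M R \<in> measurable P P"
    using measurable_suspension[OF Rm] by (simp cong: measurable_cong_sets)
  then show ?thesis
    unfolding ae_inverse_def using inv[OF T Rm RT] inv[OF Rm T TR] by blast
qed

text \<open>For almost every \<omega>, integrating the series of products over \<eta> returns the
  convergent series at s, so the series of products converges for almost every pair. By uniqueness
  of laws the superposed pair is distributed according to \<open>Pt\<close>.\<close>

lemma susp_density_sum_mono:
  assumes M: "sigma_finite_measure M" and ne: "space M \<noteq> {}"
    and U [measurable]: "\<And>n. U n \<in> measurable M M" and l [measurable]: "\<And>n. l n \<in> borel_measurable M"
    and int: "\<And>n. integrable M (\<lambda>x. exp (l n x) - 1)" and L: "\<And>n x. \<bar>l n x\<bar> \<le> L"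
    and dens: "\<And>n. distr M M (U n) = density M (\<lambda>x. ennreal (exp (l n x)))"
    and st: "0 < s" "s < t" and Ps: "laplace_law M s Ps" and Pt: "laplace_law M t Pt"
    and fin: "AE \<omega> in Ps. (\<Sum>n. susp_density M s (l n) \<omega>) < \<infinity>"
  shows "AE \<omega> in Pt. (\<Sum>n. susp_density M t (l n) \<omega>) < \<infinity>"
proof -
  define r where "r = t - s"
  have r: "0 < r" "t = s + r" using st by (auto simp: r_def)
  obtain Q where Q: "laplace_law M r Q" using laplace_law_exists[OF M ne r(1)] by blast
  let ?C = "configuration_space M"
  note sP [measurable_cong] = laplace_lawD(2)[OF Ps] and sQ [measurable_cong] = laplace_lawD(2)[OF Q]
  interpret P: prob_space Ps using Ps by (rule laplace_lawD)
  interpret Q: prob_space Q using Q by (rule laplace_lawD)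
  interpret PQ: pair_prob_space Ps Q ..
  have m [measurable]: "(\<lambda>(\<omega>, \<eta>). superpose M \<omega> \<eta>) \<in> measurable (Ps \<Otimes>\<^sub>M Q) ?C"
    using measurable_superpose[of M] by (simp cong: measurable_cong_sets)
  have [measurable]: "susp_density M v (l n) \<in> borel_measurable ?C" for v n
    by measurable
  \<comment> \<open>The function is the density of an image of the probability \<open>Q\<close>, so
    its total mass is 1.\<close>
  have one: "(\<integral>\<^sup>+\<eta>. susp_density M r (l n) \<eta> \<partial>Q) = 1" for n
  proof -
    have mS: "suspension M (U n) \<in> measurable Q Q"
      using measurable_suspension[OF U[of n]] by (simp cong: measurable_cong_sets)
    have eq: "distr Q Q (suspension M (U n)) = density Q (susp_density M r (l n))"
      using r by (intro distr_suspension[OF Q _ U l int L dens]) auto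
    interpret D: prob_space "distr Q Q (suspension M (U n))" by (rule Q.prob_space_distr) (rule mS)
    have "1 = emeasure (distr Q Q (suspension M (U n))) (space Q)" using D.emeasure_space_1 by simp
    also have "\<dots> = (\<integral>\<^sup>+\<eta>. susp_density M r (l n) \<eta> * indicator (space Q) \<eta> \<partial>Q)"
      unfolding eq by (subst emeasure_density) auto
    also have "\<dots> = (\<integral>\<^sup>+\<eta>. susp_density M r (l n) \<eta> \<partial>Q)" by (intro nn_integral_cong) auto
    finally show ?thesis by simp
  qed
  have "AE x in Ps \<Otimes>\<^sub>M Q. (\<Sum>n. susp_density M s (l n) (fst x) * susp_density M r (l n) (snd x)) < \<infinity>"
  proof (rule PQ.AE_pair_measure)
    show "AE \<omega> in Ps. AE \<eta> in Q. (\<Sum>n. susp_density M s (l n) (fst (\<omega>, \<eta>)) * susp_density M r (l n) (snd (\<omega>, \<eta>))) < \<infinity>"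
      using fin
    proof eventually_elim
      case (elim \<omega>)
      have "(\<integral>\<^sup>+\<eta>. (\<Sum>n. susp_density M s (l n) \<omega> * susp_density M r (l n) \<eta>) \<partial>Q) = (\<Sum>n. susp_density M s (l n) \<omega>)"
        by (subst nn_integral_suminf) (auto simp: nn_integral_cmult one)
      then have "AE \<eta> in Q. (\<Sum>n. susp_density M s (l n) \<omega> * susp_density M r (l n) \<eta>) \<noteq> \<infinity>"
        using elim by (intro nn_integral_PInf_AE) auto
      then show ?case by eventually_elim (simp add: less_top)
    qed
  qed measurable
  then have "AE x in Ps \<Otimes>\<^sub>M Q. (\<Sum>n. susp_density M t (l n) (case x of (\<omega>, \<eta>) \<Rightarrow> superpose M \<omega> \<eta>)) < \<infinity>"
    using AE_space
  proof eventually_elim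
    case (elim x)
    then show ?case
      by (auto simp: space_pair_measure laplace_lawD(3)[OF Ps] laplace_lawD(3)[OF Q] r(2) susp_density_superpose)
  qed
  then have "AE \<omega> in distr (Ps \<Otimes>\<^sub>M Q) ?C (\<lambda>(\<omega>, \<eta>). superpose M \<omega> \<eta>). (\<Sum>n. susp_density M t (l n) \<omega>) < \<infinity>"
    by (subst AE_distr_iff) auto
  moreover have "distr (Ps \<Otimes>\<^sub>M Q) ?C (\<lambda>(\<omega>, \<eta>). superpose M \<omega> \<eta>) = Pt"
    using laplace_law_superpose[OF Ps Q] st r Pt by (intro laplace_law_unique[of M t]) auto
  ultimately show ?thesis by (simp only:)
qed

theorem theoremC:
  fixes M :: "'a measure" and T :: "'a \<Rightarrow> 'a" and \<alpha> :: real
  assumes "standard_borel_space M"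
    and "non_atomic M"
    and "sigma_finite_measure M"
    and "emeasure M (space M) = \<infinity>"
    and "T \<in> Aut1 M"
    and "\<alpha> > 1"
    and "\<forall>n>0. AE x in M. ennreal (inverse \<alpha>) < nonsing_deriv M (T ^^ n) x \<and>
                          nonsing_deriv M (T ^^ n) x < ennreal \<alpha>"
  shows "\<exists>t\<^sub>0 :: ennreal. \<forall>t::real. \<forall>P. 0 < t \<and> poisson_law (scale_measure (ennreal t) M) P \<longrightarrow>
           (ennreal t < t\<^sub>0 \<longrightarrow> conservative P (suspension M T)) \<and>
           (t\<^sub>0 < ennreal t \<longrightarrow> totally_dissipative P (suspension M T))"
proof -
  note M = assms(3)
  have T: "T \<in> measurable M M" using assms(5) by (simp add: Aut1_def Aut_def)
  obtain R where R: "ae_inverse M T R" using assms(5) by (auto simp: Aut1_def Aut_def)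
  have ne: "space M \<noteq> {}" using assms(4) by auto
  obtain l where l: "\<And>n. l n \<in> borel_measurable M" and L: "\<And>n x. \<bar>l n x\<bar> \<le> ln \<alpha>"
    and int: "\<And>n. integrable M (\<lambda>x. exp (l n x) - 1)"
    and dens: "\<And>n. distr M M (T ^^ n) = density M (\<lambda>x. ennreal (exp (l n x)))"
    by (rule log_derivatives[OF M assms(5-7)]) blast
  let ?S = "suspension M T"
  let ?D = "\<lambda>t n. susp_density M t (l n)"
  define G where "G = {s. 0 < s \<and> (\<exists>P. laplace_law M s P \<and> (AE \<omega> in P. (\<Sum>n. ?D s n \<omega>) < \<infinity>))}"
  \<comment> \<open>If no parameter gives convergence, the infimum of the empty set is \<infinity>,
    and the suspension is conservative for every t.\<close>
  define t0 where "t0 = Inf (ennreal ` G)"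
  show ?thesis
  proof (intro exI[of _ t0] allI impI)
    fix t P assume "0 < t \<and> poisson_law (scale_measure (ennreal t) M) P"
    then have t: "0 < t" and P: "laplace_law M t P" using poisson_law_laplace_law[OF _ M] by auto
    note [measurable_cong] = laplace_lawD(2)[OF P]
    have prob: "prob_space P" by (rule laplace_lawD(1)[OF P])
    have Sm: "?S \<in> measurable P P"
      using measurable_suspension[OF T] by (simp cong: measurable_cong_sets)
    have Dm: "?D t n \<in> borel_measurable P" for n
      using measurable_susp_density[OF l, of t n] by (simp cong: measurable_cong_sets)
    have distr: "distr P P (?S ^^ n) = density P (?D t n)" for n
    proof -
      have "distr P P (?S ^^ n) = distr P P (suspension M (T ^^ n))"
        by (rule distr_cong) (auto simp: suspension_funpow[OF T] laplace_lawD(3)[OF P])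
      also have "\<dots> = density P (?D t n)"
        using t by (intro distr_suspension[OF P _ measurable_compose_n[OF T] l int L dens]) simp
      finally show ?thesis .
    qed
    show "(ennreal t < t0 \<longrightarrow> conservative P ?S) \<and> (t0 < ennreal t \<longrightarrow> totally_dissipative P ?S)"
    proof (intro conjI impI)
      assume "ennreal t < t0"
      then have "t \<notin> G" unfolding t0_def by (meson INF_lower leD)
      then have "\<not> (AE \<omega> in P. (\<Sum>n. ?D t n \<omega>) < \<infinity>)" using t P by (auto simp: G_def)
      then have "AE \<omega> in P. (\<Sum>n. ?D t n \<omega>) = \<infinity>"
        using susp_density_zero_one[where l=l, OF P M l L] by blast
      then show "conservative P ?S" by (rule conservativeI[OF prob Sm Dm distr])
    next
      assume "t0 < ennreal t"
      then obtain s where s: "s \<in> G" "ennreal s < ennreal t" unfolding t0_def by (auto simp: Inf_less_iff)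
      then obtain Ps where Ps: "0 < s" "laplace_law M s Ps" "AE \<omega> in Ps. (\<Sum>n. ?D s n \<omega>) < \<infinity>"
        by (auto simp: G_def)
      have "s < t" using s(2) Ps(1) by (simp add: ennreal_less_iff)
      have "AE \<omega> in P. (\<Sum>n. ?D t n \<omega>) < \<infinity>"
        by (rule susp_density_sum_mono[OF M ne measurable_compose_n[OF T] l int L dens Ps(1) \<open>s < t\<close> Ps(2) P Ps(3)])
      then show "totally_dissipative P ?S"
        by (rule totally_dissipativeI[OF prob Sm ae_inverse_suspension[OF P R T] Dm distr
              susp_density_pos[OF P l int L]])
    qed
  qed
qed

end
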